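(* Let $n\ge 1$, and let $[u_0,u_1]\in \left(H^1(\mathbf{R}^n)\cap L^1(\mathbf{R}^n)\right)\times\left(L^2(\mathbf{R}^n)\cap L^{1,1}(\mathbf{R}^n)\right)$. Then the unique solution $u(t,x)$ of the Cauchy problem $$u_{tt}-\Delta u+Lu_t=0\ \text{ in } (0,\infty)\times\mathbf{R}^n,\qquad u(0,x)=u_0(x),\quad u_t(0,x)=u_1(x),\quad x\in\mathbf{R}^n,$$ where $L=\log(I-\Delta)$, satisfies $$\left\Vert u(t,\cdot)-\left(\int_{\mathbf{R}^n}u_1(x)\,dx\right)\mathcal{F}^{-1}_{\xi\to x}\left((1+|\xi|^2)^{-\frac t2}\frac{\sin(|\xi|t)}{|\xi|}\right)\right\Vert_{L^2}\le I_0\,t^{-\frac n4}\qquad (t\gg 1),$$ where $$I_0:=\Vert u_0\Vert_{L^2}+\Vert u_1\Vert_{L^2}+\Vert u_0\Vert_{L^1}+\Vert(1+|x|)u_1\Vert_{L^1}.$$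
   Context: The Fourier transform is $\hat f(\xi)=\int_{\mathbf{R}^n}e^{-ix\cdot\xi}f(x)\,dx$, with inverse $\mathcal{F}^{-1}_{\xi\to x}$. The operator $L=\log(I-\Delta)$ is the Fourier multiplier $Lf=\mathcal{F}^{-1}_{\xi\to x}\left(\log(1+|\xi|^2)\hat f(\xi)\right)$ with domain $D(L)=\{f\in L^2(\mathbf{R}^n):\int_{\mathbf{R}^n}(\log(1+|\xi|^2))^2|\hat f(\xi)|^2d\xi<\infty\}$; it is nonnegative and self-adjoint in $L^2(\mathbf{R}^n)$. The weighted space is $L^{1,1}(\mathbf{R}^n)=\{f\in L^1(\mathbf{R}^n):\int_{\mathbf{R}^n}(1+|x|)|f(x)|\,dx<\infty\}$. The solution is the unique mild solution $u\in C([0,\infty);H^1(\mathbf{R}^n))\cap C^1([0,\infty);L^2(\mathbf{R}^n))$, i.e. the first component of $e^{t\mathcal{A}}[u_0,u_1]$, where $e^{t\mathcal{A}}$ is the $C_0$-semigroup on $H^1(\mathbf{R}^n)\times L^2(\mathbf{R}^n)$ generated by $\mathcal{A}[u,v]=[v,\Delta u-Lv]$ with $D(\mathcal{A})=H^2(\mathbf{R}^n)\times H^1(\mathbf{R}^n)$. The notation "$(t\gg 1)$" means that the inequality holds for all sufficiently large $t$. *)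

theory Defs
  imports "HOL-Analysis.Analysis"
begin

text \<open>
  Elements of the Lebesgue spaces are represented by complex-valued Borel functions (every almost
  everywhere class contains one); equality of elements is equality almost everywhere.  The space
  $\mathbf{R}^n$ is an arbitrary Euclidean space of dimension \<open>DIM('a)\<close>.
\<close>

definition L1_space :: "('a::euclidean_space \<Rightarrow> complex) set" where
  "L1_space = {f. integrable lborel f}"

definition L1_norm :: "('a::euclidean_space \<Rightarrow> complex) \<Rightarrow> real" where
  "L1_norm f = (\<integral>x. cmod (f x) \<partial>lborel)"

definition L11_space :: "('a::euclidean_space \<Rightarrow> complex) set" where
  "L11_space = {f \<in> L1_space. integrable lborel (\<lambda>x. (1 + norm x) * cmod (f x))}"

definition L2_space :: "('a::euclidean_space \<Rightarrow> complex) set" where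
  "L2_space = {f \<in> borel_measurable lborel. integrable lborel (\<lambda>x. (cmod (f x))\<^sup>2)}"

definition L2_norm :: "('a::euclidean_space \<Rightarrow> complex) \<Rightarrow> real" where
  "L2_norm f = sqrt (\<integral>x. (cmod (f x))\<^sup>2 \<partial>lborel)"

definition truncated_fourier ::
    "real \<Rightarrow> ('a::euclidean_space \<Rightarrow> complex) \<Rightarrow> 'a \<Rightarrow> complex" where
  "truncated_fourier R f \<xi> =
     (LINT x:cball 0 R|lborel. exp (- \<i> * complex_of_real (x \<bullet> \<xi>)) * f x)"

text \<open>
  The Fourier transform on $L^2$, in Plancherel's form: the $L^2$-limit of the integrals over balls,
  which is unique up to null sets.  For \<open>f\<close> in $L^1 \cap L^2$ it agrees almost everywhere with
  $\int e^{-i x \cdot \xi} f(x)\,dx$.  The squared distance is a \<open>nn_integral\<close>, so that a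
  difference outside of $L^2$ has infinite (rather than zero) distance.
\<close>
definition fourier :: "('a::euclidean_space \<Rightarrow> complex) \<Rightarrow> 'a \<Rightarrow> complex" where
  "fourier f = (SOME g. g \<in> L2_space \<and>
     ((\<lambda>R. \<integral>\<^sup>+\<xi>. ennreal ((cmod (truncated_fourier R f \<xi> - g \<xi>))\<^sup>2) \<partial>lborel)
        \<longlongrightarrow> 0) at_top)"

definition inv_fourier :: "('a::euclidean_space \<Rightarrow> complex) \<Rightarrow> 'a \<Rightarrow> complex" where
  "inv_fourier g = (SOME f. f \<in> L2_space \<and> (AE \<xi> in lborel. fourier f \<xi> = g \<xi>))"

definition fourier_multiplier ::
    "('a::euclidean_space \<Rightarrow> real) \<Rightarrow> ('a \<Rightarrow> complex) \<Rightarrow> 'a \<Rightarrow> complex" where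
  "fourier_multiplier m f = inv_fourier (\<lambda>\<xi>. complex_of_real (m \<xi>) * fourier f \<xi>)"

definition sobolev_space :: "real \<Rightarrow> ('a::euclidean_space \<Rightarrow> complex) set" where
  "sobolev_space s = {f \<in> L2_space.
     integrable lborel (\<lambda>\<xi>. (1 + (norm \<xi>)\<^sup>2) powr s * (cmod (fourier f \<xi>))\<^sup>2)}"

definition sobolev_norm :: "real \<Rightarrow> ('a::euclidean_space \<Rightarrow> complex) \<Rightarrow> real" where
  "sobolev_norm s f =
     sqrt (\<integral>\<xi>. (1 + (norm \<xi>)\<^sup>2) powr s * (cmod (fourier f \<xi>))\<^sup>2 \<partial>lborel)"

text \<open>On $H^2$ the (distributional) Laplacian is the multiplier with symbol $-|\xi|^2$.\<close>
definition laplacian :: "('a::euclidean_space \<Rightarrow> complex) \<Rightarrow> 'a \<Rightarrow> complex" where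
  "laplacian = fourier_multiplier (\<lambda>\<xi>. - (norm \<xi>)\<^sup>2)"

text \<open>
  The operator $L = \log(I - \Delta)$.  It is applied below only to elements of $H^1$, which is
  contained in its domain.
\<close>
definition log_op :: "('a::euclidean_space \<Rightarrow> complex) \<Rightarrow> 'a \<Rightarrow> complex" where
  "log_op = fourier_multiplier (\<lambda>\<xi>. ln (1 + (norm \<xi>)\<^sup>2))"

type_synonym 'a state = "('a \<Rightarrow> complex) \<times> ('a \<Rightarrow> complex)"

definition state_eq :: "'a::euclidean_space state \<Rightarrow> 'a state \<Rightarrow> bool" where
  "state_eq U V \<longleftrightarrow> (AE x in lborel. fst U x = fst V x) \<and> (AE x in lborel. snd U x = snd V x)"

definition state_add :: "'a::euclidean_space state \<Rightarrow> 'a state \<Rightarrow> 'a state" where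
  "state_add U V = (\<lambda>x. fst U x + fst V x, \<lambda>x. snd U x + snd V x)"

definition state_scale :: "complex \<Rightarrow> 'a::euclidean_space state \<Rightarrow> 'a state" where
  "state_scale c U = (\<lambda>x. c * fst U x, \<lambda>x. c * snd U x)"

definition state_diff :: "'a::euclidean_space state \<Rightarrow> 'a state \<Rightarrow> 'a state" where
  "state_diff U V = (\<lambda>x. fst U x - fst V x, \<lambda>x. snd U x - snd V x)"

text \<open>
  Strongly continuous semigroups of bounded linear operators on a space \<open>X\<close> of such pairs with norm
  \<open>N\<close>.  The identities hold modulo null sets; by linearity and boundedness each \<open>T t\<close> respects
  almost everywhere equality.
\<close>
definition C0_semigroup ::
    "'a::euclidean_space state set \<Rightarrow> ('a state \<Rightarrow> real) \<Rightarrow> (real \<Rightarrow> 'a state \<Rightarrow> 'a state) \<Rightarrow> bool" where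
  "C0_semigroup X N T \<longleftrightarrow>
     (\<forall>t\<ge>0. \<forall>U\<in>X. T t U \<in> X) \<and>
     (\<forall>t\<ge>0. \<forall>U\<in>X. \<forall>V\<in>X. state_eq (T t (state_add U V)) (state_add (T t U) (T t V))) \<and>
     (\<forall>t\<ge>0. \<forall>c. \<forall>U\<in>X. state_eq (T t (state_scale c U)) (state_scale c (T t U))) \<and>
     (\<forall>t\<ge>0. \<exists>M. \<forall>U\<in>X. N (T t U) \<le> M * N U) \<and>
     (\<forall>U\<in>X. state_eq (T 0 U) U) \<and>
     (\<forall>s\<ge>0. \<forall>t\<ge>0. \<forall>U\<in>X. state_eq (T (s + t) U) (T s (T t U))) \<and>
     (\<forall>U\<in>X. ((\<lambda>t. N (state_diff (T t U) U)) \<longlongrightarrow> 0) (at_right 0))"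

text \<open>
  The generator of \<open>T\<close> is the operator \<open>A\<close> with domain exactly \<open>D\<close>: the right difference quotients
  of \<open>T\<close> at \<open>U\<close> converge if and only if \<open>U\<close> is in \<open>D\<close>, and then the limit is \<open>A U\<close>.
\<close>
definition generated_by ::
    "'a::euclidean_space state set \<Rightarrow> ('a state \<Rightarrow> real) \<Rightarrow> (real \<Rightarrow> 'a state \<Rightarrow> 'a state) \<Rightarrow>
     'a state set \<Rightarrow> ('a state \<Rightarrow> 'a state) \<Rightarrow> bool" where
  "generated_by X N T D A \<longleftrightarrow>
     (\<forall>U\<in>X. \<forall>W\<in>X.
        ((\<lambda>h. N (state_diff (state_scale (complex_of_real (1 / h)) (state_diff (T h U) U)) W))
           \<longlongrightarrow> 0) (at_right 0)
        \<longleftrightarrow> U \<in> D \<and> state_eq W (A U))"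

definition energy_space :: "'a::euclidean_space state set" where
  "energy_space = sobolev_space 1 \<times> L2_space"

definition energy_norm :: "'a::euclidean_space state \<Rightarrow> real" where
  "energy_norm U = sqrt ((sobolev_norm 1 (fst U))\<^sup>2 + (L2_norm (snd U))\<^sup>2)"

definition wave_domain :: "'a::euclidean_space state set" where
  "wave_domain = sobolev_space 2 \<times> sobolev_space 1"

definition wave_op :: "'a::euclidean_space state \<Rightarrow> 'a state" where
  "wave_op U = (snd U, \<lambda>x. laplacian (fst U) x - log_op (snd U) x)"

text \<open>
  Mild solutions of $u_{tt} - \Delta u + L u_t = 0$, $u(0) = u_0$, $u_t(0) = u_1$: the first component
  of $e^{t\mathcal{A}}[u_0,u_1]$, which determines \<open>u t\<close> up to null sets.
\<close>
definition mild_solution ::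
    "('a::euclidean_space \<Rightarrow> complex) \<Rightarrow> ('a \<Rightarrow> complex) \<Rightarrow> (real \<Rightarrow> 'a \<Rightarrow> complex) \<Rightarrow> bool" where
  "mild_solution u0 u1 u \<longleftrightarrow>
     (\<exists>T. C0_semigroup energy_space energy_norm T \<and>
          generated_by energy_space energy_norm T wave_domain wave_op \<and>
          (\<forall>t\<ge>0. u t \<in> sobolev_space 1 \<and> (AE x in lborel. u t x = fst (T t (u0, u1)) x)))"

end

theory Submission
  imports Defs "HOL-Probability.Characteristic_Functions" "HOL-Probability.Sinc_Integral"
    "HOL-Real_Asymp.Real_Asymp"
begin

text \<open>
  On the Fourier side the equation becomes \<open>w'' + l w' + r\<^sup>2 w = 0\<close> with \<open>r = norm \<xi>\<close> and
  \<open>l = ln (1 + r\<^sup>2)\<close>.  Since \<open>l \<le> r\<close>, it is underdamped at every frequency: its solutions oscillate with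
  frequency \<open>b = sqrt (r\<^sup>2 - l\<^sup>2 / 4) \<ge> (sqrt 3 / 2) r\<close> and decay like \<open>exp (- l t / 2) = (1 + r\<^sup>2) powr (- t / 2)\<close>.
  The semigroup is identified with this explicit solution on the dense domain of its generator; this
  needs Plancherel's theorem and the local boundedness of strongly continuous semigroups.

  Writing \<open>A\<close> for the sum of the two \<open>L\<^sup>1\<close> norms in \<open>I0\<close>, the bounds \<open>l \<le> min r r\<^sup>2\<close> show that the
  Fourier transform of the difference is at most
  \<open>(2 / sqrt 3) A (1 + l t / 4) exp (- l t / 2) \<le> (2 / sqrt 3) A exp (- l t / 4)\<close>.
  The integral of the square of the right-hand side is asymptotically at most \<open>(4 / 3) A\<^sup>2 (4 pi / t) powr (n / 2)\<close>,
  and division by the Plancherel factor \<open>(2 pi) ^ n\<close> leaves a constant below \<open>1\<close>.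
\<close>

section \<open>The Hilbert space of square integrable functions\<close>

text \<open>The semigroup is given only through its generator, and on functions determined up to
  null sets. Two devices deal with this. \<open>encode\<close> carries states isometrically to
  \<open>l2 \<times> l2\<close>, where equality almost everywhere becomes equality and Banach space
  arguments apply. The explicit solution is then recognized without being shown to solve anything in
  the energy space: its propagator over the remaining time \<open>t - s\<close> is applied to the
  given orbit at time \<open>s\<close>, and the outcome does not depend on \<open>s\<close>. The
  unbounded symbols and the factor \<open>1 / freq\<close>, singular at the origin, force this to be
  done on annuli of frequencies, which exhaust all \<open>\<xi> \<noteq> 0\<close>. The claim has
  constant 1, so constants must be followed exactly. Half of the exponent is given up to absorb the
  linear growth in \<open>t\<close>, and comparison with a Gaussian gives up another factor 2; what
  remains to be true is \<open>4 / 3 < pi powr (n / 2)\<close>, which is tightest for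
  \<open>n = 1\<close>.\<close>

lemma L2_spaceI:
  "f \<in> borel_measurable borel \<Longrightarrow> integrable lborel (\<lambda>x. (cmod (f x))\<^sup>2) \<Longrightarrow> f \<in> L2_space"
  by (simp add: L2_space_def)

lemma L2_space_measurable: "f \<in> L2_space \<Longrightarrow> f \<in> borel_measurable borel"
  by (simp add: L2_space_def)

lemma L2_space_integrable: "f \<in> L2_space \<Longrightarrow> integrable lborel (\<lambda>x. (cmod (f x))\<^sup>2)"
  by (simp add: L2_space_def)

lemma L2_space_bound:
  assumes "f \<in> borel_measurable borel" "g \<in> L2_space" "AE x in lborel. cmod (f x) \<le> C * cmod (g x)"
  shows "f \<in> L2_space"
proof (rule L2_spaceI)
  note [measurable] = assms(1) L2_space_measurable[OF assms(2)]
  have "integrable lborel (\<lambda>x. C\<^sup>2 * (cmod (g x))\<^sup>2)"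
    using L2_space_integrable[OF assms(2)] by simp
  then show "integrable lborel (\<lambda>x. (cmod (f x))\<^sup>2)"
  proof (rule Bochner_Integration.integrable_bound)
    show "AE x in lborel. norm ((cmod (f x))\<^sup>2) \<le> norm (C\<^sup>2 * (cmod (g x))\<^sup>2)"
      using assms(3) by eventually_elim (simp add: power_mono flip: power_mult_distrib)
  qed simp
qed fact

lemma cmod_add_square_le: "(cmod (a + b))\<^sup>2 \<le> 2 * (cmod a)\<^sup>2 + 2 * (cmod b)\<^sup>2"
proof -
  have "(cmod (a + b))\<^sup>2 \<le> (cmod a + cmod b)\<^sup>2"
    by (simp add: norm_triangle_ineq power_mono)
  also have "\<dots> \<le> 2 * (cmod a)\<^sup>2 + 2 * (cmod b)\<^sup>2"
    using sum_squares_bound[of "cmod a" "cmod b"] by (simp add: power2_sum)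
  finally show ?thesis .
qed

lemma L2_space_zero: "(\<lambda>x. 0) \<in> L2_space"
  by (rule L2_spaceI) auto

lemma L2_space_add:
  assumes "f \<in> L2_space" "g \<in> L2_space"
  shows "(\<lambda>x. f x + g x) \<in> L2_space"
proof (rule L2_spaceI)
  note [measurable] = L2_space_measurable[OF assms(1)] L2_space_measurable[OF assms(2)]
  show "(\<lambda>x. f x + g x) \<in> borel_measurable borel" by measurable
  have "integrable lborel (\<lambda>x. 2 * (cmod (f x))\<^sup>2 + 2 * (cmod (g x))\<^sup>2)"
    using L2_space_integrable[OF assms(1)] L2_space_integrable[OF assms(2)] by simp
  then show "integrable lborel (\<lambda>x. (cmod (f x + g x))\<^sup>2)"
    by (rule Bochner_Integration.integrable_bound) (auto intro!: cmod_add_square_le)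
qed

lemma L2_space_cmult: "f \<in> L2_space \<Longrightarrow> (\<lambda>x. c * f x) \<in> L2_space"
  by (rule L2_space_bound[of _ f "cmod c"]) (auto simp: norm_mult dest: L2_space_measurable)

lemma L2_space_diff:
  assumes "f \<in> L2_space" "g \<in> L2_space"
  shows "(\<lambda>x. f x - g x) \<in> L2_space"
  using L2_space_add[OF assms(1) L2_space_cmult[OF assms(2), of "-1"]] by simp

lemma L2_space_uminus: "f \<in> L2_space \<Longrightarrow> (\<lambda>x. - f x) \<in> L2_space"
  using L2_space_cmult[of f "-1"] by simp

lemma L2_space_scaleR: "f \<in> L2_space \<Longrightarrow> (\<lambda>x. c *\<^sub>R f x) \<in> L2_space"
  using L2_space_cmult[of f "complex_of_real c"] by (simp add: scaleR_conv_of_real)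

lemma L2_space_inner_integrable:
  assumes "f \<in> L2_space" "g \<in> L2_space"
  shows "integrable lborel (\<lambda>x. f x \<bullet> g x)"
proof -
  note [measurable] = L2_space_measurable[OF assms(1)] L2_space_measurable[OF assms(2)]
  have "integrable lborel (\<lambda>x. (cmod (f x))\<^sup>2 + (cmod (g x))\<^sup>2)"
    using L2_space_integrable[OF assms(1)] L2_space_integrable[OF assms(2)] by simp
  then show ?thesis
  proof (rule Bochner_Integration.integrable_bound)
    have "\<bar>f x \<bullet> g x\<bar> \<le> (cmod (f x))\<^sup>2 + (cmod (g x))\<^sup>2" for x
      using Cauchy_Schwarz_ineq2[of "f x" "g x"] sum_squares_bound[of "cmod (f x)" "cmod (g x)"]
        mult_nonneg_nonneg[OF norm_ge_zero norm_ge_zero, of "f x" "g x"]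
      by linarith
    then show "AE x in lborel. norm (f x \<bullet> g x) \<le> norm ((cmod (f x))\<^sup>2 + (cmod (g x))\<^sup>2)"
      by simp
  qed simp
qed

section \<open>Square integrable functions modulo null sets as a real Hilbert space\<close>

definition l2_rel :: "('a::euclidean_space \<Rightarrow> complex) \<Rightarrow> ('a \<Rightarrow> complex) \<Rightarrow> bool" where
  "l2_rel f g \<longleftrightarrow> f \<in> L2_space \<and> g \<in> L2_space \<and> (AE x in lborel. f x = g x)"

\<comment> \<open>\<open>l2_rel\<close> is reflexive exactly on \<open>L2_space\<close>, so the
  partial quotient consists of classes of square integrable functions only.\<close>
quotient_type (overloaded) 'a l2 = "'a::euclidean_space \<Rightarrow> complex" / partial: l2_rel
  morphisms rep_l2 to_l2
proof (rule part_equivpI)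
  show "\<exists>f. l2_rel f (f :: 'a \<Rightarrow> complex)"
    using L2_space_zero by (auto simp: l2_rel_def)
  show "symp (l2_rel :: ('a \<Rightarrow> complex) \<Rightarrow> _)"
    by (auto simp: l2_rel_def symp_def)
  show "transp (l2_rel :: ('a \<Rightarrow> complex) \<Rightarrow> _)"
    by (auto simp: l2_rel_def transp_def)
qed

lemma rep_l2_L2 [simp]: "rep_l2 x \<in> L2_space"
  using Quotient_rep_reflp[OF Quotient_l2, of x] by (simp add: l2_rel_def)

lemma rep_l2_measurable [measurable]: "rep_l2 x \<in> borel_measurable borel"
  by (rule L2_space_measurable) simp

lemma to_l2_rep_l2 [simp]: "to_l2 (rep_l2 x) = x"
  by (rule Quotient_abs_rep[OF Quotient_l2])

lemma to_l2_eq_iff: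
  "f \<in> L2_space \<Longrightarrow> g \<in> L2_space \<Longrightarrow> to_l2 f = to_l2 g \<longleftrightarrow> (AE x in lborel. f x = g x)"
  using Quotient_rel[OF Quotient_l2, of f g] by (auto simp: l2_rel_def)

lemma to_l2_cong: "AE x in lborel. f x = g x \<Longrightarrow> f \<in> L2_space \<Longrightarrow> g \<in> L2_space \<Longrightarrow> to_l2 f = to_l2 g"
  by (simp add: to_l2_eq_iff)

lemma rep_l2_to_l2: "f \<in> L2_space \<Longrightarrow> AE x in lborel. rep_l2 (to_l2 f) x = f x"
  using to_l2_eq_iff[of "rep_l2 (to_l2 f)" f] by simp

lemma l2_cases: obtains f where "f \<in> L2_space" "x = to_l2 f"
  using that[of "rep_l2 x"] by simp

text \<open>The inner product is the real part of the Hermitian one, since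
  \<open>z \<bullet> w\<close> is \<open>Re (z * cnj w)\<close> for complex numbers. The norm is the
  same, and polarization and adjoints work with it; only multiplication by non-real scalars has to
  be treated separately.\<close>

instantiation l2 :: (euclidean_space) real_inner
begin

lift_definition zero_l2 :: "'a l2" is "\<lambda>x. 0"
  by (simp add: l2_rel_def L2_space_zero)

lift_definition plus_l2 :: "'a l2 \<Rightarrow> 'a l2 \<Rightarrow> 'a l2" is "\<lambda>f g x. f x + g x"
proof -
  fix f f' g g' :: "'a \<Rightarrow> complex"
  assume a: "l2_rel f f'" "l2_rel g g'"
  then have "AE x in lborel. f x = f' x" "AE x in lborel. g x = g' x"
    by (auto simp: l2_rel_def)
  then have "AE x in lborel. f x + g x = f' x + g' x"
    by eventually_elim simp
  then show "l2_rel (\<lambda>x. f x + g x) (\<lambda>x. f' x + g' x)"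
    using a by (simp add: l2_rel_def L2_space_add)
qed

lift_definition minus_l2 :: "'a l2 \<Rightarrow> 'a l2 \<Rightarrow> 'a l2" is "\<lambda>f g x. f x - g x"
proof -
  fix f f' g g' :: "'a \<Rightarrow> complex"
  assume a: "l2_rel f f'" "l2_rel g g'"
  then have "AE x in lborel. f x = f' x" "AE x in lborel. g x = g' x"
    by (auto simp: l2_rel_def)
  then have "AE x in lborel. f x - g x = f' x - g' x"
    by eventually_elim simp
  then show "l2_rel (\<lambda>x. f x - g x) (\<lambda>x. f' x - g' x)"
    using a by (simp add: l2_rel_def L2_space_diff)
qed

lift_definition uminus_l2 :: "'a l2 \<Rightarrow> 'a l2" is "\<lambda>f x. - f x"
  by (auto simp: l2_rel_def L2_space_uminus)

lift_definition scaleR_l2 :: "real \<Rightarrow> 'a l2 \<Rightarrow> 'a l2" is "\<lambda>c f x. c *\<^sub>R f x"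
  by (auto simp: l2_rel_def L2_space_scaleR)

lift_definition inner_l2 :: "'a l2 \<Rightarrow> 'a l2 \<Rightarrow> real" is "\<lambda>f g. \<integral>x. f x \<bullet> g x \<partial>lborel"
proof -
  fix f f' g g' :: "'a \<Rightarrow> complex"
  assume a: "l2_rel f f'" "l2_rel g g'"
  have [measurable]: "f \<in> borel_measurable borel" "f' \<in> borel_measurable borel"
      "g \<in> borel_measurable borel" "g' \<in> borel_measurable borel"
    using a by (auto simp: l2_rel_def L2_space_measurable)
  show "(\<integral>x. f x \<bullet> g x \<partial>lborel) = (\<integral>x. f' x \<bullet> g' x \<partial>lborel)"
  proof (rule integral_cong_AE)
    have "AE x in lborel. f x = f' x" "AE x in lborel. g x = g' x"
      using a by (auto simp: l2_rel_def)
    then show "AE x in lborel. f x \<bullet> g x = f' x \<bullet> g' x"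
      by eventually_elim simp
  qed measurable
qed

definition norm_l2 :: "'a l2 \<Rightarrow> real" where "norm_l2 x = sqrt (x \<bullet> x)"
definition dist_l2 :: "'a l2 \<Rightarrow> 'a l2 \<Rightarrow> real" where "dist_l2 x y = norm (x - y)"
definition sgn_l2 :: "'a l2 \<Rightarrow> 'a l2" where "sgn_l2 x = scaleR (inverse (norm x)) x"
definition uniformity_l2 :: "('a l2 \<times> 'a l2) filter"
  where "uniformity_l2 = (INF e\<in>{0<..}. principal {(x, y). dist x y < e})"
definition open_l2 :: "'a l2 set \<Rightarrow> bool"
  where "open_l2 U = (\<forall>x\<in>U. eventually (\<lambda>(x', y). x' = x \<longrightarrow> y \<in> U) uniformity)"

lemma l2_op_to_l2:
  "f \<in> L2_space \<Longrightarrow> g \<in> L2_space \<Longrightarrow> to_l2 f + to_l2 g = to_l2 (\<lambda>x. f x + g x)"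
  "f \<in> L2_space \<Longrightarrow> g \<in> L2_space \<Longrightarrow> to_l2 f - to_l2 g = to_l2 (\<lambda>x. f x - g x)"
  "f \<in> L2_space \<Longrightarrow> - to_l2 f = to_l2 (\<lambda>x. - f x)"
  "f \<in> L2_space \<Longrightarrow> c *\<^sub>R to_l2 f = to_l2 (\<lambda>x. c *\<^sub>R f x)"
  "f \<in> L2_space \<Longrightarrow> g \<in> L2_space \<Longrightarrow> to_l2 f \<bullet> to_l2 g = (\<integral>x. f x \<bullet> g x \<partial>lborel)"
  by (simp_all add: plus_l2.abs_eq minus_l2.abs_eq uminus_l2.abs_eq scaleR_l2.abs_eq inner_l2.abs_eq l2_rel_def)

instance
proof
  fix x y z :: "'a l2" and a b :: real
  obtain f g h where fgh: "f \<in> L2_space" "g \<in> L2_space" "h \<in> L2_space"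
    and xyz: "x = to_l2 f" "y = to_l2 g" "z = to_l2 h"
    using l2_cases[of x] l2_cases[of y] l2_cases[of z] by metis
  note defs = xyz zero_l2_def l2_op_to_l2 fgh L2_space_zero L2_space_add L2_space_diff
    L2_space_uminus L2_space_scaleR
  show "x + y + z = x + (y + z)"
    by (simp add: defs add.assoc)
  show "x + y = y + x"
    by (simp add: defs add.commute)
  show "0 + x = x"
    by (simp add: defs)
  show "- x + x = 0"
    by (simp add: defs)
  show "x - y = x + - y"
    by (simp add: defs)
  show "a *\<^sub>R (x + y) = a *\<^sub>R x + a *\<^sub>R y"
    by (simp add: defs scaleR_add_right del: scaleR_conv_of_real)
  show "(a + b) *\<^sub>R x = a *\<^sub>R x + b *\<^sub>R x"
    by (simp add: defs scaleR_add_left)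
  show "a *\<^sub>R b *\<^sub>R x = (a * b) *\<^sub>R x"
    by (simp add: defs)
  show "1 *\<^sub>R x = x"
    by (simp add: defs)
  show "x \<bullet> y = y \<bullet> x"
    by (simp add: defs inner_commute)
  show "(x + y) \<bullet> z = x \<bullet> z + y \<bullet> z"
    by (simp add: defs inner_add_left L2_space_inner_integrable)
  show "(a *\<^sub>R x) \<bullet> y = a * (x \<bullet> y)"
    by (simp add: defs)
  show "0 \<le> x \<bullet> x"
    by (simp add: defs)
  show "x \<bullet> x = 0 \<longleftrightarrow> x = 0"
    by (simp add: defs to_l2_eq_iff integral_nonneg_eq_0_iff_AE L2_space_inner_integrable)
  show "dist x y = norm (x - y)" by (rule dist_l2_def)
  show "sgn x = scaleR (inverse (norm x)) x" by (rule sgn_l2_def)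
  show "(uniformity :: ('a l2 \<times> 'a l2) filter) = (INF e\<in>{0<..}. principal {(x, y). dist x y < e})"
    by (rule uniformity_l2_def)
  show "open U = (\<forall>x\<in>U. \<forall>\<^sub>F (x', y) in uniformity. x' = x \<longrightarrow> y \<in> U)" for U :: "'a l2 set"
    by (rule open_l2_def)
  show "norm x = sqrt (x \<bullet> x)" by (rule norm_l2_def)
qed

end

lemmas to_l2_add = l2_op_to_l2(1)[symmetric]
  and to_l2_diff = l2_op_to_l2(2)[symmetric]
  and to_l2_scaleR = l2_op_to_l2(4)[symmetric]
  and to_l2_inner = l2_op_to_l2(5)

lemma norm_to_l2: "f \<in> L2_space \<Longrightarrow> norm (to_l2 f) = L2_norm f"
  by (simp add: norm_l2_def to_l2_inner L2_norm_def power2_norm_eq_inner)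

lemma norm_to_l2_sq: "f \<in> L2_space \<Longrightarrow> (norm (to_l2 f))\<^sup>2 = (\<integral>x. (cmod (f x))\<^sup>2 \<partial>lborel)"
  by (simp add: norm_to_l2 L2_norm_def)

lemma L2_nn_integral:
  "f \<in> L2_space \<Longrightarrow> (\<integral>\<^sup>+x. ennreal ((cmod (f x))\<^sup>2) \<partial>lborel) = ennreal ((norm (to_l2 f))\<^sup>2)"
  by (simp add: norm_to_l2_sq nn_integral_eq_integral L2_space_integrable)

lemma L2_spaceI_nn:
  assumes "f \<in> borel_measurable borel" "(\<integral>\<^sup>+x. ennreal ((cmod (f x))\<^sup>2) \<partial>lborel) < \<infinity>"
  shows "f \<in> L2_space"
  using assms by (intro L2_spaceI integrableI_bounded) auto

text \<open>Riesz--Fischer: the rapid decay of the increments makes \<open>\<Sum>n. 4 ^ n * (cmod (f (Suc n) x - f n x))\<^sup>2\<close>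
  finite almost everywhere, which gives pointwise convergence; Fatou's lemma identifies the limit.\<close>
lemma l2_rapid_Cauchy_convergent:
  fixes X :: "nat \<Rightarrow> 'a::euclidean_space l2"
  assumes rapid: "\<And>n. (norm (X (Suc n) - X n))\<^sup>2 \<le> (1/8) ^ n" and cau: "Cauchy X"
  shows "convergent X"
proof -
  define f where "f n = rep_l2 (X n)" for n
  have f: "f n \<in> L2_space" "to_l2 (f n) = X n" for n by (auto simp: f_def)
  have [measurable]: "f n \<in> borel_measurable borel" for n by (simp add: f_def)
  have int: "(\<integral>\<^sup>+x. ennreal ((cmod (f n x - f m x))\<^sup>2) \<partial>lborel) = ennreal ((norm (X n - X m))\<^sup>2)" for n m
    using L2_nn_integral[OF L2_space_diff[OF f(1) f(1)], of n m] by (simp add: to_l2_diff f)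
  have "(\<integral>\<^sup>+x. (\<Sum>n. ennreal (4 ^ n * (cmod (f (Suc n) x - f n x))\<^sup>2)) \<partial>lborel)
      = (\<Sum>n. \<integral>\<^sup>+x. ennreal (4 ^ n * (cmod (f (Suc n) x - f n x))\<^sup>2) \<partial>lborel)"
    by (rule nn_integral_suminf) measurable
  also have "\<dots> = (\<Sum>n. ennreal (4 ^ n * (norm (X (Suc n) - X n))\<^sup>2))"
    by (simp add: ennreal_mult nn_integral_cmult int)
  also have "\<dots> \<le> (\<Sum>n. ennreal ((1/2) ^ n))"
  proof (rule suminf_le)
    fix n
    \<comment> \<open>The weight \<open>4 ^ n\<close> lies between two needs: against
      \<open>(1/8) ^ n\<close> it leaves a summable series, and
      \<open>4 ^ n * (cmod d)\<^sup>2 < 1\<close> still forces an increment \<open>d\<close> below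
      \<open>(1/2) ^ n\<close>.\<close>
    have "4 ^ n * (norm (X (Suc n) - X n))\<^sup>2 \<le> 4 ^ n * (1/8) ^ n"
      by (rule mult_left_mono[OF rapid]) simp
    also have "\<dots> = ((1/2) :: real) ^ n" by (simp flip: power_mult_distrib)
    finally show "ennreal (4 ^ n * (norm (X (Suc n) - X n))\<^sup>2) \<le> ennreal ((1/2) ^ n)"
      by (rule ennreal_leI)
  qed auto
  also have "\<dots> = ennreal (\<Sum>n. (1/2) ^ n)"
    by (rule suminf_ennreal_eq) (auto intro!: summable_sums summable_geometric)
  also have "\<dots> < \<infinity>" by simp
  finally have "AE x in lborel. (\<Sum>n. ennreal (4 ^ n * (cmod (f (Suc n) x - f n x))\<^sup>2)) \<noteq> \<infinity>"
    by (intro nn_integral_noteq_infinite) auto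
  then have conv: "AE x in lborel. convergent (\<lambda>n. f n x)"
  proof eventually_elim
    fix x assume "(\<Sum>n. ennreal (4 ^ n * (cmod (f (Suc n) x - f n x))\<^sup>2)) \<noteq> \<infinity>"
    then have "summable (\<lambda>n. 4 ^ n * (cmod (f (Suc n) x - f n x))\<^sup>2)"
      by (intro summable_suminf_not_top) auto
    then have "(\<lambda>n. 4 ^ n * (cmod (f (Suc n) x - f n x))\<^sup>2) \<longlonglongrightarrow> 0"
      by (rule summable_LIMSEQ_zero)
    then have "\<forall>\<^sub>F n in sequentially. 4 ^ n * (cmod (f (Suc n) x - f n x))\<^sup>2 < 1"
      by (rule order_tendstoD) simp
    then have "\<forall>\<^sub>F n in sequentially. norm (f (Suc n) x - f n x) \<le> (1/2) ^ n"
    proof eventually_elim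
      fix n assume "4 ^ n * (cmod (f (Suc n) x - f n x))\<^sup>2 < 1"
      moreover have "(4::real) ^ n = (2 ^ n)\<^sup>2" by (simp add: power2_eq_square flip: power_mult_distrib)
      ultimately have "(2 ^ n * cmod (f (Suc n) x - f n x))\<^sup>2 < 1\<^sup>2"
        by (simp add: power_mult_distrib)
      then have "2 ^ n * cmod (f (Suc n) x - f n x) < 1"
        by (rule power_less_imp_less_base) simp
      then show "norm (f (Suc n) x - f n x) \<le> (1/2) ^ n"
        by (simp add: power_one_over field_simps)
    qed
    then have "summable (\<lambda>n. f (Suc n) x - f n x)"
      by (rule summable_comparison_test_ev) (simp add: summable_geometric)
    then have "convergent (\<lambda>n. (\<Sum>i<n. f (Suc i) x - f i x) + f 0 x)"
      by (intro convergent_add convergent_const) (simp add: summable_iff_convergent)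
    then show "convergent (\<lambda>n. f n x)"
      unfolding sum_lessThan_telescope[of "\<lambda>n. f n x"] by simp
  qed
  define g where "g x = lim (\<lambda>n. f n x)" for x
  have [measurable]: "g \<in> borel_measurable borel"
    unfolding g_def[abs_def] by (rule borel_measurable_lim_metric) measurable
  have lim: "AE x in lborel. (\<lambda>n. f n x) \<longlonglongrightarrow> g x"
    using conv by eventually_elim (simp add: g_def convergent_LIMSEQ_iff)
  have fatou: "(\<integral>\<^sup>+x. ennreal ((cmod (g x - f n x))\<^sup>2) \<partial>lborel) \<le> ennreal (e\<^sup>2)"
    if "\<And>m. m \<ge> n \<Longrightarrow> norm (X m - X n) \<le> e" "e \<ge> 0" for n e
  proof -
    have "(\<integral>\<^sup>+x. ennreal ((cmod (g x - f n x))\<^sup>2) \<partial>lborel)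
        = (\<integral>\<^sup>+x. liminf (\<lambda>m. ennreal ((cmod (f m x - f n x))\<^sup>2)) \<partial>lborel)"
    proof (rule nn_integral_cong_AE, use lim in eventually_elim)
      fix x assume "(\<lambda>n. f n x) \<longlonglongrightarrow> g x"
      then have "(\<lambda>m. ennreal ((cmod (f m x - f n x))\<^sup>2)) \<longlonglongrightarrow> ennreal ((cmod (g x - f n x))\<^sup>2)"
        by (intro tendsto_intros)
      then show "ennreal ((cmod (g x - f n x))\<^sup>2) = liminf (\<lambda>m. ennreal ((cmod (f m x - f n x))\<^sup>2))"
        by (rule lim_imp_Liminf[OF trivial_limit_sequentially, symmetric])
    qed
    also have "\<dots> \<le> liminf (\<lambda>m. \<integral>\<^sup>+x. ennreal ((cmod (f m x - f n x))\<^sup>2) \<partial>lborel)"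
      by (rule nn_integral_liminf) measurable
    also have "\<dots> \<le> liminf (\<lambda>m. ennreal (e\<^sup>2))"
    proof (rule Liminf_mono)
      show "\<forall>\<^sub>F m in sequentially. (\<integral>\<^sup>+x. ennreal ((cmod (f m x - f n x))\<^sup>2) \<partial>lborel) \<le> ennreal (e\<^sup>2)"
        using eventually_ge_at_top[of n]
        by eventually_elim (auto simp: int intro!: ennreal_leI power_mono that)
    qed
    also have "\<dots> = ennreal (e\<^sup>2)" by (simp add: Liminf_const)
    finally show ?thesis .
  qed
  have diff: "(\<lambda>x. g x - f n x) \<in> L2_space \<and> norm (to_l2 (\<lambda>x. g x - f n x)) \<le> e"
    if e: "\<And>m. m \<ge> n \<Longrightarrow> norm (X m - X n) \<le> e" "e \<ge> 0" for n e
  proof -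
    have *: "(\<lambda>x. g x - f n x) \<in> L2_space"
      by (rule L2_spaceI_nn) (simp, rule order_le_less_trans[OF fatou[OF e]], simp_all)
    have "ennreal ((norm (to_l2 (\<lambda>x. g x - f n x)))\<^sup>2) \<le> ennreal (e\<^sup>2)"
      using fatou[OF e] by (simp only: L2_nn_integral[OF *])
    then have "(norm (to_l2 (\<lambda>x. g x - f n x)))\<^sup>2 \<le> e\<^sup>2"
      by simp
    then show ?thesis using * e(2) by (blast intro: power2_le_imp_le)
  qed
  have "g \<in> L2_space"
  proof -
    obtain N where "\<forall>m\<ge>N. \<forall>n\<ge>N. norm (X m - X n) < 1"
      using CauchyD[OF cau, of 1] by auto
    then have "norm (X m - X N) \<le> 1" if "m \<ge> N" for m using that by (simp add: less_imp_le)
    then have "(\<lambda>x. g x - f N x) \<in> L2_space" using diff[of N 1] by simp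
    from L2_space_add[OF this f(1)[of N]] show ?thesis by simp
  qed
  have "X \<longlonglongrightarrow> to_l2 g"
  proof (rule LIMSEQ_I)
    fix e :: real assume "e > 0"
    then obtain N where N: "\<forall>m\<ge>N. \<forall>n\<ge>N. norm (X m - X n) < e/2"
      using CauchyD[OF cau, of "e/2"] by auto
    have "norm (X n - to_l2 g) < e" if "n \<ge> N" for n
    proof -
      have "norm (to_l2 (\<lambda>x. g x - f n x)) \<le> e/2"
        using diff[of n "e/2"] N that \<open>e > 0\<close> by (simp add: less_imp_le)
      then have "norm (to_l2 g - X n) \<le> e/2" by (simp add: to_l2_diff \<open>g \<in> L2_space\<close> f)
      then show ?thesis using \<open>e > 0\<close> by (simp add: norm_minus_commute)
    qed
    then show "\<exists>no. \<forall>n\<ge>no. norm (X n - to_l2 g) < e" by blast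
  qed
  then show ?thesis by (rule convergentI)
qed

instance l2 :: (euclidean_space) complete_space
proof
  fix X :: "nat \<Rightarrow> 'a l2"
  assume cau: "Cauchy X"
  define e :: "nat \<Rightarrow> real" where "e n = sqrt ((1/8) ^ n)" for n
  have e: "e n > 0" "(e n)\<^sup>2 = (1/8) ^ n" for n by (auto simp: e_def)
  have "\<forall>n. \<exists>N. \<forall>m\<ge>N. \<forall>k\<ge>N. norm (X m - X k) < e n"
    using CauchyD[OF cau] e(1) by simp
  from choice[OF this] obtain N where N: "\<forall>n. \<forall>m\<ge>N n. \<forall>k\<ge>N n. norm (X m - X k) < e n" ..
  \<comment> \<open>The two arguments of \<open>max\<close> make \<open>r\<close> strictly
    increasing and keep \<open>r n\<close> beyond \<open>N n\<close>; both \<open>r n\<close> and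
    \<open>r (Suc n)\<close> then lie in the range where distances are below
    \<open>e n\<close>.\<close>
  define r where "r = rec_nat (N 0) (\<lambda>n p. max (Suc p) (N (Suc n)))"
  have r: "r 0 = N 0" "r (Suc n) = max (Suc (r n)) (N (Suc n))" for n by (auto simp: r_def)
  have sm: "strict_mono r" by (rule strict_monoI_Suc) (simp add: r)
  have ge: "r n \<ge> N n" for n by (cases n) (auto simp: r)
  have "(norm (X (r (Suc n)) - X (r n)))\<^sup>2 \<le> (1/8) ^ n" for n
  proof -
    have "norm (X (r (Suc n)) - X (r n)) < e n"
      using N ge[of n] by (simp add: r)
    then have "(norm (X (r (Suc n)) - X (r n)))\<^sup>2 \<le> (e n)\<^sup>2"
      by (intro power_mono) simp_all
    then show ?thesis by (simp add: e(2))
  qed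
  moreover have "Cauchy (\<lambda>n. X (r n))"
    using Cauchy_subseq_Cauchy[OF cau sm] by (simp add: comp_def)
  ultimately obtain L where "(\<lambda>n. X (r n)) \<longlonglongrightarrow> L"
    using l2_rapid_Cauchy_convergent[of "\<lambda>n. X (r n)"] by (auto simp: convergent_def)
  then show "convergent X"
    using Cauchy_converges_subseq[OF cau sm, of L] by (auto simp: convergent_def comp_def)
qed

instance l2 :: (euclidean_space) banach ..

section \<open>The Fourier transform on integrable functions\<close>

lemma lborel_integral_affine:
  fixes f :: "'a::euclidean_space \<Rightarrow> 'b::{banach, second_countable_topology}"
  assumes c: "c \<noteq> 0" and [measurable]: "f \<in> borel_measurable borel"
  shows "integrable lborel (\<lambda>x. f (t + c *\<^sub>R x)) \<longleftrightarrow> integrable lborel f"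
    and "(\<integral>x. f x \<partial>lborel) = \<bar>c\<bar> ^ DIM('a) *\<^sub>R (\<integral>x. f (t + c *\<^sub>R x) \<partial>lborel)"
proof -
  let ?d = "density (distr lborel borel (\<lambda>x. t + c *\<^sub>R x)) (\<lambda>_. ennreal (\<bar>c\<bar> ^ DIM('a)))"
  have eq: "lborel = ?d"
    using lborel_affine[OF c, of t] by (simp add: ennreal_power)
  have "integrable lborel f \<longleftrightarrow> integrable ?d f"
    using eq by (rule arg_cong)
  also have "\<dots> \<longleftrightarrow> integrable lborel (\<lambda>x. f (t + c *\<^sub>R x))"
  proof
    assume "integrable ?d f"
    then have "integrable lborel (\<lambda>x. \<bar>c\<bar> ^ DIM('a) *\<^sub>R f (t + c *\<^sub>R x))"
      by (simp add: integrable_density integrable_distr_eq)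
    then have "integrable lborel (\<lambda>x. inverse (\<bar>c\<bar> ^ DIM('a)) *\<^sub>R \<bar>c\<bar> ^ DIM('a) *\<^sub>R f (t + c *\<^sub>R x))"
      by (rule integrable_scaleR_right)
    then show "integrable lborel (\<lambda>x. f (t + c *\<^sub>R x))"
      using c by simp
  qed (simp add: integrable_density integrable_distr_eq)
  finally show "integrable lborel (\<lambda>x. f (t + c *\<^sub>R x)) \<longleftrightarrow> integrable lborel f" ..
  have "(\<integral>x. f x \<partial>lborel) = (\<integral>x. f x \<partial>?d)"
    using eq by (rule arg_cong)
  also have "\<dots> = \<bar>c\<bar> ^ DIM('a) *\<^sub>R (\<integral>x. f (t + c *\<^sub>R x) \<partial>lborel)"
    by (simp add: integral_density integral_distr)
  finally show "(\<integral>x. f x \<partial>lborel) = \<bar>c\<bar> ^ DIM('a) *\<^sub>R (\<integral>x. f (t + c *\<^sub>R x) \<partial>lborel)" .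
qed

text \<open>\<open>lborel\<close> is the image of the product of the one-dimensional measures under
  the coordinate map. This reduces the transform of the Gaussian, and later an integrable majorant,
  to dimension one.\<close>

lemma lborel_prod_Basis:
  fixes f :: "'a::euclidean_space \<Rightarrow> real \<Rightarrow> 'b::{real_normed_field, banach, second_countable_topology}"
  assumes int: "\<And>b. b \<in> Basis \<Longrightarrow> integrable lborel (f b)"
  shows "integrable lborel (\<lambda>x. \<Prod>b\<in>Basis. f b (x \<bullet> b))"
    and "(\<integral>x. (\<Prod>b\<in>Basis. f b (x \<bullet> b)) \<partial>lborel) = (\<Prod>b\<in>Basis. \<integral>x. f b x \<partial>lborel)"
proof -
  interpret product_sigma_finite "\<lambda>_::'a. lborel :: real measure" ..
  have [measurable]: "b \<in> Basis \<Longrightarrow> f b \<in> borel_measurable borel" for b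
    using borel_measurable_integrable[OF int] by simp
  have [simp]: "(\<Prod>b\<in>Basis. f b ((\<Sum>c\<in>Basis. x c *\<^sub>R c) \<bullet> b)) = (\<Prod>b\<in>Basis. f b (x b))" for x
    by (rule prod.cong) (auto simp: inner_sum_left_Basis)
  show "integrable lborel (\<lambda>x. \<Prod>b\<in>Basis. f b (x \<bullet> b))"
    unfolding lborel_eq[where 'a = 'a]
    by (simp add: integrable_distr_eq product_integrable_prod int)
  show "(\<integral>x. (\<Prod>b\<in>Basis. f b (x \<bullet> b)) \<partial>lborel) = (\<Prod>b\<in>Basis. \<integral>x. f b x \<partial>lborel)"
    unfolding lborel_eq[where 'a = 'a]
    by (simp add: integral_distr product_integral_prod int)
qed

text \<open>The transform of integrable functions, defined at every point. It is kept apart from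
  \<open>fourier\<close>, which is an L2 limit fixed only up to null sets.\<close>

definition fourier_L1 :: "('a::euclidean_space \<Rightarrow> complex) \<Rightarrow> 'a \<Rightarrow> complex" where
  "fourier_L1 f \<xi> = (\<integral>x. exp (- \<i> * complex_of_real (x \<bullet> \<xi>)) * f x \<partial>lborel)"

lemma integrable_exp_mult:
  assumes "integrable lborel f"
  shows "integrable lborel (\<lambda>x::'a::euclidean_space. exp (- \<i> * complex_of_real (x \<bullet> \<xi>)) * f x)"
    and "integrable lborel (\<lambda>x::'a::euclidean_space. exp (\<i> * complex_of_real (x \<bullet> \<xi>)) * f x)"
proof -
  note [measurable] = borel_measurable_integrable[OF assms]
  show "integrable lborel (\<lambda>x::'a. exp (- \<i> * complex_of_real (x \<bullet> \<xi>)) * f x)"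
    by (rule Bochner_Integration.integrable_bound[OF assms]) (auto simp: norm_mult)
  show "integrable lborel (\<lambda>x::'a. exp (\<i> * complex_of_real (x \<bullet> \<xi>)) * f x)"
    by (rule Bochner_Integration.integrable_bound[OF assms]) (auto simp: norm_mult)
qed

lemma borel_measurable_cnj [measurable]:
  "f \<in> borel_measurable M \<Longrightarrow> (\<lambda>x. cnj (f x)) \<in> borel_measurable M"
  by (rule measurable_compose[OF _ borel_measurable_continuous_onI]) (auto intro: continuous_intros)

lemma fourier_L1_measurable [measurable]:
  assumes [measurable]: "f \<in> borel_measurable borel"
  shows "fourier_L1 f \<in> borel_measurable borel"
  unfolding fourier_L1_def[abs_def]
  by (rule lborel.borel_measurable_lebesgue_integral) measurable

lemma norm_fourier_L1_le: "cmod (fourier_L1 f \<xi>) \<le> L1_norm f"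
proof -
  have "cmod (fourier_L1 f \<xi>) \<le> (\<integral>x. cmod (exp (- \<i> * complex_of_real (x \<bullet> \<xi>)) * f x) \<partial>lborel)"
    unfolding fourier_L1_def by (rule integral_norm_bound)
  then show ?thesis by (simp add: norm_mult L1_norm_def)
qed

lemma fourier_L1_diff:
  assumes "integrable lborel f" "integrable lborel g"
  shows "fourier_L1 (\<lambda>x. f x - g x) \<xi> = fourier_L1 f \<xi> - fourier_L1 g \<xi>"
  using assms by (simp add: fourier_L1_def right_diff_distrib integrable_exp_mult[simplified])

text \<open>Fubini: the kernel is a phase of modulus 1, so the integrand is dominated by the product
  of the two moduli. The formula serves twice, to insert a Gaussian into Plancherel's identity and
  to compute the adjoint of the transform.\<close>

lemma fourier_L1_multiplication:
  fixes f g :: "'a::euclidean_space \<Rightarrow> complex"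
  assumes f: "integrable lborel f" and g: "integrable lborel g"
  shows "(\<integral>\<xi>. fourier_L1 f \<xi> * g \<xi> \<partial>lborel) = (\<integral>x. f x * fourier_L1 g x \<partial>lborel)"
proof -
  note [measurable] = borel_measurable_integrable[OF f] borel_measurable_integrable[OF g]
  define h where "h x \<xi> = exp (- \<i> * complex_of_real (x \<bullet> \<xi>)) * f x * g \<xi>" for x \<xi> :: 'a
  have "integrable (lborel \<Otimes>\<^sub>M lborel) (case_prod h)"
  proof (rule lborel_pair.Fubini_integrable)
    show "case_prod h \<in> borel_measurable (lborel \<Otimes>\<^sub>M lborel)"
      unfolding h_def by measurable
    show "integrable lborel (\<lambda>x. \<integral>y. norm (case_prod h (x, y)) \<partial>lborel)"
      using f by (simp add: h_def norm_mult)
    show "AE x in lborel. integrable lborel (\<lambda>y. case_prod h (x, y))"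
    proof (rule AE_I2)
      fix x :: 'a
      show "integrable lborel (\<lambda>y. case_prod h (x, y))"
        by (rule Bochner_Integration.integrable_bound[of _ "\<lambda>y. cmod (f x) * cmod (g y)"])
          (use g in \<open>auto simp: h_def norm_mult\<close>)
    qed
  qed
  then have "(\<integral>\<xi>. (\<integral>x. h x \<xi> \<partial>lborel) \<partial>lborel) = (\<integral>x. (\<integral>\<xi>. h x \<xi> \<partial>lborel) \<partial>lborel)"
    by (rule lborel_pair.Fubini_integral)
  moreover have "(\<integral>x. h x \<xi> \<partial>lborel) = fourier_L1 f \<xi> * g \<xi>" for \<xi>
    by (simp add: h_def fourier_L1_def)
  moreover have "(\<integral>\<xi>. h x \<xi> \<partial>lborel) = f x * fourier_L1 g x" for x
  proof -
    have "(\<integral>\<xi>. h x \<xi> \<partial>lborel) = (\<integral>\<xi>. f x * (exp (- \<i> * complex_of_real (\<xi> \<bullet> x)) * g \<xi>) \<partial>lborel)"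
      by (rule Bochner_Integration.integral_cong) (auto simp: h_def inner_commute)
    then show ?thesis by (simp add: fourier_L1_def)
  qed
  ultimately show ?thesis by simp
qed

subsection \<open>Gaussians\<close>

text \<open>The parameter scales the argument: as \<open>e\<close> tends to 0,
  \<open>gaussian e\<close> tends to 1 while its transform, a multiple of
  \<open>gaussian (1 / e)\<close>, concentrates at the origin. With \<open>e = sqrt (t / 2)\<close>
  the same function later bounds the damping factor.\<close>

definition gaussian :: "real \<Rightarrow> 'a::euclidean_space \<Rightarrow> real" where
  "gaussian e x = exp (- (e * norm x)\<^sup>2 / 2)"

lemma gaussian_measurable [measurable]: "gaussian e \<in> borel_measurable borel"
  unfolding gaussian_def[abs_def] by measurable

lemma gaussian_pos [simp]: "gaussian e x > 0" "gaussian e x \<ge> 0"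
  by (simp_all add: gaussian_def)

lemma gaussian_real: "integrable lborel (gaussian 1 :: real \<Rightarrow> real)"
  "(\<integral>x. exp (- \<i> * complex_of_real (x * t)) * complex_of_real (gaussian 1 x) \<partial>lborel)
    = complex_of_real (sqrt (2 * pi) * gaussian 1 t)"
proof -
  have eq: "gaussian 1 x = sqrt (2 * pi) * std_normal_density x" for x :: real
    by (simp add: gaussian_def std_normal_density_def)
  have "integrable lborel (\<lambda>x. sqrt (2 * pi) * std_normal_density x)"
    using integrable_std_normal_moment[of 0] by simp
  then show "integrable lborel (gaussian 1 :: real \<Rightarrow> real)"
    unfolding eq[abs_def] .
  \<comment> \<open>The characteristic function carries the phase with the opposite sign, hence the
    argument \<open>- t\<close>.\<close>
  have "char std_normal_distribution (- t)
      = (\<integral>x. std_normal_density x *\<^sub>R exp (\<i> * complex_of_real (- t * x)) \<partial>lborel)"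
    unfolding char_def by (subst integral_density) auto
  then have "(\<integral>x. std_normal_density x *\<^sub>R exp (\<i> * complex_of_real (- t * x)) \<partial>lborel)
      = complex_of_real (gaussian 1 t)"
    unfolding char_std_normal_distribution by (simp add: gaussian_def)
  then have "complex_of_real (sqrt (2 * pi)) *
      (\<integral>x. std_normal_density x *\<^sub>R exp (\<i> * complex_of_real (- t * x)) \<partial>lborel)
      = complex_of_real (sqrt (2 * pi) * gaussian 1 t)"
    by simp
  then show "(\<integral>x. exp (- \<i> * complex_of_real (x * t)) * complex_of_real (gaussian 1 x) \<partial>lborel)
    = complex_of_real (sqrt (2 * pi) * gaussian 1 t)"
    by (subst (asm) integral_mult_right_zero[symmetric]) (simp add: eq scaleR_conv_of_real mult_ac)
qed

lemma gaussian_eq_prod: "gaussian 1 x = (\<Prod>b\<in>Basis. gaussian 1 (x \<bullet> b))"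
proof -
  have "(norm x)\<^sup>2 = (\<Sum>b\<in>Basis. (x \<bullet> b)\<^sup>2)"
    unfolding power2_norm_eq_inner by (subst euclidean_inner) (simp add: power2_eq_square)
  then show ?thesis
    by (simp add: gaussian_def sum_divide_distrib sum_negf flip: exp_sum)
qed

lemma gaussian_1: "integrable lborel (gaussian 1 :: 'a::euclidean_space \<Rightarrow> real)"
  "fourier_L1 (\<lambda>x. complex_of_real (gaussian 1 x)) (\<xi>::'a)
    = complex_of_real (sqrt (2 * pi) ^ DIM('a) * gaussian 1 \<xi>)"
proof -
  show "integrable lborel (gaussian 1 :: 'a \<Rightarrow> real)"
    by (subst gaussian_eq_prod[abs_def]) (intro lborel_prod_Basis gaussian_real)
  have "exp (- \<i> * complex_of_real (x \<bullet> \<xi>)) * complex_of_real (gaussian 1 x)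
      = (\<Prod>b\<in>Basis. exp (- \<i> * complex_of_real ((x \<bullet> b) * (\<xi> \<bullet> b))) * complex_of_real (gaussian 1 (x \<bullet> b)))"
    for x :: 'a
  proof -
    have "exp (- \<i> * complex_of_real (x \<bullet> \<xi>)) = (\<Prod>b\<in>Basis. exp (- \<i> * complex_of_real ((x \<bullet> b) * (\<xi> \<bullet> b))))"
      unfolding euclidean_inner[of x \<xi>] of_real_sum sum_distrib_left by (simp add: exp_sum)
    then show ?thesis
      unfolding gaussian_eq_prod[of x] by (simp only: prod.distrib of_real_prod)
  qed
  then have "fourier_L1 (\<lambda>x. complex_of_real (gaussian 1 x)) \<xi>
     = (\<integral>x. (\<Prod>b\<in>Basis. exp (- \<i> * complex_of_real ((x \<bullet> b) * (\<xi> \<bullet> b))) * complex_of_real (gaussian 1 (x \<bullet> b))) \<partial>lborel)"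
    by (simp only: fourier_L1_def)
  also have "\<dots> = (\<Prod>b\<in>Basis. \<integral>x. exp (- \<i> * complex_of_real (x * (\<xi> \<bullet> b))) * complex_of_real (gaussian 1 x) \<partial>lborel)"
    using gaussian_real(1)
    by (intro lborel_prod_Basis(2)[where f = "\<lambda>b x. exp (- \<i> * complex_of_real (x * (\<xi> \<bullet> b))) * complex_of_real (gaussian 1 x)"])
      (rule integrable_exp_mult(1)[where 'a = real, unfolded inner_real_def], simp)
  also have "\<dots> = complex_of_real (sqrt (2 * pi) ^ DIM('a) * gaussian 1 \<xi>)"
    unfolding gaussian_real(2) gaussian_eq_prod[of \<xi>] by (simp add: prod.distrib)
  finally show "fourier_L1 (\<lambda>x. complex_of_real (gaussian 1 x)) \<xi>
    = complex_of_real (sqrt (2 * pi) ^ DIM('a) * gaussian 1 \<xi>)" .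
qed

lemma gaussian_integrable:
  assumes "e > 0"
  shows "integrable lborel (gaussian e :: 'a::euclidean_space \<Rightarrow> real)"
proof -
  have "integrable lborel (\<lambda>x::'a. gaussian 1 (0 + e *\<^sub>R x))"
    using assms by (subst lborel_integral_affine) (auto simp: gaussian_1)
  then show ?thesis using assms by (simp add: gaussian_def[abs_def])
qed

lemma gaussian_fourier:
  fixes \<xi> :: "'a::euclidean_space"
  assumes "e > 0"
  shows "fourier_L1 (\<lambda>x. complex_of_real (gaussian e x)) \<xi>
    = complex_of_real ((sqrt (2 * pi) / e) ^ DIM('a) * gaussian (1 / e) \<xi>)"
proof -
  have "fourier_L1 (\<lambda>x. complex_of_real (gaussian e x)) \<xi>
    = \<bar>1 / e\<bar> ^ DIM('a) *\<^sub>R (\<integral>x. exp (- \<i> * complex_of_real ((0 + (1 / e) *\<^sub>R x) \<bullet> \<xi>))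
        * complex_of_real (gaussian e (0 + (1 / e) *\<^sub>R x)) \<partial>lborel)"
    unfolding fourier_L1_def using assms by (intro lborel_integral_affine) auto
  also have "\<dots> = \<bar>1 / e\<bar> ^ DIM('a) *\<^sub>R fourier_L1 (\<lambda>x. complex_of_real (gaussian 1 x)) ((1 / e) *\<^sub>R \<xi>)"
    using assms by (simp add: fourier_L1_def gaussian_def)
  also have "\<dots> = complex_of_real ((sqrt (2 * pi) / e) ^ DIM('a) * gaussian (1 / e) \<xi>)"
    unfolding gaussian_1 using assms by (simp add: gaussian_def power_divide scaleR_conv_of_real)
  finally show ?thesis .
qed

lemma gaussian_integral:
  "e > 0 \<Longrightarrow> (\<integral>x. gaussian e (x::'a::euclidean_space) \<partial>lborel) = (sqrt (2 * pi) / e) ^ DIM('a)"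
  using gaussian_fourier[of e "0::'a"]
  by (simp add: fourier_L1_def gaussian_def del: of_real_power of_real_divide of_real_mult)

subsection \<open>Plancherel's identity for continuous functions\<close>

text \<open>The Gaussian makes \<open>cnj (fourier_L1 f)\<close> integrable, so that the
  multiplication formula applies to it and \<open>f\<close>. The substitution in the inner integral
  moves \<open>e\<close> into the argument of \<open>f\<close>, which prepares the limit
  \<open>e\<close> to 0.\<close>

lemma fourier_L1_gaussian_weighted:
  fixes f :: "'a::euclidean_space \<Rightarrow> complex"
  assumes f: "integrable lborel f" and e: "e > 0"
  shows "(\<integral>\<xi>. complex_of_real ((cmod (fourier_L1 f \<xi>))\<^sup>2 * gaussian e \<xi>) \<partial>lborel)
    = complex_of_real (sqrt (2 * pi) ^ DIM('a)) *
        (\<integral>x. f x * cnj (\<integral>z. complex_of_real (gaussian 1 z) * f (x + e *\<^sub>R z) \<partial>lborel) \<partial>lborel)"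
proof -
  note [measurable] = borel_measurable_integrable[OF f, simplified]
  have inner: "fourier_L1 (\<lambda>\<xi>. cnj (fourier_L1 f \<xi>) * complex_of_real (gaussian e \<xi>)) x
    = complex_of_real (sqrt (2 * pi) ^ DIM('a)) * cnj (\<integral>z. complex_of_real (gaussian 1 z) * f (x + e *\<^sub>R z) \<partial>lborel)"
    for x :: 'a
  proof -
    \<comment> \<open>A modulated Gaussian: the modulation by \<open>x\<close> translates its
      transform to the centre \<open>x\<close>.\<close>
    define h where "h \<xi> = exp (\<i> * complex_of_real (\<xi> \<bullet> x)) * complex_of_real (gaussian e \<xi>)" for \<xi>
    have h: "integrable lborel h"
      unfolding h_def using gaussian_integrable[OF e, where 'a = 'a] by (intro integrable_exp_mult) simp
    have Fh: "fourier_L1 h y = complex_of_real ((sqrt (2 * pi) / e) ^ DIM('a) * gaussian (1 / e) (y - x))" for y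
      unfolding gaussian_fourier[OF e, symmetric] fourier_L1_def h_def
      by (intro Bochner_Integration.integral_cong)
        (auto simp: inner_diff_right right_diff_distrib exp_diff exp_minus field_simps)
    have "cnj (fourier_L1 (\<lambda>\<xi>. cnj (fourier_L1 f \<xi>) * complex_of_real (gaussian e \<xi>)) x)
      = (\<integral>\<xi>. fourier_L1 f \<xi> * h \<xi> \<partial>lborel)"
    proof -
      have "cnj (exp (- \<i> * complex_of_real (\<xi> \<bullet> x)) * (cnj (fourier_L1 f \<xi>) * complex_of_real (gaussian e \<xi>)))
          = fourier_L1 f \<xi> * h \<xi>" for \<xi>
        by (simp add: h_def exp_cnj)
      then have "(\<integral>\<xi>. fourier_L1 f \<xi> * h \<xi> \<partial>lborel)
          = (\<integral>\<xi>. cnj (exp (- \<i> * complex_of_real (\<xi> \<bullet> x)) * (cnj (fourier_L1 f \<xi>) * complex_of_real (gaussian e \<xi>))) \<partial>lborel)"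
        by presburger
      also have "\<dots> = cnj (\<integral>\<xi>. exp (- \<i> * complex_of_real (\<xi> \<bullet> x)) * (cnj (fourier_L1 f \<xi>) * complex_of_real (gaussian e \<xi>)) \<partial>lborel)"
        by (rule Bochner_Integration.integral_cnj)
      finally show ?thesis by (simp only: fourier_L1_def[where \<xi> = x])
    qed
    also have "\<dots> = (\<integral>y. f y * complex_of_real ((sqrt (2 * pi) / e) ^ DIM('a) * gaussian (1 / e) (y - x)) \<partial>lborel)"
      by (simp only: fourier_L1_multiplication[OF f h] Fh)
    \<comment> \<open>Substitution of \<open>x + e z\<close> for \<open>y\<close>. The Jacobian will
      cancel the power of \<open>1 / e\<close> that normalizes the transformed Gaussian.\<close>
    also have "\<dots> = \<bar>e\<bar> ^ DIM('a) *\<^sub>R (\<integral>z. f (x + e *\<^sub>R z) *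
        complex_of_real ((sqrt (2 * pi) / e) ^ DIM('a) * gaussian (1 / e) ((x + e *\<^sub>R z) - x)) \<partial>lborel)"
      using e by (intro lborel_integral_affine) auto
    also have "\<dots> = \<bar>e\<bar> ^ DIM('a) *\<^sub>R (\<integral>z. complex_of_real ((sqrt (2 * pi) / e) ^ DIM('a)) *
        (complex_of_real (gaussian 1 z) * f (x + e *\<^sub>R z)) \<partial>lborel)"
      using e by (intro arg_cong2[where f = scaleR] refl Bochner_Integration.integral_cong) (auto simp: gaussian_def)
    also have "\<dots> = complex_of_real (sqrt (2 * pi) ^ DIM('a)) *
        (\<integral>z. complex_of_real (gaussian 1 z) * f (x + e *\<^sub>R z) \<partial>lborel)"
      using e by (subst integral_mult_right_zero) (simp add: scaleR_conv_of_real power_divide)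
    finally have "cnj (fourier_L1 (\<lambda>\<xi>. cnj (fourier_L1 f \<xi>) * complex_of_real (gaussian e \<xi>)) x) = \<dots>" .
    from arg_cong[OF this, of cnj] show ?thesis
      by (simp only: complex_cnj_cnj complex_cnj_complex_of_real complex_cnj_mult)
  qed
  have g: "integrable lborel (\<lambda>\<xi>. cnj (fourier_L1 f \<xi>) * complex_of_real (gaussian e \<xi>))"
  proof (rule Bochner_Integration.integrable_bound)
    show "integrable lborel (\<lambda>\<xi>::'a. L1_norm f * gaussian e \<xi>)"
      using gaussian_integrable[OF e, where 'a = 'a] by simp
    show "AE \<xi> in lborel. norm (cnj (fourier_L1 f \<xi>) * complex_of_real (gaussian e \<xi>)) \<le> norm (L1_norm f * gaussian e \<xi>)"
      by (auto simp: norm_mult abs_mult intro!: mult_right_mono norm_fourier_L1_le[THEN order_trans])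
  qed simp
  have "(\<integral>\<xi>. complex_of_real ((cmod (fourier_L1 f \<xi>))\<^sup>2 * gaussian e \<xi>) \<partial>lborel)
    = (\<integral>\<xi>. fourier_L1 f \<xi> * (cnj (fourier_L1 f \<xi>) * complex_of_real (gaussian e \<xi>)) \<partial>lborel)"
    by (simp only: complex_norm_square of_real_mult mult.assoc)
  also have "\<dots> = (\<integral>x. f x * (complex_of_real (sqrt (2 * pi) ^ DIM('a)) *
      cnj (\<integral>z. complex_of_real (gaussian 1 z) * f (x + e *\<^sub>R z) \<partial>lborel)) \<partial>lborel)"
    by (simp only: fourier_L1_multiplication[OF f g] inner)
  also have "\<dots> = (\<integral>x. complex_of_real (sqrt (2 * pi) ^ DIM('a)) * (f x *
      cnj (\<integral>z. complex_of_real (gaussian 1 z) * f (x + e *\<^sub>R z) \<partial>lborel)) \<partial>lborel)"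
    by (simp only: mult_ac)
  finally show ?thesis by (simp only: integral_mult_right_zero)
qed

lemma L2_space_bounded_integrable:
  assumes f: "integrable lborel f" and B: "\<And>x. cmod (f x) \<le> B"
  shows "f \<in> L2_space"
proof (rule L2_spaceI)
  note [measurable] = borel_measurable_integrable[OF f, simplified]
  have "integrable lborel (\<lambda>x. B * cmod (f x))" using f by simp
  then show "integrable lborel (\<lambda>x. (cmod (f x))\<^sup>2)"
  proof (rule Bochner_Integration.integrable_bound)
    have "(cmod (f x))\<^sup>2 \<le> \<bar>B * cmod (f x)\<bar>" for x
      using mult_right_mono[OF B[of x], of "cmod (f x)"] by (simp add: power2_eq_square)
    then show "AE x in lborel. norm ((cmod (f x))\<^sup>2) \<le> norm (B * cmod (f x))" by simp
  qed simp
qed (use f in auto)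

text \<open>The width \<open>e\<close> of the weighted identity tends to 0. On the frequency side
  the Gaussians increase, so monotone convergence also yields square integrability of the transform,
  which is not known beforehand. On the other side convergence is dominated, with continuity of
  \<open>f\<close> giving the pointwise limit and the bound \<open>B\<close> the majorant.\<close>

lemma plancherel_identity_continuous:
  fixes f :: "'a::euclidean_space \<Rightarrow> complex"
  assumes f: "integrable lborel f" and cont: "continuous_on UNIV f" and B: "\<And>x. cmod (f x) \<le> B"
  shows "fourier_L1 f \<in> L2_space"
    and "(\<integral>\<xi>. (cmod (fourier_L1 f \<xi>))\<^sup>2 \<partial>lborel) = (2 * pi) ^ DIM('a) * (\<integral>x. (cmod (f x))\<^sup>2 \<partial>lborel)"
proof -
  define s where "s = sqrt (2 * pi) ^ DIM('a)"
  define e where "e k = inverse (real (Suc k))" for k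
  define g where "g k x = (\<integral>z. complex_of_real (gaussian 1 z) * f (x + e k *\<^sub>R z) \<partial>lborel)" for k and x :: 'a
  note [measurable] = borel_measurable_integrable[OF f, simplified]
  have e: "e k > 0" for k by (simp add: e_def)
  have e0: "e \<longlonglongrightarrow> 0" unfolding e_def by (rule LIMSEQ_inverse_real_of_nat)
  have int_gauss: "integrable lborel (\<lambda>z::'a. B * gaussian 1 z)"
    using gaussian_1(1)[where 'a = 'a] by simp
  have "B \<ge> 0" using norm_ge_zero B by (rule order_trans)
  have bd: "cmod (complex_of_real (gaussian 1 z) * f (x + e k *\<^sub>R z)) \<le> B * gaussian 1 z" for z x k
    by (auto simp: norm_mult mult.commute intro!: mult_right_mono B)
  have g_meas [measurable]: "g k \<in> borel_measurable borel" for k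
    unfolding g_def[abs_def] by (rule lborel.borel_measurable_lebesgue_integral) measurable
  have g_bd: "cmod (g k x) \<le> B * s" for k x
  proof -
    have "cmod (g k x) \<le> (\<integral>z. B * gaussian 1 (z::'a) \<partial>lborel)"
      unfolding g_def
    proof (rule Bochner_Integration.integral_norm_bound_integral[OF _ int_gauss bd])
      show "integrable lborel (\<lambda>z. complex_of_real (gaussian 1 z) * f (x + e k *\<^sub>R z))"
        by (rule Bochner_Integration.integrable_bound[OF int_gauss])
          (auto intro!: AE_I2 order_trans[OF bd])
    qed
    then show ?thesis using gaussian_integral[where 'a = 'a, of 1] by (simp add: s_def)
  qed
  have g_lim: "(\<lambda>k. g k x) \<longlonglongrightarrow> complex_of_real s * f x" for x
  proof -
    have "(\<lambda>k. g k x) \<longlonglongrightarrow> (\<integral>z. complex_of_real (gaussian 1 (z::'a)) * f x \<partial>lborel)"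
      unfolding g_def
    proof (rule integral_dominated_convergence[OF _ _ int_gauss])
      have f_lim: "(\<lambda>k. f (x + e k *\<^sub>R z)) \<longlonglongrightarrow> f x" for z
      proof -
        have "isCont f x" using cont by (simp add: continuous_on_eq_continuous_at)
        moreover have "(\<lambda>k. x + e k *\<^sub>R z) \<longlonglongrightarrow> x + 0 *\<^sub>R z"
          by (intro tendsto_intros e0)
        then have "(\<lambda>k. x + e k *\<^sub>R z) \<longlonglongrightarrow> x" by simp
        ultimately show ?thesis by (rule isCont_tendsto_compose)
      qed
      show "AE z in lborel. (\<lambda>k. complex_of_real (gaussian 1 (z::'a)) * f (x + e k *\<^sub>R z))
          \<longlonglongrightarrow> complex_of_real (gaussian 1 z) * f x"
        by (intro AE_I2 tendsto_mult_left f_lim)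
    qed (auto intro: bd)
    also have "(\<integral>z. complex_of_real (gaussian 1 (z::'a)) * f x \<partial>lborel) = complex_of_real s * f x"
      using gaussian_integral[where 'a = 'a, of 1] by (simp add: s_def)
    finally show ?thesis .
  qed
  have rhs: "(\<lambda>k. complex_of_real s * (\<integral>x. f x * cnj (g k x) \<partial>lborel))
      \<longlonglongrightarrow> complex_of_real s * (\<integral>x. f x * cnj (complex_of_real s * f x) \<partial>lborel)"
  proof (intro tendsto_mult tendsto_const integral_dominated_convergence)
    show "integrable lborel (\<lambda>x. (B * s) * cmod (f x))" using f by simp
    show "AE x in lborel. (\<lambda>k. f x * cnj (g k x)) \<longlonglongrightarrow> f x * cnj (complex_of_real s * f x)"
      by (intro AE_I2 tendsto_intros tendsto_cnj g_lim)
    show "AE x in lborel. cmod (f x * cnj (g k x)) \<le> (B * s) * cmod (f x)" for k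
    proof (rule AE_I2)
      fix x
      show "cmod (f x * cnj (g k x)) \<le> (B * s) * cmod (f x)"
        using mult_right_mono[OF g_bd[of k x] norm_ge_zero[of "f x"]] by (simp add: norm_mult mult.commute)
    qed
  qed measurable
  have "complex_of_real s * (\<integral>x. f x * cnj (complex_of_real s * f x) \<partial>lborel)
      = complex_of_real ((2 * pi) ^ DIM('a) * (\<integral>x. (cmod (f x))\<^sup>2 \<partial>lborel))"
  proof -
    have "(\<integral>x. f x * cnj (complex_of_real s * f x) \<partial>lborel)
        = (\<integral>x. complex_of_real s * complex_of_real ((cmod (f x))\<^sup>2) \<partial>lborel)"
      by (simp only: complex_norm_square complex_cnj_mult complex_cnj_complex_of_real mult_ac)
    also have "\<dots> = complex_of_real s * complex_of_real (\<integral>x. (cmod (f x))\<^sup>2 \<partial>lborel)"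
      by (simp only: integral_mult_right_zero integral_complex_of_real)
    moreover have "s * s = (2 * pi) ^ DIM('a)"
      unfolding s_def power_mult_distrib[symmetric] by simp
    ultimately show ?thesis by (simp flip: of_real_mult mult.assoc)
  qed
  with rhs have lim: "(\<lambda>k. \<integral>\<xi>. complex_of_real ((cmod (fourier_L1 f \<xi>))\<^sup>2 * gaussian (e k) \<xi>) \<partial>lborel)
      \<longlonglongrightarrow> complex_of_real ((2 * pi) ^ DIM('a) * (\<integral>x. (cmod (f x))\<^sup>2 \<partial>lborel))"
    using fourier_L1_gaussian_weighted[OF f e] by (simp only: s_def g_def)
  have int: "integrable lborel (\<lambda>\<xi>. (cmod (fourier_L1 f \<xi>))\<^sup>2 * gaussian (e k) \<xi>)" for k
  proof (rule Bochner_Integration.integrable_bound)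
    show "integrable lborel (\<lambda>\<xi>::'a. (L1_norm f)\<^sup>2 * gaussian (e k) \<xi>)"
      using gaussian_integrable[OF e, where 'a = 'a] by simp
    show "AE \<xi> in lborel. norm ((cmod (fourier_L1 f \<xi>))\<^sup>2 * gaussian (e k) \<xi>) \<le> norm ((L1_norm f)\<^sup>2 * gaussian (e k) \<xi>)"
      by (auto simp: abs_mult intro!: mult_right_mono power_mono norm_fourier_L1_le)
  qed simp
  have mono: "AE \<xi> in lborel. mono (\<lambda>k. (cmod (fourier_L1 f \<xi>))\<^sup>2 * gaussian (e k) \<xi>)"
  proof (intro AE_I2 monoI mult_left_mono)
    fix \<xi> :: 'a and k l :: nat assume "k \<le> l"
    then have "(e l * norm \<xi>)\<^sup>2 \<le> (e k * norm \<xi>)\<^sup>2"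
      by (intro power_mono mult_right_mono) (auto simp: e_def field_simps)
    then show "gaussian (e k) \<xi> \<le> gaussian (e l) \<xi>" by (simp add: gaussian_def)
  qed auto
  have lim_pt: "AE \<xi> in lborel. (\<lambda>k. (cmod (fourier_L1 f \<xi>))\<^sup>2 * gaussian (e k) \<xi>) \<longlonglongrightarrow> (cmod (fourier_L1 f \<xi>))\<^sup>2"
  proof (rule AE_I2)
    fix \<xi> :: 'a
    have "(\<lambda>k. (cmod (fourier_L1 f \<xi>))\<^sup>2 * gaussian (e k) \<xi>)
       \<longlonglongrightarrow> (cmod (fourier_L1 f \<xi>))\<^sup>2 * exp (- (0 * norm \<xi>)\<^sup>2 / 2)"
      unfolding gaussian_def by (intro tendsto_intros e0) simp
    then show "(\<lambda>k. (cmod (fourier_L1 f \<xi>))\<^sup>2 * gaussian (e k) \<xi>) \<longlonglongrightarrow> (cmod (fourier_L1 f \<xi>))\<^sup>2" by simp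
  qed
  have "(\<lambda>k. \<integral>\<xi>. (cmod (fourier_L1 f \<xi>))\<^sup>2 * gaussian (e k) \<xi> \<partial>lborel)
      \<longlonglongrightarrow> (2 * pi) ^ DIM('a) * (\<integral>x. (cmod (f x))\<^sup>2 \<partial>lborel)"
    using lim unfolding integral_complex_of_real tendsto_of_real_iff .
  note * = integrable_monotone_convergence[OF int mono lim_pt this]
    integral_monotone_convergence[OF int mono lim_pt this]
  show "fourier_L1 f \<in> L2_space" by (rule L2_spaceI) (use *(1) in simp_all)
  show "(\<integral>\<xi>. (cmod (fourier_L1 f \<xi>))\<^sup>2 \<partial>lborel) = (2 * pi) ^ DIM('a) * (\<integral>x. (cmod (f x))\<^sup>2 \<partial>lborel)"
    by (rule *(2)) simp
qed

section \<open>Plancherel's theorem\<close>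

lemma l2_tendstoI:
  assumes "\<And>n. g n \<in> L2_space" "f \<in> L2_space"
    and "((\<lambda>n. \<integral>x. (cmod (g n x - f x))\<^sup>2 \<partial>lborel) \<longlongrightarrow> 0) F"
  shows "((\<lambda>n. to_l2 (g n)) \<longlongrightarrow> to_l2 f) F"
proof -
  have "((\<lambda>n. sqrt (\<integral>x. (cmod (g n x - f x))\<^sup>2 \<partial>lborel)) \<longlongrightarrow> sqrt 0) F"
    by (intro tendsto_real_sqrt assms)
  moreover have "sqrt (\<integral>x. (cmod (g n x - f x))\<^sup>2 \<partial>lborel) = norm (to_l2 (g n) - to_l2 f)" for n
    using norm_to_l2[OF L2_space_diff[OF assms(1)[of n] assms(2)]]
    by (simp add: L2_norm_def to_l2_diff assms)
  ultimately have "((\<lambda>n. norm (to_l2 (g n) - to_l2 f)) \<longlongrightarrow> 0) F"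
    by simp
  then show ?thesis
    by (rule LIM_zero_cancel[OF tendsto_norm_zero_cancel])
qed

lemma AE_limit_bounded:
  fixes g :: "nat \<Rightarrow> 'a::euclidean_space \<Rightarrow> complex"
  assumes lim: "AE x in lborel. (\<lambda>n. g n x) \<longlonglongrightarrow> f x"
    and bd: "\<And>n. AE x in lborel. cmod (g n x) \<le> w x"
  shows "AE x in lborel. cmod (f x) \<le> w x"
  using AE_all_countable[THEN iffD2, OF allI[OF bd]] lim
proof eventually_elim
  fix x assume "\<forall>n. cmod (g n x) \<le> w x" "(\<lambda>n. g n x) \<longlonglongrightarrow> f x"
  then show "cmod (f x) \<le> w x"
    by (intro LIMSEQ_le_const2[OF tendsto_norm]) auto
qed

lemma L2_dominated:
  fixes g :: "nat \<Rightarrow> 'a::euclidean_space \<Rightarrow> complex"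
  assumes meas: "\<And>n. g n \<in> borel_measurable borel" "f \<in> borel_measurable borel"
    and lim: "AE x in lborel. (\<lambda>n. g n x) \<longlonglongrightarrow> f x"
    and bd: "\<And>n. AE x in lborel. cmod (g n x) \<le> w x"
    and w: "integrable lborel (\<lambda>x. (w x)\<^sup>2)" "w \<in> borel_measurable borel"
  shows "g n \<in> L2_space" "f \<in> L2_space" "(\<lambda>n. to_l2 (g n)) \<longlonglongrightarrow> to_l2 f"
proof -
  note [measurable] = meas w(2)
  have wL2: "(\<lambda>x. complex_of_real (w x)) \<in> L2_space"
    using w by (intro L2_spaceI) auto
  have bdf: "AE x in lborel. cmod (f x) \<le> w x" by (rule AE_limit_bounded[OF lim bd])
  show gL2: "g n \<in> L2_space" for n
    using bd[of n] by (intro L2_space_bound[OF _ wL2, where C = 1]) (auto elim!: eventually_mono)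
  show fL2: "f \<in> L2_space"
    using bdf by (intro L2_space_bound[OF _ wL2, where C = 1]) (auto elim!: eventually_mono)
  have "(\<lambda>n. \<integral>x. (cmod (g n x - f x))\<^sup>2 \<partial>lborel) \<longlonglongrightarrow> (\<integral>x. 0 \<partial>(lborel :: 'a measure))"
  proof (rule integral_dominated_convergence)
    show "integrable lborel (\<lambda>x. 4 * (w x)\<^sup>2)" using w by simp
    show "AE x in lborel. (\<lambda>n. (cmod (g n x - f x))\<^sup>2) \<longlonglongrightarrow> 0"
      using lim
    proof eventually_elim
      fix x assume "(\<lambda>n. g n x) \<longlonglongrightarrow> f x"
      then have "(\<lambda>n. (cmod (g n x - f x))\<^sup>2) \<longlonglongrightarrow> (cmod (f x - f x))\<^sup>2"
        by (intro tendsto_intros)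
      then show "(\<lambda>n. (cmod (g n x - f x))\<^sup>2) \<longlonglongrightarrow> 0" by simp
    qed
    show "AE x in lborel. norm ((cmod (g n x - f x))\<^sup>2) \<le> 4 * (w x)\<^sup>2" for n
      using bd[of n] bdf
    proof eventually_elim
      fix x assume "cmod (g n x) \<le> w x" "cmod (f x) \<le> w x"
      then have "cmod (g n x - f x) \<le> 2 * w x"
        using norm_triangle_ineq4[of "g n x" "f x"] by linarith
      then have "(cmod (g n x - f x))\<^sup>2 \<le> (2 * w x)\<^sup>2" by (intro power_mono) auto
      then show "norm ((cmod (g n x - f x))\<^sup>2) \<le> 4 * (w x)\<^sup>2" by (simp add: power_mult_distrib)
    qed
  qed measurable
  then show "(\<lambda>n. to_l2 (g n)) \<longlonglongrightarrow> to_l2 f"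
    by (intro l2_tendstoI gL2 fL2) simp
qed

lemma L1_dominated:
  fixes g :: "nat \<Rightarrow> 'a::euclidean_space \<Rightarrow> complex"
  assumes meas: "\<And>n. g n \<in> borel_measurable borel" "f \<in> borel_measurable borel"
    and lim: "AE x in lborel. (\<lambda>n. g n x) \<longlonglongrightarrow> f x"
    and bd: "\<And>n. AE x in lborel. cmod (g n x) \<le> w x"
    and w: "integrable lborel w"
  shows "integrable lborel (g n)" "integrable lborel f" "(\<lambda>n. L1_norm (\<lambda>x. g n x - f x)) \<longlonglongrightarrow> 0"
proof -
  note [measurable] = meas borel_measurable_integrable[OF w, simplified]
  have bdf: "AE x in lborel. cmod (f x) \<le> w x" by (rule AE_limit_bounded[OF lim bd])
  show "integrable lborel (g n)" for n
    using bd[of n] by (intro Bochner_Integration.integrable_bound[OF w]) (auto elim!: eventually_mono)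
  show "integrable lborel f"
    using bdf by (intro Bochner_Integration.integrable_bound[OF w]) (auto elim!: eventually_mono)
  have "(\<lambda>n. \<integral>x. cmod (g n x - f x) \<partial>lborel) \<longlonglongrightarrow> (\<integral>x. 0 \<partial>(lborel :: 'a measure))"
  proof (rule integral_dominated_convergence)
    show "integrable lborel (\<lambda>x. 2 * w x)" using w by simp
    show "AE x in lborel. (\<lambda>n. cmod (g n x - f x)) \<longlonglongrightarrow> 0"
      using lim
    proof eventually_elim
      fix x assume "(\<lambda>n. g n x) \<longlonglongrightarrow> f x"
      then have "(\<lambda>n. cmod (g n x - f x)) \<longlonglongrightarrow> cmod (f x - f x)"
        by (intro tendsto_intros)
      then show "(\<lambda>n. cmod (g n x - f x)) \<longlonglongrightarrow> 0" by simp
    qed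
    show "AE x in lborel. norm (cmod (g n x - f x)) \<le> 2 * w x" for n
      using bd[of n] bdf
    proof eventually_elim
      fix x assume "cmod (g n x) \<le> w x" "cmod (f x) \<le> w x"
      then show "norm (cmod (g n x - f x)) \<le> 2 * w x"
        using norm_triangle_ineq4[of "g n x" "f x"] by simp
    qed
  qed measurable
  then show "(\<lambda>n. L1_norm (\<lambda>x. g n x - f x)) \<longlonglongrightarrow> 0"
    by (simp add: L1_norm_def)
qed

text \<open>Fatou's lemma applied to the distance from a representative of the L2 limit. In the
  approximation arguments the transforms converge pointwise by L1 bounds and in L2 by isometry; this
  identifies the two limits.\<close>

lemma l2_limit_eq_pointwise_limit:
  fixes g :: "nat \<Rightarrow> 'a::euclidean_space \<Rightarrow> complex"
  assumes g: "\<And>n. g n \<in> L2_space" and h: "(\<lambda>n. to_l2 (g n)) \<longlonglongrightarrow> h"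
    and lim: "\<And>x. (\<lambda>n. g n x) \<longlonglongrightarrow> f x" and f [measurable]: "f \<in> borel_measurable borel"
  shows "f \<in> L2_space" "to_l2 f = h"
proof -
  obtain k where k: "k \<in> L2_space" "h = to_l2 k" using l2_cases[of h] by metis
  note [measurable] = L2_space_measurable[OF g] L2_space_measurable[OF k(1)]
  have "(\<lambda>n. (norm (to_l2 (g n) - h))\<^sup>2) \<longlonglongrightarrow> (norm (h - h))\<^sup>2"
    by (intro tendsto_intros h)
  then have n0: "(\<lambda>n. ennreal ((norm (to_l2 (g n) - h))\<^sup>2)) \<longlonglongrightarrow> ennreal 0"
    by (intro tendsto_ennrealI) simp
  have "(\<integral>\<^sup>+x. ennreal ((cmod (f x - k x))\<^sup>2) \<partial>lborel)
      = (\<integral>\<^sup>+x. liminf (\<lambda>n. ennreal ((cmod (g n x - k x))\<^sup>2)) \<partial>lborel)"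
    by (intro nn_integral_cong lim_imp_Liminf[OF trivial_limit_sequentially, symmetric] tendsto_intros lim)
  also have "\<dots> \<le> liminf (\<lambda>n. \<integral>\<^sup>+x. ennreal ((cmod (g n x - k x))\<^sup>2) \<partial>lborel)"
    by (rule nn_integral_liminf) measurable
  also have "\<dots> = liminf (\<lambda>n. ennreal ((norm (to_l2 (g n) - h))\<^sup>2))"
    by (simp add: L2_nn_integral[OF L2_space_diff] to_l2_diff g k)
  also have "\<dots> = 0"
    using lim_imp_Liminf[OF trivial_limit_sequentially n0] by simp
  finally have "(\<integral>\<^sup>+x. ennreal ((cmod (f x - k x))\<^sup>2) \<partial>lborel) = 0" by simp
  then have ae: "AE x in lborel. f x = k x"
    by (simp add: nn_integral_0_iff_AE)
  show "f \<in> L2_space"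
    by (rule L2_space_bound[OF f k(1), of 1]) (use ae in \<open>auto elim!: eventually_mono\<close>)
  then show "to_l2 f = h"
    using k ae by (simp add: to_l2_eq_iff)
qed

lemma isometric_image_converges:
  fixes X :: "nat \<Rightarrow> 'b::real_normed_vector" and Y :: "nat \<Rightarrow> 'c::banach"
  assumes X: "X \<longlonglongrightarrow> x" and c: "c > 0" and iso: "\<And>m n. norm (Y m - Y n) = c * norm (X m - X n)"
  shows "convergent Y"
proof -
  have "Cauchy Y"
  proof (rule CauchyI)
    fix e :: real assume "e > 0"
    then have "e / c > 0" using c by simp
    from CauchyD[OF LIMSEQ_imp_Cauchy[OF X] this] obtain M
      where "\<forall>m\<ge>M. \<forall>n\<ge>M. norm (X m - X n) < e / c" by auto
    then show "\<exists>M. \<forall>m\<ge>M. \<forall>n\<ge>M. norm (Y m - Y n) < e"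
      using c by (auto simp: iso field_simps)
  qed
  then show ?thesis by (rule Cauchy_convergent)
qed

text \<open>The transform carries no normalizing factor, so it multiplies L2 norms by this constant.
  The type argument supplies the dimension.\<close>

definition plancherel_const :: "'a::euclidean_space itself \<Rightarrow> real" where
  "plancherel_const _ = sqrt ((2 * pi) ^ DIM('a))"

lemma plancherel_const_pos: "plancherel_const TYPE('a::euclidean_space) > 0"
  by (simp add: plancherel_const_def)

definition plancherel :: "('a::euclidean_space \<Rightarrow> complex) \<Rightarrow> bool" where
  "plancherel f \<longleftrightarrow> integrable lborel f \<and> f \<in> L2_space \<and> fourier_L1 f \<in> L2_space \<and>
     norm (to_l2 (fourier_L1 f)) = plancherel_const TYPE('a) * norm (to_l2 f)"

text \<open>Approximation in L1 makes the transforms converge pointwise, approximation in L2 makes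
  the norms converge. Closure of \<open>S\<close> under differences turns the norm identity on
  \<open>S\<close> into an isometry, hence the transforms into a Cauchy sequence. The lemma is used
  twice, to pass from continuous functions to bounded ones of bounded support and from these to all
  of L1 and L2.\<close>

lemma plancherel_closure:
  fixes f :: "'a::euclidean_space \<Rightarrow> complex"
  assumes S: "\<And>f. f \<in> S \<Longrightarrow> plancherel f" "\<And>f g. f \<in> S \<Longrightarrow> g \<in> S \<Longrightarrow> (\<lambda>x. f x - g x) \<in> S"
    and g: "\<And>n. g n \<in> S"
    and f: "integrable lborel f" "f \<in> L2_space"
    and L1: "(\<lambda>n. L1_norm (\<lambda>x. g n x - f x)) \<longlonglongrightarrow> 0" and L2: "(\<lambda>n. to_l2 (g n)) \<longlonglongrightarrow> to_l2 f"
  shows "plancherel f"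
proof -
  define c where "c = plancherel_const TYPE('a)"
  have c: "c > 0" unfolding c_def by (rule plancherel_const_pos)
  note [measurable] = borel_measurable_integrable[OF f(1), simplified]
  have gn: "integrable lborel (g n)" "g n \<in> L2_space" "fourier_L1 (g n) \<in> L2_space"
    "norm (to_l2 (fourier_L1 (g n))) = c * norm (to_l2 (g n))" for n
    using S(1)[OF g[of n]] by (auto simp: plancherel_def c_def)
  have diff: "norm (to_l2 (fourier_L1 (g n)) - to_l2 (fourier_L1 (g m))) = c * norm (to_l2 (g n) - to_l2 (g m))" for n m
  proof -
    have "norm (to_l2 (fourier_L1 (\<lambda>x. g n x - g m x))) = c * norm (to_l2 (\<lambda>x. g n x - g m x))"
      using S(1)[OF S(2)[OF g g], of n m] by (simp add: plancherel_def c_def)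
    moreover have "fourier_L1 (\<lambda>x. g n x - g m x) = (\<lambda>\<xi>. fourier_L1 (g n) \<xi> - fourier_L1 (g m) \<xi>)"
      using fourier_L1_diff[OF gn(1) gn(1)] by blast
    ultimately show ?thesis by (simp add: to_l2_diff gn)
  qed
  obtain h where h: "(\<lambda>n. to_l2 (fourier_L1 (g n))) \<longlonglongrightarrow> h"
    using isometric_image_converges[OF L2 c, of "\<lambda>n. to_l2 (fourier_L1 (g n))"] diff by (auto simp: convergent_def)
  have pt: "(\<lambda>n. fourier_L1 (g n) \<xi>) \<longlonglongrightarrow> fourier_L1 f \<xi>" for \<xi>
  proof (rule LIM_zero_cancel, rule tendsto_norm_zero_cancel, rule real_tendsto_sandwich[OF _ _ tendsto_const L1])
    show "\<forall>\<^sub>F n in sequentially. norm (fourier_L1 (g n) \<xi> - fourier_L1 f \<xi>) \<le> L1_norm (\<lambda>x. g n x - f x)"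
      using norm_fourier_L1_le[of "\<lambda>x. g n x - f x" \<xi> for n] by (simp add: fourier_L1_diff gn f)
  qed simp
  have 1: "fourier_L1 f \<in> L2_space" "to_l2 (fourier_L1 f) = h"
    using l2_limit_eq_pointwise_limit[OF gn(3) h pt] by simp_all
  have "(\<lambda>n. norm (to_l2 (fourier_L1 (g n)))) \<longlonglongrightarrow> c * norm (to_l2 f)"
    unfolding gn(4) by (intro tendsto_intros L2)
  with tendsto_norm[OF h] have "norm h = c * norm (to_l2 f)"
    by (rule LIMSEQ_unique)
  then show ?thesis using 1 f by (simp add: plancherel_def c_def)
qed

lemma plancherel_continuous:
  assumes f: "integrable lborel f" and cont: "continuous_on UNIV f" and B: "\<And>x. cmod (f x) \<le> B"
  shows "plancherel f"
proof -
  have L2: "f \<in> L2_space" by (rule L2_space_bounded_integrable[OF f B])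
  note * = plancherel_identity_continuous[OF f cont B]
  have "norm (to_l2 (fourier_L1 f)) = sqrt ((2 * pi) ^ DIM('a) * (\<integral>x. (cmod (f x))\<^sup>2 \<partial>lborel))"
    using *(2) by (simp add: norm_to_l2 *(1) L2_norm_def)
  then show ?thesis
    using f L2 *(1) by (simp add: plancherel_def plancherel_const_def norm_to_l2 L2_norm_def real_sqrt_mult)
qed

text \<open>A measurable function is an almost everywhere limit of continuous ones. These are made
  uniformly bounded by \<open>clip\<close> and cut off in space by \<open>\<psi>\<close>; both maps
  are continuous and leave the limit alone, because \<open>f\<close> is itself bounded by
  \<open>M\<close> and vanishes where \<open>\<psi>\<close> differs from 1.\<close>

lemma plancherel_bounded_support:
  fixes f :: "'a::euclidean_space \<Rightarrow> complex"
  assumes f [measurable]: "f \<in> borel_measurable borel" and B: "\<And>x. cmod (f x) \<le> B"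
    and R: "\<And>x. norm x > R \<Longrightarrow> f x = 0"
  shows "plancherel f"
proof -
  define S where "S = {f :: 'a \<Rightarrow> complex. integrable lborel f \<and> continuous_on UNIV f \<and> (\<exists>B. \<forall>x. cmod (f x) \<le> B)}"
  define M where "M = max B 1"
  have M: "M > 0" "\<And>x. cmod (f x) \<le> M" using B by (auto simp: M_def max.coboundedI1)
  have "f \<in> borel_measurable (lebesgue_on UNIV)"
    using measurable_completion[of f lborel borel] by (simp add: lebesgue_on_UNIV_eq)
  then have "f measurable_on UNIV"
    by (simp add: measurable_on_iff_borel_measurable)
  then obtain N k where N: "negligible N" and k: "\<And>n. continuous_on UNIV (k n)"
    "\<And>x. x \<notin> N \<Longrightarrow> (\<lambda>n. k n x) \<longlonglongrightarrow> f x"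
    unfolding measurable_on_def by auto
  \<comment> \<open>The radial retraction onto the disc of radius \<open>M\<close>. The quotient
    keeps it continuous at the origin, and \<open>M = max B 1\<close> keeps the denominator
    positive.\<close>
  define clip :: "complex \<Rightarrow> complex" where "clip z = complex_of_real (M / max M (cmod z)) * z" for z
  define \<psi> :: "'a \<Rightarrow> real" where "\<psi> x = max 0 (min 1 (R + 1 - norm x))" for x
  define g where "g n x = complex_of_real (\<psi> x) * clip (k n x)" for n x
  define w :: "'a \<Rightarrow> real" where "w x = M * indicator (cball 0 (R + 1)) x" for x
  have clip_bd: "cmod (clip z) \<le> M" for z
    using M(1) by (auto simp: clip_def norm_mult norm_divide divide_simps max_def)
  have clip_cont: "continuous_on UNIV clip"
    unfolding clip_def using M(1) by (intro continuous_intros) auto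
  have \<psi>: "0 \<le> \<psi> x" "\<psi> x \<le> 1" "norm x \<le> R \<Longrightarrow> \<psi> x = 1" "norm x > R + 1 \<Longrightarrow> \<psi> x = 0" for x
    by (auto simp: \<psi>_def)
  have g_cont: "continuous_on UNIV (g n)" for n
  proof -
    have "continuous_on UNIV (\<lambda>x. clip (k n x))"
      by (rule continuous_on_compose2[OF clip_cont k(1)]) auto
    then show ?thesis unfolding g_def \<psi>_def by (intro continuous_intros)
  qed
  then have g_meas: "g n \<in> borel_measurable borel" for n
    by (rule borel_measurable_continuous_onI)
  have g_bd: "cmod (g n x) \<le> w x" for n x
  proof (cases "norm x > R + 1")
    case False
    have "cmod (g n x) \<le> 1 * M"
      unfolding g_def norm_mult using \<psi>[of x] clip_bd by (intro mult_mono) auto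
    then show ?thesis using False by (simp add: w_def)
  qed (simp add: g_def \<psi> w_def)
  have "N \<in> null_sets lebesgue" using N by (simp add: negligible_iff_null_sets)
  then have "AE x in lebesgue. x \<notin> N" by (rule AE_not_in)
  then have "AE x in lborel. x \<notin> N" by (simp add: AE_completion_iff)
  then have lim: "AE x in lborel. (\<lambda>n. g n x) \<longlonglongrightarrow> f x"
  proof eventually_elim
    fix x assume "x \<notin> N"
    have 1: "clip (f x) = f x" using M by (simp add: clip_def max_absorb1)
    have 2: "complex_of_real (\<psi> x) * f x = f x"
      using R[of x] \<psi>(3)[of x] by (cases "norm x > R") auto
    have "isCont clip (f x)" using clip_cont by (simp add: continuous_on_eq_continuous_at)
    then have "(\<lambda>n. clip (k n x)) \<longlonglongrightarrow> clip (f x)"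
      by (rule isCont_tendsto_compose) (rule k(2)[OF \<open>x \<notin> N\<close>])
    then have "(\<lambda>n. g n x) \<longlonglongrightarrow> complex_of_real (\<psi> x) * clip (f x)"
      unfolding g_def by (intro tendsto_intros)
    then show "(\<lambda>n. g n x) \<longlonglongrightarrow> f x" by (simp only: 1 2)
  qed
  have ind: "integrable lborel (indicator (cball 0 (R + 1)) :: 'a \<Rightarrow> real)"
    by (rule integrable_real_indicator) (simp_all add: emeasure_bounded_finite[simplified])
  have "(\<lambda>x. (w x)\<^sup>2) = (\<lambda>x. M\<^sup>2 * indicator (cball 0 (R + 1)) x)"
    by (auto simp: w_def indicator_def)
  then have w: "integrable lborel (\<lambda>x. (w x)\<^sup>2)" "integrable lborel w"
    using ind by (simp_all add: w_def[abs_def])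
  have w_meas: "w \<in> borel_measurable borel"
    using borel_measurable_integrable[OF w(2)] by simp
  note L1 = L1_dominated[OF g_meas f lim AE_I2[OF g_bd] w(2)]
  note L2 = L2_dominated[OF g_meas f lim AE_I2[OF g_bd] w(1) w_meas]
  show ?thesis
  proof (rule plancherel_closure[where S = S and g = g])
    show "g n \<in> S" for n
      using L1(1) g_cont g_bd by (auto simp: S_def w_def indicator_def intro!: exI[of _ M] order_trans[OF g_bd] less_imp_le[OF M(1)])
    show "plancherel f" if "f \<in> S" for f
      using that by (auto simp: S_def intro: plancherel_continuous)
    show "(\<lambda>x. f x - g x) \<in> S" if fg: "f \<in> S" "g \<in> S" for f g
    proof -
      obtain B B' where "\<forall>x. cmod (f x) \<le> B" "\<forall>x. cmod (g x) \<le> B'" using fg by (auto simp: S_def)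
      then have "cmod (f x - g x) \<le> B + B'" for x
        by (intro order_trans[OF norm_triangle_ineq4] add_mono) auto
      then show ?thesis using fg by (auto simp: S_def intro!: continuous_intros)
    qed
  qed (use L1 L2 in auto)
qed

theorem plancherel_L1_L2:
  fixes f :: "'a::euclidean_space \<Rightarrow> complex"
  assumes int: "integrable lborel f" and L2: "f \<in> L2_space"
  shows "plancherel f"
proof -
  define S where "S = {f :: 'a \<Rightarrow> complex. f \<in> borel_measurable borel \<and> (\<exists>B. \<forall>x. cmod (f x) \<le> B) \<and> (\<exists>R. \<forall>x. norm x > R \<longrightarrow> f x = 0)}"
  note f [measurable] = L2_space_measurable[OF L2]
  \<comment> \<open>Truncation both of the argument and of the value: every \<open>g n\<close> is
    bounded with bounded support, and at each point the sequence is eventually equal to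
    \<open>f\<close>.\<close>
  define g where "g n x = indicator {x. norm x \<le> real n \<and> cmod (f x) \<le> real n} x *\<^sub>R f x" for n x
  have g_meas: "g n \<in> borel_measurable borel" for n unfolding g_def by measurable
  have g_bd: "cmod (g n x) \<le> cmod (f x)" for n x by (simp add: g_def indicator_def)
  have lim: "AE x in lborel. (\<lambda>n. g n x) \<longlonglongrightarrow> f x"
  proof (rule AE_I2)
    fix x
    obtain N where N: "max (norm x) (cmod (f x)) \<le> real N" using real_arch_simple by blast
    have "\<forall>\<^sub>F n in sequentially. g n x = f x"
      using eventually_ge_at_top[of N] by eventually_elim (use N in \<open>auto simp: g_def\<close>)
    then show "(\<lambda>n. g n x) \<longlonglongrightarrow> f x" by (rule tendsto_eventually)
  qed
  note L1d = L1_dominated[OF g_meas f lim AE_I2[OF g_bd] integrable_norm[OF int]]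
  note L2d = L2_dominated[OF g_meas f lim AE_I2[OF g_bd] L2_space_integrable[OF L2]
      measurable_compose[OF f borel_measurable_norm]]
  show ?thesis
  proof (rule plancherel_closure[where S = S and g = g])
    have "cmod (g n x) \<le> real n" for n x by (auto simp: g_def indicator_def)
    moreover have "norm x > real n \<Longrightarrow> g n x = 0" for n x by (auto simp: g_def indicator_def)
    ultimately show "g n \<in> S" for n
      using g_meas unfolding S_def by blast
    show "plancherel f" if "f \<in> S" for f
      using that by (auto simp: S_def intro: plancherel_bounded_support)
    show "(\<lambda>x. f x - g x) \<in> S" if fg: "f \<in> S" "g \<in> S" for f g
    proof -
      obtain B where "\<forall>x. cmod (f x) \<le> B" using fg(1) unfolding S_def by blast
      moreover obtain B' where "\<forall>x. cmod (g x) \<le> B'" using fg(2) unfolding S_def by blast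
      ultimately have 1: "\<forall>x. cmod (f x - g x) \<le> B + B'"
        by (intro allI order_trans[OF norm_triangle_ineq4] add_mono) auto
      obtain R where "\<forall>x. norm x > R \<longrightarrow> f x = 0" using fg(1) unfolding S_def by blast
      moreover obtain R' where "\<forall>x. norm x > R' \<longrightarrow> g x = 0" using fg(2) unfolding S_def by blast
      ultimately have 2: "\<forall>x. norm x > max R R' \<longrightarrow> f x - g x = 0" by simp
      have [measurable]: "f \<in> borel_measurable borel" "g \<in> borel_measurable borel" using fg by (auto simp: S_def)
      have "(\<lambda>x. f x - g x) \<in> borel_measurable borel" by measurable
      then show ?thesis using 1 2 unfolding S_def by blast
    qed
  qed (use int L2 L1d L2d in auto)
qed

subsection \<open>The Fourier transform on square integrable functions\<close>

definition truncate :: "real \<Rightarrow> ('a::euclidean_space \<Rightarrow> complex) \<Rightarrow> 'a \<Rightarrow> complex" where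
  "truncate R f x = indicator (cball 0 R) x *\<^sub>R f x"

lemma truncated_fourier_eq: "truncated_fourier R f = fourier_L1 (truncate R f)"
  by (rule ext) (simp add: truncated_fourier_def fourier_L1_def truncate_def set_lebesgue_integral_def)

lemma truncate_L2: "f \<in> L2_space \<Longrightarrow> truncate R f \<in> L2_space"
  by (rule L2_space_bound[of _ f 1])
    (auto simp: truncate_def[abs_def] indicator_def dest: L2_space_measurable intro!: borel_measurable_scaleR)

lemma truncate_integrable:
  fixes f :: "'a::euclidean_space \<Rightarrow> complex"
  assumes f: "f \<in> L2_space"
  shows "integrable lborel (truncate R f)"
proof (rule Bochner_Integration.integrable_bound)
  note [measurable] = L2_space_measurable[OF f]
  have "integrable lborel (indicator (cball 0 R) :: 'a \<Rightarrow> real)"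
    by (rule integrable_real_indicator) (simp_all add: emeasure_bounded_finite[simplified])
  then show "integrable lborel (\<lambda>x. indicator (cball 0 R) x + (cmod (f x))\<^sup>2)"
    using L2_space_integrable[OF f] by simp
  show "truncate R f \<in> borel_measurable lborel"
    using L2_space_measurable[OF truncate_L2[OF f]] by simp
  have "y \<le> 1 + y\<^sup>2" for y :: real
    using sum_squares_bound[of y 1] by (simp, smt (verit) zero_le_power2)
  then show "AE x in lborel. norm (truncate R f x) \<le> norm (indicator (cball 0 R) x + (cmod (f x))\<^sup>2)"
    by (auto simp: truncate_def indicator_def)
qed

lemma truncate_tendsto:
  fixes f :: "'a::euclidean_space \<Rightarrow> complex"
  assumes f: "f \<in> L2_space"
  shows "((\<lambda>R. to_l2 (truncate R f)) \<longlongrightarrow> to_l2 f) at_top"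
proof (rule tendsto_at_topI_sequentially)
  fix X :: "nat \<Rightarrow> real" assume X: "filterlim X at_top sequentially"
  note fm [measurable] = L2_space_measurable[OF f]
  show "(\<lambda>n. to_l2 (truncate (X n) f)) \<longlonglongrightarrow> to_l2 f"
  proof (rule L2_dominated(3)[OF _ _ _ _ L2_space_integrable[OF f]
      measurable_compose[OF fm borel_measurable_norm]])
    show "truncate (X n) f \<in> borel_measurable borel" for n
      by (rule L2_space_measurable[OF truncate_L2[OF f]])
    show "AE x in lborel. (\<lambda>n. truncate (X n) f x) \<longlonglongrightarrow> f x"
    proof (rule AE_I2)
      fix x :: 'a
      have "\<forall>\<^sub>F n in sequentially. norm x \<le> X n" using X by (simp add: filterlim_at_top)
      then have "\<forall>\<^sub>F n in sequentially. truncate (X n) f x = f x"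
        by eventually_elim (simp add: truncate_def)
      then show "(\<lambda>n. truncate (X n) f x) \<longlonglongrightarrow> f x" by (rule tendsto_eventually)
    qed
    show "AE x in lborel. cmod (truncate (X n) f x) \<le> cmod (f x)" for n
      by (auto simp: truncate_def indicator_def)
  qed (rule fm)
qed

lemma fourier_L1_isometry:
  fixes f g :: "'a::euclidean_space \<Rightarrow> complex"
  assumes "integrable lborel f" "f \<in> L2_space" "integrable lborel g" "g \<in> L2_space"
  shows "norm (to_l2 (fourier_L1 f) - to_l2 (fourier_L1 g)) = plancherel_const TYPE('a) * norm (to_l2 f - to_l2 g)"
proof -
  have p: "plancherel f" "plancherel g" "plancherel (\<lambda>x. f x - g x)"
    using assms by (auto intro!: plancherel_L1_L2 L2_space_diff)
  have "fourier_L1 (\<lambda>x. f x - g x) = (\<lambda>\<xi>. fourier_L1 f \<xi> - fourier_L1 g \<xi>)"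
    using fourier_L1_diff[OF assms(1,3)] by blast
  then show ?thesis using p by (simp add: plancherel_def to_l2_diff)
qed

text \<open>\<open>fourier\<close> is a choice, so a limit has to be exhibited first. Isometry makes
  the transforms of the truncations Cauchy along integer radii, and completeness of
  \<open>l2\<close> provides the limit; the choice is then a limit along all real radii.\<close>

lemma fourier_spec:
  fixes f :: "'a::euclidean_space \<Rightarrow> complex"
  assumes f: "f \<in> L2_space"
  shows "fourier f \<in> L2_space"
    and "((\<lambda>R. to_l2 (fourier_L1 (truncate R f))) \<longlongrightarrow> to_l2 (fourier f)) at_top"
proof -
  define c where "c = plancherel_const TYPE('a)"
  have c: "c > 0" unfolding c_def by (rule plancherel_const_pos)
  have L2: "fourier_L1 (truncate R f) \<in> L2_space" for R
    using plancherel_L1_L2[OF truncate_integrable truncate_L2, OF f f] by (simp add: plancherel_def)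
  have iso: "norm (to_l2 (fourier_L1 (truncate R f)) - to_l2 (fourier_L1 (truncate R' f)))
      = c * norm (to_l2 (truncate R f) - to_l2 (truncate R' f))" for R R'
    unfolding c_def by (intro fourier_L1_isometry truncate_integrable truncate_L2 f)
  have lim: "(\<lambda>n. to_l2 (truncate (real n) f)) \<longlonglongrightarrow> to_l2 f"
    by (rule filterlim_compose[OF truncate_tendsto[OF f] filterlim_real_sequentially])
  obtain h where h: "(\<lambda>n. to_l2 (fourier_L1 (truncate (real n) f))) \<longlonglongrightarrow> h"
    using isometric_image_converges[OF lim c, of "\<lambda>n. to_l2 (fourier_L1 (truncate (real n) f))"] iso
    by (auto simp: convergent_def)
  \<comment> \<open>Letting one of the two radii tend to infinity turns the isometry into an exact
    distance to \<open>h\<close> for every real \<open>R\<close>, which upgrades convergence along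
    integers.\<close>
  have dist: "norm (to_l2 (fourier_L1 (truncate R f)) - h) = c * norm (to_l2 (truncate R f) - to_l2 f)" for R
  proof (rule LIMSEQ_unique)
    show "(\<lambda>n. norm (to_l2 (fourier_L1 (truncate R f)) - to_l2 (fourier_L1 (truncate (real n) f))))
        \<longlonglongrightarrow> norm (to_l2 (fourier_L1 (truncate R f)) - h)"
      by (intro tendsto_intros h)
    show "(\<lambda>n. norm (to_l2 (fourier_L1 (truncate R f)) - to_l2 (fourier_L1 (truncate (real n) f))))
        \<longlonglongrightarrow> c * norm (to_l2 (truncate R f) - to_l2 f)"
      unfolding iso by (intro tendsto_intros lim)
  qed
  have nn: "(\<integral>\<^sup>+\<xi>. ennreal ((cmod (truncated_fourier R f \<xi> - g \<xi>))\<^sup>2) \<partial>lborel)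
      = ennreal ((norm (to_l2 (fourier_L1 (truncate R f)) - to_l2 g))\<^sup>2)" if "g \<in> L2_space" for g R
    using L2_nn_integral[OF L2_space_diff[OF L2 that]] by (simp add: truncated_fourier_eq to_l2_diff L2 that)
  obtain k where k: "k \<in> L2_space" "h = to_l2 k" using l2_cases[of h] by metis
  have "((\<lambda>R. ennreal ((c * norm (to_l2 (truncate R f) - to_l2 f))\<^sup>2)) \<longlongrightarrow> ennreal ((c * norm (to_l2 f - to_l2 f))\<^sup>2)) at_top"
    by (intro tendsto_ennrealI tendsto_intros truncate_tendsto f)
  then have "k \<in> L2_space \<and>
     ((\<lambda>R. \<integral>\<^sup>+\<xi>. ennreal ((cmod (truncated_fourier R f \<xi> - k \<xi>))\<^sup>2) \<partial>lborel) \<longlongrightarrow> 0) at_top"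
    using k(1) by (simp add: nn[OF k(1)] dist[unfolded k(2)])
  from someI[of "\<lambda>g. g \<in> L2_space \<and>
     ((\<lambda>R. \<integral>\<^sup>+\<xi>. ennreal ((cmod (truncated_fourier R f \<xi> - g \<xi>))\<^sup>2) \<partial>lborel) \<longlongrightarrow> 0) at_top", OF this]
  have *: "fourier f \<in> L2_space"
    "((\<lambda>R. \<integral>\<^sup>+\<xi>. ennreal ((cmod (truncated_fourier R f \<xi> - fourier f \<xi>))\<^sup>2) \<partial>lborel) \<longlongrightarrow> 0) at_top"
    unfolding fourier_def[symmetric] by simp_all
  show "fourier f \<in> L2_space" by fact
  have "((\<lambda>R. (norm (to_l2 (fourier_L1 (truncate R f)) - to_l2 (fourier f)))\<^sup>2) \<longlongrightarrow> 0) at_top"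
    using *(2) unfolding nn[OF *(1)] by (simp flip: ennreal_0)
  then have "((\<lambda>R. sqrt ((norm (to_l2 (fourier_L1 (truncate R f)) - to_l2 (fourier f)))\<^sup>2)) \<longlongrightarrow> sqrt 0) at_top"
    by (rule tendsto_real_sqrt)
  then have "((\<lambda>R. norm (to_l2 (fourier_L1 (truncate R f)) - to_l2 (fourier f))) \<longlongrightarrow> 0) at_top"
    by simp
  then show "((\<lambda>R. to_l2 (fourier_L1 (truncate R f))) \<longlongrightarrow> to_l2 (fourier f)) at_top"
    by (rule LIM_zero_cancel[OF tendsto_norm_zero_cancel])
qed

text \<open>The difference of a truncated transform and \<open>fourier_L1 f\<close> has a norm
  proportional to that of the truncation error. The lemma gives access to pointwise bounds for the
  transforms of the initial data.\<close>

lemma fourier_L1_fourier: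
  fixes f :: "'a::euclidean_space \<Rightarrow> complex"
  assumes "integrable lborel f" "f \<in> L2_space"
  shows "AE \<xi> in lborel. fourier f \<xi> = fourier_L1 f \<xi>"
proof -
  have L2: "fourier_L1 f \<in> L2_space"
    using plancherel_L1_L2[OF assms] by (simp add: plancherel_def)
  have "((\<lambda>R. norm (to_l2 (fourier_L1 (truncate R f)) - to_l2 (fourier_L1 f))) \<longlongrightarrow>
      plancherel_const TYPE('a) * norm (to_l2 f - to_l2 f)) at_top"
    unfolding fourier_L1_isometry[OF truncate_integrable[OF assms(2)] truncate_L2[OF assms(2)] assms]
    by (intro tendsto_intros truncate_tendsto assms)
  then have "((\<lambda>R. norm (to_l2 (fourier_L1 (truncate R f)) - to_l2 (fourier_L1 f))) \<longlongrightarrow> 0) at_top"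
    by simp
  then have "((\<lambda>R. to_l2 (fourier_L1 (truncate R f))) \<longlongrightarrow> to_l2 (fourier_L1 f)) at_top"
    by (rule LIM_zero_cancel[OF tendsto_norm_zero_cancel])
  then have "to_l2 (fourier f) = to_l2 (fourier_L1 f)"
    using tendsto_unique[OF _ fourier_spec(2)[OF assms(2)]] by simp
  then show ?thesis by (simp add: to_l2_eq_iff L2 fourier_spec assms)
qed

section \<open>The transform as an operator on \<open>l2\<close>: isometry, adjoint and
  range\<close>

definition fourier_l2 :: "'a::euclidean_space l2 \<Rightarrow> 'a l2" where
  "fourier_l2 x = to_l2 (fourier (rep_l2 x))"

lemma fourier_l2_tendsto:
  "((\<lambda>R. to_l2 (fourier_L1 (truncate R (rep_l2 x)))) \<longlongrightarrow> fourier_l2 x) at_top"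
  unfolding fourier_l2_def by (rule fourier_spec(2)) simp

lemma fourier_L1_truncate_L2: "f \<in> L2_space \<Longrightarrow> fourier_L1 (truncate R f) \<in> L2_space"
  using plancherel_L1_L2[OF truncate_integrable truncate_L2] by (auto simp: plancherel_def)

text \<open>Altering a function on a null set changes none of the truncated integrals, so the limit
  does not depend on the representative.\<close>

lemma fourier_l2_to_l2:
  assumes f: "f \<in> L2_space"
  shows "fourier_l2 (to_l2 f) = to_l2 (fourier f)"
proof -
  have ae: "AE x in lborel. rep_l2 (to_l2 f) x = f x" by (rule rep_l2_to_l2[OF f])
  have "fourier_L1 (truncate R (rep_l2 (to_l2 f))) = fourier_L1 (truncate R f)" for R
    unfolding fourier_L1_def
  proof (intro ext integral_cong_AE)
    note [measurable] = L2_space_measurable[OF truncate_L2[OF f]] L2_space_measurable[OF truncate_L2[OF rep_l2_L2]]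
    fix \<xi>
    show "AE x in lborel. exp (- \<i> * complex_of_real (x \<bullet> \<xi>)) * truncate R (rep_l2 (to_l2 f)) x
       = exp (- \<i> * complex_of_real (x \<bullet> \<xi>)) * truncate R f x"
      using ae by eventually_elim (simp add: truncate_def)
    show "(\<lambda>x. exp (- \<i> * complex_of_real (x \<bullet> \<xi>)) * truncate R (rep_l2 (to_l2 f)) x) \<in> borel_measurable lborel"
      by measurable
    show "(\<lambda>x. exp (- \<i> * complex_of_real (x \<bullet> \<xi>)) * truncate R f x) \<in> borel_measurable lborel"
      by measurable
  qed
  then have "((\<lambda>R. to_l2 (fourier_L1 (truncate R f))) \<longlongrightarrow> fourier_l2 (to_l2 f)) at_top"
    using fourier_l2_tendsto[of "to_l2 f"] by simp
  from tendsto_unique[OF _ this fourier_spec(2)[OF f]] show ?thesis by simp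
qed

lemma norm_fourier_l2: "norm (fourier_l2 x) = plancherel_const TYPE('a) * norm (x :: 'a::euclidean_space l2)"
proof (rule tendsto_unique[OF trivial_limit_at_top_linorder])
  show "((\<lambda>R. norm (to_l2 (fourier_L1 (truncate R (rep_l2 x))))) \<longlongrightarrow> norm (fourier_l2 x)) at_top"
    by (intro tendsto_intros fourier_l2_tendsto)
  have "norm (to_l2 (fourier_L1 (truncate R (rep_l2 x)))) = plancherel_const TYPE('a) * norm (to_l2 (truncate R (rep_l2 x)))" for R
    using plancherel_L1_L2[OF truncate_integrable[OF rep_l2_L2[of x]] truncate_L2[OF rep_l2_L2[of x]]] by (simp add: plancherel_def)
  then show "((\<lambda>R. norm (to_l2 (fourier_L1 (truncate R (rep_l2 x))))) \<longlongrightarrow> plancherel_const TYPE('a) * norm x) at_top"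
    using tendsto_mult[OF tendsto_const tendsto_norm[OF truncate_tendsto[OF rep_l2_L2, of x]], of "plancherel_const TYPE('a)"]
    by simp
qed

lemma bounded_linear_fourier_l2: "bounded_linear (fourier_l2 :: 'a::euclidean_space l2 \<Rightarrow> 'a l2)"
proof (rule bounded_linear_intro)
  fix x y :: "'a l2" and c :: real
  obtain f g where f: "f \<in> L2_space" "x = to_l2 f" and g: "g \<in> L2_space" "y = to_l2 g"
    using l2_cases[of x] l2_cases[of y] by metis
  note int = truncate_integrable[OF f(1)] truncate_integrable[OF g(1)]
  have "fourier_L1 (truncate R (\<lambda>x. f x + g x)) = (\<lambda>\<xi>. fourier_L1 (truncate R f) \<xi> + fourier_L1 (truncate R g) \<xi>)" for R
  proof -
    have "truncate R (\<lambda>x. f x + g x) = (\<lambda>x. truncate R f x + truncate R g x)"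
      by (auto simp: truncate_def scaleR_add_right)
    then show ?thesis
      using int by (simp add: fourier_L1_def distrib_left integrable_exp_mult[simplified] fun_eq_iff)
  qed
  then have "to_l2 (fourier_L1 (truncate R (\<lambda>x. f x + g x)))
     = to_l2 (fourier_L1 (truncate R f)) + to_l2 (fourier_L1 (truncate R g))" for R
    by (simp add: to_l2_add fourier_L1_truncate_L2 f g)
  then have "((\<lambda>R. to_l2 (fourier_L1 (truncate R (\<lambda>x. f x + g x)))) \<longlongrightarrow> to_l2 (fourier f) + to_l2 (fourier g)) at_top"
    using tendsto_add[OF fourier_spec(2)[OF f(1)] fourier_spec(2)[OF g(1)]] by simp
  from tendsto_unique[OF _ this fourier_spec(2)[OF L2_space_add[OF f(1) g(1)]]]
  show "fourier_l2 (x + y) = fourier_l2 x + fourier_l2 y"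
    by (simp add: f g fourier_l2_to_l2 L2_space_add flip: to_l2_add)
  have "fourier_L1 (truncate R (\<lambda>x. c *\<^sub>R f x)) = (\<lambda>\<xi>. c *\<^sub>R fourier_L1 (truncate R f) \<xi>)" for R
  proof -
    have "truncate R (\<lambda>x. c *\<^sub>R f x) = (\<lambda>x. c *\<^sub>R truncate R f x)"
      by (auto simp: truncate_def)
    then show ?thesis
      by (simp add: fourier_L1_def fun_eq_iff del: scaleR_conv_of_real)
  qed
  then have "to_l2 (fourier_L1 (truncate R (\<lambda>x. c *\<^sub>R f x))) = c *\<^sub>R to_l2 (fourier_L1 (truncate R f))" for R
    by (simp add: to_l2_scaleR fourier_L1_truncate_L2 f)
  then have "((\<lambda>R. to_l2 (fourier_L1 (truncate R (\<lambda>x. c *\<^sub>R f x)))) \<longlongrightarrow> c *\<^sub>R to_l2 (fourier f)) at_top"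
    using tendsto_scaleR[OF tendsto_const fourier_spec(2)[OF f(1)], of c] by simp
  from tendsto_unique[OF _ this fourier_spec(2)[OF L2_space_scaleR[OF f(1)]]]
  show "fourier_l2 (c *\<^sub>R x) = c *\<^sub>R fourier_l2 x"
    by (simp add: f fourier_l2_to_l2 L2_space_scaleR flip: to_l2_scaleR)
  show "norm (fourier_l2 x) \<le> norm x * plancherel_const TYPE('a)"
    by (simp add: norm_fourier_l2)
qed

lemmas fourier_l2_add = linear_add[OF bounded_linear.linear[OF bounded_linear_fourier_l2]]
  and fourier_l2_diff = linear_diff[OF bounded_linear.linear[OF bounded_linear_fourier_l2]]
  and fourier_l2_scaleR = linear_scale[OF bounded_linear.linear[OF bounded_linear_fourier_l2]]
  and tendsto_fourier_l2 = bounded_linear.tendsto[OF bounded_linear_fourier_l2]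

lemma inner_fourier_l2:
  "fourier_l2 x \<bullet> fourier_l2 y = (plancherel_const TYPE('a))\<^sup>2 * (x \<bullet> (y :: 'a::euclidean_space l2))"
  unfolding dot_norm fourier_l2_add[symmetric] norm_fourier_l2 power_mult_distrib
  by (simp add: algebra_simps)

lemma L2_space_cnj: "f \<in> L2_space \<Longrightarrow> (\<lambda>x. cnj (f x)) \<in> L2_space"
  by (rule L2_space_bound[of _ f 1]) (auto dest: L2_space_measurable)

definition cnj_l2 :: "'a::euclidean_space l2 \<Rightarrow> 'a l2" where
  "cnj_l2 x = to_l2 (\<lambda>t. cnj (rep_l2 x t))"

lemma cnj_l2_to_l2:
  assumes "f \<in> L2_space"
  shows "cnj_l2 (to_l2 f) = to_l2 (\<lambda>x. cnj (f x))"
  unfolding cnj_l2_def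
  by (rule to_l2_cong) (use rep_l2_to_l2[OF assms] in \<open>auto intro!: L2_space_cnj assms elim!: eventually_mono\<close>)

lemma cnj_l2_cnj_l2 [simp]: "cnj_l2 (cnj_l2 x) = x"
proof -
  obtain f where "f \<in> L2_space" "x = to_l2 f" using l2_cases[of x] by metis
  then show ?thesis by (simp add: cnj_l2_to_l2 L2_space_cnj)
qed

lemma bounded_linear_cnj_l2: "bounded_linear (cnj_l2 :: 'a::euclidean_space l2 \<Rightarrow> 'a l2)"
proof (rule bounded_linear_intro)
  fix x y :: "'a l2" and c :: real
  obtain f g where f: "f \<in> L2_space" "x = to_l2 f" and g: "g \<in> L2_space" "y = to_l2 g"
    using l2_cases[of x] l2_cases[of y] by metis
  show "cnj_l2 (x + y) = cnj_l2 x + cnj_l2 y"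
    by (simp add: f g cnj_l2_to_l2 L2_space_add L2_space_cnj flip: to_l2_add)
  show "cnj_l2 (c *\<^sub>R x) = c *\<^sub>R cnj_l2 x"
    by (simp add: f cnj_l2_to_l2 L2_space_scaleR L2_space_cnj flip: to_l2_scaleR)
  show "norm (cnj_l2 x) \<le> norm x * 1"
    by (simp add: f cnj_l2_to_l2 L2_space_cnj norm_to_l2 L2_norm_def)
qed

lemmas cnj_l2_scaleR = linear_scale[OF bounded_linear.linear[OF bounded_linear_cnj_l2]]
  and tendsto_cnj_l2 = bounded_linear.tendsto[OF bounded_linear_cnj_l2]

text \<open>The multiplication formula, extended to square integrable functions by continuity, identifies the
  adjoint of the Fourier transform as its conjugate; surjectivity follows from this and the isometry.\<close>
lemma fourier_l2_adjoint: "fourier_l2 x \<bullet> y = x \<bullet> cnj_l2 (fourier_l2 (cnj_l2 y))"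
proof -
  obtain f g where f: "f \<in> L2_space" "x = to_l2 f" and g: "g \<in> L2_space" "y = to_l2 g"
    using l2_cases[of x] l2_cases[of y] by metis
  define f' g' where "f' R = truncate R f" and "g' R = truncate R g" for R
  have L: "integrable lborel (f' R)" "f' R \<in> L2_space" "integrable lborel (g' R)" "g' R \<in> L2_space"
    "fourier_L1 (f' R) \<in> L2_space" for R
    using f g by (simp_all add: f'_def g'_def truncate_integrable truncate_L2 fourier_L1_truncate_L2)
  have cg: "(\<lambda>x. cnj (g' R x)) = truncate R (\<lambda>x. cnj (g x))" for R
    by (auto simp: g'_def truncate_def)
  have L': "integrable lborel (\<lambda>x. cnj (g' R x))" "fourier_L1 (\<lambda>x. cnj (g' R x)) \<in> L2_space" for R
    unfolding cg by (intro truncate_integrable fourier_L1_truncate_L2 L2_space_cnj g(1))+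
  have Re_eq: "z \<bullet> w = Re (z * cnj w)" for z w :: complex
    by (simp add: inner_complex_def)
  \<comment> \<open>A complex product is assembled from real inner products, one for its real and
    one for its imaginary part.\<close>
  have int: "integrable lborel (\<lambda>x. u x * v x)" if "u \<in> L2_space" "v \<in> L2_space" for u v :: "'a \<Rightarrow> complex"
  proof -
    have "integrable lborel (\<lambda>x. complex_of_real (cnj (u x) \<bullet> v x))" "integrable lborel (\<lambda>x. complex_of_real ((\<i> * cnj (u x)) \<bullet> v x))"
      using that by (intro integrable_of_real L2_space_inner_integrable L2_space_cnj L2_space_cmult; simp)+
    then have "integrable lborel (\<lambda>x. complex_of_real (cnj (u x) \<bullet> v x) + \<i> * complex_of_real ((\<i> * cnj (u x)) \<bullet> v x))"
      by simp
    moreover have "complex_of_real (cnj z \<bullet> w) + \<i> * complex_of_real ((\<i> * cnj z) \<bullet> w) = z * w" for z w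
      by (simp add: complex_eq_iff inner_complex_def)
    ultimately show ?thesis by simp
  qed
  have trunc: "to_l2 (fourier_L1 (f' R)) \<bullet> to_l2 (g' R) = to_l2 (f' R) \<bullet> cnj_l2 (to_l2 (fourier_L1 (\<lambda>x. cnj (g' R x))))" for R
  proof -
    have "to_l2 (fourier_L1 (f' R)) \<bullet> to_l2 (g' R) = (\<integral>x. Re (fourier_L1 (f' R) x * cnj (g' R x)) \<partial>lborel)"
      by (simp add: to_l2_inner L Re_eq)
    also have "\<dots> = Re (\<integral>x. fourier_L1 (f' R) x * cnj (g' R x) \<partial>lborel)"
      by (rule integral_Re[OF int[OF L(5) L2_space_cnj[OF L(4)]]])
    also have "\<dots> = Re (\<integral>x. f' R x * fourier_L1 (\<lambda>x. cnj (g' R x)) x \<partial>lborel)"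
      by (subst fourier_L1_multiplication[OF L(1) L'(1)]) (rule refl)
    also have "\<dots> = (\<integral>x. Re (f' R x * fourier_L1 (\<lambda>x. cnj (g' R x)) x) \<partial>lborel)"
      by (rule integral_Re[symmetric, OF int[OF L(2) L'(2)]])
    also have "\<dots> = to_l2 (f' R) \<bullet> cnj_l2 (to_l2 (fourier_L1 (\<lambda>x. cnj (g' R x))))"
      by (simp only: cnj_l2_to_l2 L' to_l2_inner L L2_space_cnj Re_eq complex_cnj_cnj)
    finally show ?thesis .
  qed
  have "((\<lambda>R. to_l2 (fourier_L1 (f' R)) \<bullet> to_l2 (g' R)) \<longlongrightarrow> to_l2 (fourier f) \<bullet> to_l2 g) at_top"
    unfolding f'_def g'_def by (intro tendsto_inner fourier_spec f g truncate_tendsto)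
  moreover have "((\<lambda>R. to_l2 (f' R) \<bullet> cnj_l2 (to_l2 (fourier_L1 (\<lambda>x. cnj (g' R x)))))
      \<longlongrightarrow> to_l2 f \<bullet> cnj_l2 (to_l2 (fourier (\<lambda>x. cnj (g x))))) at_top"
    unfolding cg f'_def by (intro tendsto_inner tendsto_cnj_l2 fourier_spec f g truncate_tendsto L2_space_cnj)
  ultimately have "to_l2 (fourier f) \<bullet> to_l2 g = to_l2 f \<bullet> cnj_l2 (to_l2 (fourier (\<lambda>x. cnj (g x))))"
    unfolding trunc by (rule tendsto_unique[rotated]) simp
  then show ?thesis
    by (simp add: f g fourier_l2_to_l2 cnj_l2_to_l2 L2_space_cnj)
qed

lemma fourier_l2_surj: "\<exists>x. fourier_l2 x = (y :: 'a::euclidean_space l2)"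
proof -
  define c where "c = (plancherel_const TYPE('a))\<^sup>2"
  have c: "c \<noteq> 0" using plancherel_const_pos[where 'a = 'a] by (simp add: c_def)
  \<comment> \<open>With \<open>C\<close> for conjugation and \<open>F\<close> for the transform,
    the adjoint is \<open>C F C\<close>, so the isometry reads \<open>C F C F = c\<close>.
    Evaluating at \<open>C y\<close> and conjugating once more gives \<open>F C F C = c\<close>, a
    right inverse.\<close>
  have left_inverse: "cnj_l2 (fourier_l2 (cnj_l2 (fourier_l2 z))) = c *\<^sub>R z" for z :: "'a l2"
  proof (rule vector_eq_rdot[THEN iffD1], rule allI)
    fix x :: "'a l2"
    show "cnj_l2 (fourier_l2 (cnj_l2 (fourier_l2 z))) \<bullet> x = c *\<^sub>R z \<bullet> x"
      using inner_fourier_l2[of x z] by (simp add: fourier_l2_adjoint inner_commute[of _ x] c_def)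
  qed
  have "fourier_l2 (cnj_l2 (fourier_l2 (cnj_l2 y))) = cnj_l2 (c *\<^sub>R cnj_l2 y)"
    using left_inverse[of "cnj_l2 y"] by (metis cnj_l2_cnj_l2)
  also have "\<dots> = c *\<^sub>R y" by (simp add: cnj_l2_scaleR)
  finally have "fourier_l2 (inverse c *\<^sub>R cnj_l2 (fourier_l2 (cnj_l2 y))) = y"
    using c by (simp add: fourier_l2_scaleR)
  then show ?thesis ..
qed

lemma inv_fourier:
  assumes g: "g \<in> L2_space"
  shows "inv_fourier g \<in> L2_space" "AE \<xi> in lborel. fourier (inv_fourier g) \<xi> = g \<xi>"
proof -
  obtain f where f: "f \<in> L2_space" "fourier_l2 (to_l2 f) = to_l2 g"
    using fourier_l2_surj[of "to_l2 g"] l2_cases by metis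
  then have "f \<in> L2_space \<and> (AE \<xi> in lborel. fourier f \<xi> = g \<xi>)"
    using to_l2_eq_iff[OF fourier_spec(1)[OF f(1)] g] by (simp add: fourier_l2_to_l2)
  from someI[of "\<lambda>f. f \<in> L2_space \<and> (AE \<xi> in lborel. fourier f \<xi> = g \<xi>)", OF this]
  show "inv_fourier g \<in> L2_space" "AE \<xi> in lborel. fourier (inv_fourier g) \<xi> = g \<xi>"
    unfolding inv_fourier_def[symmetric] by simp_all
qed

lemma fourier_l2_inv_fourier: "g \<in> L2_space \<Longrightarrow> fourier_l2 (to_l2 (inv_fourier g)) = to_l2 g"
  by (simp add: fourier_l2_to_l2 inv_fourier to_l2_eq_iff fourier_spec)

lemma fourier_l2_inj: "fourier_l2 x = fourier_l2 y \<longleftrightarrow> x = y"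
  using norm_fourier_l2[of "x - y"] plancherel_const_pos[where 'a = 'a] by (auto simp: fourier_l2_diff)

section \<open>Strongly continuous semigroups on Banach spaces\<close>

text \<open>Sokal's gliding hump proof.\<close>
lemma banach_steinhaus_sequence:
  fixes A :: "nat \<Rightarrow> 'b::banach \<Rightarrow> 'c::real_normed_vector"
  assumes lin: "\<And>n. bounded_linear (A n)" and bdd: "\<And>x. bounded (range (\<lambda>n. A n x))"
  shows "\<exists>K. \<forall>n x. norm (A n x) \<le> K * norm x"
proof (rule ccontr)
  assume neg: "\<not> ?thesis"
  have "\<exists>n. onorm (A n) > 4 ^ k" for k
  proof (rule ccontr)
    assume "\<not> (\<exists>n. onorm (A n) > 4 ^ k)"
    then have "norm (A n x) \<le> 4 ^ k * norm x" for n x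
      by (intro order_trans[OF onorm[OF lin]] mult_right_mono) (auto simp: not_less)
    then show False using neg by blast
  qed
  then obtain m where m: "\<And>k. onorm (A (m k)) > 4 ^ k" by metis
  have step: "\<exists>z. norm (z - x) \<le> r \<and> norm (A n z) \<ge> 2 / 3 * onorm (A n) * r"
    if r: "r > 0" and pos: "onorm (A n) > 0" for x r n
  proof -
    interpret bounded_linear "A n" by (rule lin)
    have "\<exists>y. norm (A n y) > 2 / 3 * onorm (A n) * norm y"
    proof (rule ccontr)
      assume "\<not> ?thesis"
      then have "onorm (A n) \<le> 2 / 3 * onorm (A n)"
        using pos by (intro onorm_bound) (auto simp: not_less)
      then show False using pos by simp
    qed
    then obtain y where y: "norm (A n y) > 2 / 3 * onorm (A n) * norm y" ..
    then have "y \<noteq> 0" by (auto simp: zero)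
    define w where "w = (r / norm y) *\<^sub>R y"
    have w: "norm w = r" using \<open>y \<noteq> 0\<close> r by (simp add: w_def)
    have "norm (A n w) = r / norm y * norm (A n y)" using r by (simp add: w_def scaleR)
    also have "\<dots> \<ge> r / norm y * (2 / 3 * onorm (A n) * norm y)"
      using y r by (intro mult_left_mono) auto
    finally have Aw: "norm (A n w) \<ge> 2 / 3 * onorm (A n) * r" using \<open>y \<noteq> 0\<close> by (simp add: field_simps)
    \<comment> \<open>Since twice \<open>A n w\<close> is the difference of the images of
      \<open>x + w\<close> and \<open>x - w\<close>, one of the two images is at least as large as
      \<open>A n w\<close>, whatever \<open>x\<close> is.\<close>
    have "2 *\<^sub>R A n w = A n (x + w) - A n (x - w)" by (simp add: add diff scaleR_2)
    then have "2 * norm (A n w) \<le> norm (A n (x + w)) + norm (A n (x - w))"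
      using norm_triangle_ineq4[of "A n (x + w)" "A n (x - w)"] norm_scaleR[of 2 "A n w"] by simp
    then consider "norm (A n (x + w)) \<ge> norm (A n w)" | "norm (A n (x - w)) \<ge> norm (A n w)" by linarith
    then show ?thesis
    proof cases
      case 1 then show ?thesis using w Aw by (intro exI[of _ "x + w"]) auto
    next
      case 2 then show ?thesis using w Aw by (intro exI[of _ "x - w"]) auto
    qed
  qed
  \<comment> \<open>Steps of length \<open>(1/3) ^ k\<close> leave a tail of at most half that
    length. The later steps therefore destroy at most \<open>1/2\<close> of the \<open>2/3\<close>
    gained relative to the operator norm; \<open>1/6\<close> survives, and
    \<open>4 ^ k * (1/3) ^ k\<close> is unbounded.\<close>
  have "\<exists>x. \<forall>k. True \<and> (norm (x (Suc k) - x k) \<le> (1/3) ^ k \<and> norm (A (m k) (x (Suc k))) \<ge> 2 / 3 * onorm (A (m k)) * (1/3) ^ k)"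
  proof (rule dependent_nat_choice)
    fix x k
    have "onorm (A (m k)) > 0" using m[of k] by (rule less_trans[rotated]) simp
    then show "\<exists>y. True \<and> norm (y - x) \<le> (1/3) ^ k \<and> norm (A (m k) y) \<ge> 2 / 3 * onorm (A (m k)) * (1/3) ^ k"
      using step[of "(1/3) ^ k" "m k" x] by simp
  qed simp
  then obtain x where x: "\<And>k. norm (x (Suc k) - x k) \<le> (1/3) ^ k"
    "\<And>k. norm (A (m k) (x (Suc k))) \<ge> 2 / 3 * onorm (A (m k)) * (1/3) ^ k" by auto
  have "summable (\<lambda>k. x (Suc k) - x k)"
    by (rule summable_comparison_test[of _ "\<lambda>k. (1/3) ^ k"]) (auto simp: x(1) summable_geometric)
  then have "convergent (\<lambda>n. (\<Sum>i<n. x (Suc i) - x i) + x 0)"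
    by (intro convergent_add convergent_const) (simp add: summable_iff_convergent)
  then obtain z where z: "x \<longlonglongrightarrow> z"
    unfolding sum_lessThan_telescope by (auto simp: convergent_def)
  \<comment> \<open>The exact partial sum of the geometric series, factor
    \<open>1 - (1/3) ^ j\<close> included, is what the induction on \<open>j\<close> can
    carry.\<close>
  have tail: "norm (x (j + Suc k) - x (Suc k)) \<le> (1/3) ^ k / 2 * (1 - (1/3) ^ j)" for k j
  proof (induction j)
    case (Suc j)
    have "norm (x (Suc j + Suc k) - x (Suc k))
        \<le> norm (x (Suc (j + Suc k)) - x (j + Suc k)) + norm (x (j + Suc k) - x (Suc k))"
      using norm_triangle_ineq[of "x (Suc (j + Suc k)) - x (j + Suc k)" "x (j + Suc k) - x (Suc k)"] by simp
    also have "\<dots> \<le> (1/3) ^ (j + Suc k) + (1/3) ^ k / 2 * (1 - (1/3) ^ j)"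
      by (intro add_mono x Suc)
    also have "\<dots> = (1/3) ^ k / 2 * (1 - (1/3) ^ Suc j)"
      by (simp add: power_add field_simps)
    finally show ?case .
  qed simp
  have dist: "norm (z - x (Suc k)) \<le> (1/3) ^ k / 2" for k
  proof (rule LIMSEQ_le_const2)
    show "(\<lambda>j. norm (x (j + Suc k) - x (Suc k))) \<longlonglongrightarrow> norm (z - x (Suc k))"
      by (intro tendsto_intros LIMSEQ_ignore_initial_segment z)
    have "norm (x (j + Suc k) - x (Suc k)) \<le> (1/3) ^ k / 2" for j
    proof -
      have "(1/3) ^ k / 2 * (1 - (1/3) ^ j) \<le> (1/3 :: real) ^ k / 2 * 1"
        by (intro mult_left_mono) auto
      with tail[of j k] show ?thesis by linarith
    qed
    then show "\<exists>N. \<forall>j\<ge>N. norm (x (j + Suc k) - x (Suc k)) \<le> (1/3) ^ k / 2" by blast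
  qed
  have large: "norm (A (m k) z) \<ge> (4/3) ^ k / 6" for k
  proof -
    interpret bounded_linear "A (m k)" by (rule lin)
    have "norm (A (m k) (z - x (Suc k))) \<le> onorm (A (m k)) * norm (z - x (Suc k))"
      by (rule onorm[OF lin])
    also have "\<dots> \<le> onorm (A (m k)) * ((1/3) ^ k / 2)"
      by (intro mult_left_mono dist onorm_pos_le[OF lin])
    finally have "norm (A (m k) z) \<ge> 2 / 3 * onorm (A (m k)) * (1/3) ^ k - onorm (A (m k)) * ((1/3) ^ k / 2)"
      using x(2)[of k] norm_triangle_ineq2[of "A (m k) (x (Suc k))" "A (m k) z"]
      by (simp add: diff norm_minus_commute)
    also have "2 / 3 * onorm (A (m k)) * (1/3) ^ k - onorm (A (m k)) * ((1/3) ^ k / 2) = onorm (A (m k)) * ((1/3) ^ k / 6)"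
      by (simp add: algebra_simps)
    finally have "onorm (A (m k)) * ((1/3) ^ k / 6) \<le> norm (A (m k) z)" .
    moreover have "4 ^ k * ((1/3) ^ k / 6) \<le> onorm (A (m k)) * ((1/3) ^ k / 6)"
      using m[of k] by (intro mult_right_mono) auto
    moreover have "4 ^ k * ((1/3) ^ k / 6) = (4/3 :: real) ^ k / 6"
      by (simp add: power_divide)
    ultimately show ?thesis by linarith
  qed
  obtain B where B: "\<And>n. norm (A n z) \<le> B"
    using bdd[of z] by (auto simp: bounded_iff)
  obtain k where "6 * B < (4/3) ^ k"
    using real_arch_pow[of "4/3" "6 * B"] by auto
  then show False using large[of k] B[of "m k"] by linarith
qed

section \<open>Local boundedness, strong continuity and derivatives of orbits\<close>

locale c0_semigroup =
  fixes T :: "real \<Rightarrow> 'b::banach \<Rightarrow> 'b"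
  assumes bounded_linear: "t \<ge> 0 \<Longrightarrow> bounded_linear (T t)"
    and zero: "T 0 x = x"
    and add: "s \<ge> 0 \<Longrightarrow> t \<ge> 0 \<Longrightarrow> T (s + t) x = T s (T t x)"
    and right_continuous: "((\<lambda>t. T t x) \<longlongrightarrow> x) (at_right 0)"
begin

definition generates :: "'b \<Rightarrow> 'b \<Rightarrow> bool" where
  "generates x y \<longleftrightarrow> ((\<lambda>h. (1 / h) *\<^sub>R (T h x - x)) \<longlongrightarrow> y) (at_right 0)"

lemma diff: "t \<ge> 0 \<Longrightarrow> T t (x - y) = T t x - T t y"
  by (rule linear_diff[OF bounded_linear.linear[OF bounded_linear]])

lemma scaleR: "t \<ge> 0 \<Longrightarrow> T t (c *\<^sub>R x) = c *\<^sub>R T t x"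
  by (rule linear_scale[OF bounded_linear.linear[OF bounded_linear]])

text \<open>A failure produces times tending to 0 at which no common operator bound holds. Along
  these times every orbit converges by strong continuity at 0 and is therefore bounded, which
  contradicts the uniform boundedness principle.\<close>

lemma bounded_near_0: "\<exists>\<delta>>0. \<exists>M\<ge>1. \<forall>t\<in>{0..\<delta>}. \<forall>x. norm (T t x) \<le> M * norm x"
proof (rule ccontr)
  assume neg: "\<not> ?thesis"
  have "\<exists>t x. t \<in> {0..inverse (real (Suc n))} \<and> norm (T t x) > real (Suc n) * norm x" for n
  proof -
    have "inverse (real (Suc n)) > 0" "real (Suc n) \<ge> 1" by auto
    then show ?thesis using neg by (meson not_less)
  qed
  then obtain t x where t: "\<And>n. t n \<in> {0..inverse (real (Suc n))}"
    and x: "\<And>n. norm (T (t n) (x n)) > real (Suc n) * norm (x n)" by metis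
  have t0: "t \<longlonglongrightarrow> 0"
    by (rule real_tendsto_sandwich[OF _ _ tendsto_const LIMSEQ_inverse_real_of_nat]) (use t in auto)
  have "\<exists>K. \<forall>n y. norm (T (t n) y) \<le> K * norm y"
  proof (rule banach_steinhaus_sequence)
    show "bounded_linear (T (t n))" for n using t by (intro bounded_linear) auto
    fix y
    have "continuous (at 0 within {0..}) (\<lambda>s. T s y)"
      using right_continuous[of y] by (simp add: continuous_within zero at_within_Ici_at_right)
    then have "(\<lambda>n. T (t n) y) \<longlonglongrightarrow> T 0 y"
      by (rule continuous_within_tendsto_compose) (use t t0 in auto)
    then show "bounded (range (\<lambda>n. T (t n) y))"
      by (rule convergent_imp_bounded)
  qed
  then obtain K where K: "\<And>n y. norm (T (t n) y) \<le> K * norm y" by auto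
  obtain n where "K \<le> real n" using real_arch_simple by blast
  then have "K * norm (x n) \<le> real (Suc n) * norm (x n)" by (intro mult_right_mono) auto
  then show False using x[of n] K[of n "x n"] by linarith
qed

lemma locally_bounded: "\<exists>K\<ge>0. \<forall>s\<in>{0..t}. \<forall>x. norm (T s x) \<le> K * norm x"
proof -
  obtain \<delta> M where \<delta>: "\<delta> > 0" and M: "M \<ge> 1" and bd: "\<And>t x. t \<in> {0..\<delta>} \<Longrightarrow> norm (T t x) \<le> M * norm x"
    using bounded_near_0 by blast
  obtain N where N: "t < real N * \<delta>" using \<delta> reals_Archimedean3 by blast
  have pow: "norm (T (real n * h) x) \<le> M ^ n * norm x" if h: "h \<in> {0..\<delta>}" for n h x
  proof (induction n)
    case (Suc n)
    have "T (real (Suc n) * h) x = T h (T (real n * h) x)"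
      using h add[of h "real n * h" x] by (simp add: distrib_right)
    then have "norm (T (real (Suc n) * h) x) \<le> M * norm (T (real n * h) x)" using bd[OF h] by simp
    also have "\<dots> \<le> M * (M ^ n * norm x)" using Suc M by (intro mult_left_mono) auto
    finally show ?case by simp
  qed (simp add: zero)
  \<comment> \<open>Each \<open>s\<close> is cut into the same number \<open>N\<close> of equal
    steps, of length at most \<open>\<delta>\<close>, so that one power of \<open>M\<close> serves
    for all \<open>s\<close>.\<close>
  have "norm (T s x) \<le> M ^ N * norm x" if s: "s \<in> {0..t}" for s x
  proof -
    have "N > 0" using s N by (cases N) auto
    then have "s / real N \<in> {0..\<delta>}" using s N \<delta> by (auto simp: field_simps)
    from pow[OF this, of N x] show ?thesis using \<open>N > 0\<close> by simp
  qed
  then show ?thesis using M by (intro exI[of _ "M ^ N"]) auto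
qed

lemma T_right_zero: "((\<lambda>s. T \<bar>s - a\<bar> x) \<longlongrightarrow> x) (at a within S)"
proof -
  have "((\<lambda>s. \<bar>s - a\<bar>) \<longlongrightarrow> \<bar>a - a\<bar>) (at a within S)"
    by (intro tendsto_intros)
  then have "filterlim (\<lambda>s. \<bar>s - a\<bar>) (at_right 0) (at a within S)"
    by (auto simp: filterlim_at eventually_at_filter)
  from filterlim_compose[OF right_continuous this] show ?thesis .
qed

text \<open>The operator at the smaller of the two times factors out and is uniformly bounded.
  Continuity on both sides of \<open>a\<close> is thus reduced to right continuity at 0.\<close>

lemma diff_bound:
  assumes K: "\<And>s x. s \<in> {0..t} \<Longrightarrow> norm (T s x) \<le> K * norm x" and s: "s \<in> {0..t}" "a \<in> {0..t}"
  shows "norm (T s x - T a x) \<le> K * norm (T \<bar>s - a\<bar> x - x)"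
proof -
  have *: "norm (T p x - T q x) \<le> K * norm (T (p - q) x - x)" if "q \<le> p" "0 \<le> q" "p \<le> t" for p q
  proof -
    have "T p x - T q x = T q (T (p - q) x - x)"
      using that add[of q "p - q" x] by (simp add: diff)
    then show ?thesis using K[of q] that by simp
  qed
  show ?thesis
    using *[of s a] *[of a s] s by (cases "s \<le> a") (auto simp: norm_minus_commute)
qed

lemma continuous: "a \<ge> 0 \<Longrightarrow> ((\<lambda>s. T s x) \<longlongrightarrow> T a x) (at a within {0..})"
proof -
  assume a: "a \<ge> 0"
  obtain K where K: "\<And>s x. s \<in> {0..a+1} \<Longrightarrow> norm (T s x) \<le> K * norm x"
    using locally_bounded[of "a + 1"] by blast
  have "((\<lambda>s. K * norm (T \<bar>s - a\<bar> x - x)) \<longlongrightarrow> K * norm (x - x)) (at a within {0..})"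
    by (intro tendsto_intros T_right_zero)
  then have lim: "((\<lambda>s. K * norm (T \<bar>s - a\<bar> x - x)) \<longlongrightarrow> 0) (at a within {0..})" by simp
  have ev: "\<forall>\<^sub>F s in at a within {0..}. s \<in> {0..a + 1}"
    unfolding eventually_at by (intro exI[of _ 1]) (auto simp: dist_real_def)
  have "\<forall>\<^sub>F s in at a within {0..}. norm (T s x - T a x) \<le> K * norm (T \<bar>s - a\<bar> x - x)"
    using ev by eventually_elim (rule diff_bound[OF K], use a in auto)
  from Lim_null_comparison[OF this lim] show ?thesis by (rule LIM_zero_cancel)
qed

text \<open>\<open>T s\<close> is bounded and commutes with \<open>T h\<close>, hence it can be
  moved through the difference quotient and its limit. This keeps orbits inside the domain.\<close>

lemma generates_T:
  assumes "generates x y" "s \<ge> 0"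
  shows "generates (T s x) (T s y)"
proof -
  have "((\<lambda>h. T s ((1 / h) *\<^sub>R (T h x - x))) \<longlongrightarrow> T s y) (at_right 0)"
    using assms by (auto simp: generates_def intro!: bounded_linear.tendsto[OF bounded_linear])
  moreover have "\<forall>\<^sub>F h in at_right 0. T s ((1 / h) *\<^sub>R (T h x - x)) = (1 / h) *\<^sub>R (T h (T s x) - T s x)"
    using eventually_at_right_less[of 0]
  proof eventually_elim
    fix h :: real assume "0 < h"
    then show "T s ((1 / h) *\<^sub>R (T h x - x)) = (1 / h) *\<^sub>R (T h (T s x) - T s x)"
      using assms add[of s h x] add[of h s x] by (simp add: scaleR diff add.commute)
  qed
  ultimately show ?thesis
    unfolding generates_def by (rule Lim_transform_eventually)
qed

text \<open>The two-sided derivative: to the left of \<open>a\<close>, the difference quotient is the image of a right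
  difference quotient at \<open>0\<close> under an operator from a locally bounded family.\<close>
lemma has_vector_derivative:
  assumes xy: "generates x y" and a: "a \<ge> 0"
  shows "((\<lambda>s. T s x) has_vector_derivative T a y) (at a within {0..})"
proof -
  define \<phi> where "\<phi> h = (1 / h) *\<^sub>R (T h x - x) - y" for h
  obtain K where K: "\<And>s x. s \<in> {0..a+1} \<Longrightarrow> norm (T s x) \<le> K * norm x"
    using locally_bounded[of "a + 1"] by blast
  have "((\<lambda>s. \<bar>s - a\<bar>) \<longlongrightarrow> \<bar>a - a\<bar>) (at a within {0..})"
    by (intro tendsto_intros)
  then have "filterlim (\<lambda>s. \<bar>s - a\<bar>) (at_right 0) (at a within {0..})"
    by (auto simp: filterlim_at eventually_at_filter)
  moreover have "(\<phi> \<longlongrightarrow> y - y) (at_right 0)"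
    using xy unfolding \<phi>_def generates_def by (intro tendsto_diff tendsto_const)
  ultimately have "((\<lambda>s. \<phi> \<bar>s - a\<bar>) \<longlongrightarrow> 0) (at a within {0..})"
    using filterlim_compose by fastforce
  then have "((\<lambda>s. K * norm (\<phi> \<bar>s - a\<bar>) + norm (T s y - T a y)) \<longlongrightarrow> K * norm (0 :: 'b) + norm (T a y - T a y)) (at a within {0..})"
    by (intro tendsto_intros continuous a)
  then have lim: "((\<lambda>s. K * norm (\<phi> \<bar>s - a\<bar>) + norm (T s y - T a y)) \<longlongrightarrow> 0) (at a within {0..})"
    by simp
  have bound: "norm ((T s x - T a x) - (s - a) *\<^sub>R T a y) / norm (s - a) \<le> K * norm (\<phi> \<bar>s - a\<bar>) + norm (T s y - T a y)"
    if s: "s \<in> {0..a + 1}" "s \<noteq> a" for s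
  proof (cases "s > a")
    case True
    define h where "h = s - a"
    have h: "h > 0" "s = a + h" using True by (auto simp: h_def)
    have "(T s x - T a x) - (s - a) *\<^sub>R T a y = h *\<^sub>R T a (\<phi> h)"
      using h a by (simp add: \<phi>_def scaleR diff add scaleR_diff_right)
    then have "norm ((T s x - T a x) - (s - a) *\<^sub>R T a y) / norm (s - a) = norm (T a (\<phi> h))"
      using h by simp
    also have "\<dots> \<le> K * norm (\<phi> h)" using K a by simp
    finally show ?thesis using h by (simp add: add_increasing2)
  next
    case False
    define h where "h = a - s"
    have h: "h > 0" "a = s + h" using False s by (auto simp: h_def)
    \<comment> \<open>To the left of \<open>a\<close> the factor taken out is \<open>T s\<close>,
      which produces \<open>T s y\<close> where the derivative should have \<open>T a y\<close>;
      strong continuity accounts for the difference.\<close>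
    have "(T s x - T a x) - (s - a) *\<^sub>R T a y = - (h *\<^sub>R (T s (\<phi> h) + (T s y - T a y)))"
      using h s by (simp add: \<phi>_def scaleR diff add scaleR_diff_right scaleR_add_right)
    then have "norm ((T s x - T a x) - (s - a) *\<^sub>R T a y) / norm (s - a) = norm (T s (\<phi> h) + (T s y - T a y))"
      using h by simp
    also have "\<dots> \<le> norm (T s (\<phi> h)) + norm (T s y - T a y)" by (rule norm_triangle_ineq)
    also have "\<dots> \<le> K * norm (\<phi> h) + norm (T s y - T a y)" using K s by simp
    finally show ?thesis using h by simp
  qed
  have ev: "\<forall>\<^sub>F s in at a within {0..}. s \<in> {0..a + 1} \<and> s \<noteq> a"
    unfolding eventually_at by (intro exI[of _ 1]) (auto simp: dist_real_def)
  have "\<forall>\<^sub>F s in at a within {0..}. norm (norm ((T s x - T a x) - (s - a) *\<^sub>R T a y) / norm (s - a))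
      \<le> K * norm (\<phi> \<bar>s - a\<bar>) + norm (T s y - T a y)"
    using ev by eventually_elim (use bound in auto)
  from Lim_null_comparison[OF this lim] show ?thesis
    unfolding has_vector_derivative_def has_derivative_iff_norm
    by (simp add: bounded_linear_scaleR_left)
qed

end

section \<open>The energy space on the Fourier side\<close>

lemma fourier_add:
  assumes f: "f \<in> L2_space" and g: "g \<in> L2_space"
  shows "AE \<xi> in lborel. fourier (\<lambda>x. f x + g x) \<xi> = fourier f \<xi> + fourier g \<xi>"
proof -
  have "to_l2 (fourier (\<lambda>x. f x + g x)) = to_l2 (\<lambda>\<xi>. fourier f \<xi> + fourier g \<xi>)"
    using fourier_l2_add[of "to_l2 f" "to_l2 g"]
    by (simp add: fourier_l2_to_l2 f g L2_space_add fourier_spec flip: to_l2_add)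
  then show ?thesis by (simp add: to_l2_eq_iff f g L2_space_add fourier_spec)
qed

lemma fourier_diff:
  assumes f: "f \<in> L2_space" and g: "g \<in> L2_space"
  shows "AE \<xi> in lborel. fourier (\<lambda>x. f x - g x) \<xi> = fourier f \<xi> - fourier g \<xi>"
proof -
  have "to_l2 (fourier (\<lambda>x. f x - g x)) = to_l2 (\<lambda>\<xi>. fourier f \<xi> - fourier g \<xi>)"
    using fourier_l2_diff[of "to_l2 f" "to_l2 g"]
    by (simp add: fourier_l2_to_l2 f g L2_space_diff fourier_spec flip: to_l2_diff)
  then show ?thesis by (simp add: to_l2_eq_iff f g L2_space_diff fourier_spec)
qed

lemma truncate_cmult: "truncate R (\<lambda>x. c * f x) = (\<lambda>x. c * truncate R f x)"
  by (simp add: truncate_def fun_eq_iff)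

text \<open>The real Hilbert space \<open>l2\<close> only carries real scalars; the complex homogeneity is
  read off the defining limit.\<close>
lemma fourier_cmult:
  assumes f: "f \<in> L2_space"
  shows "AE \<xi> in lborel. fourier (\<lambda>x. c * f x) \<xi> = c * fourier f \<xi>"
proof -
  have cf: "(\<lambda>x. c * f x) \<in> L2_space" by (rule L2_space_cmult[OF f])
  have F: "fourier_L1 (truncate R (\<lambda>x. c * f x)) = (\<lambda>\<xi>. c * fourier_L1 (truncate R f) \<xi>)" for R
  proof
    fix \<xi>
    have "(\<lambda>x. exp (- \<i> * complex_of_real (x \<bullet> \<xi>)) * (c * truncate R f x))
        = (\<lambda>x. c * (exp (- \<i> * complex_of_real (x \<bullet> \<xi>)) * truncate R f x))"
      by (simp add: mult_ac)
    then show "fourier_L1 (truncate R (\<lambda>x. c * f x)) \<xi> = c * fourier_L1 (truncate R f) \<xi>"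
      unfolding fourier_L1_def truncate_cmult by (simp only: integral_mult_right_zero)
  qed
  have norm_le: "norm (to_l2 (\<lambda>x. c * g x) - to_l2 (\<lambda>x. c * h x)) = cmod c * norm (to_l2 g - to_l2 h)"
    if "g \<in> L2_space" "h \<in> L2_space" for g h :: "'a \<Rightarrow> complex"
  proof -
    have "norm (to_l2 (\<lambda>x. c * g x) - to_l2 (\<lambda>x. c * h x)) = norm (to_l2 (\<lambda>x. c * (g x - h x)))"
      using that by (simp add: L2_space_cmult right_diff_distrib flip: to_l2_diff)
    also have "\<dots> = cmod c * norm (to_l2 (\<lambda>x. g x - h x))"
      using that by (simp add: norm_to_l2 L2_space_cmult L2_space_diff L2_norm_def norm_mult
          power_mult_distrib real_sqrt_mult)
    finally show ?thesis using that by (simp add: to_l2_diff)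
  qed
  have "((\<lambda>R. cmod c * norm (to_l2 (fourier_L1 (truncate R f)) - to_l2 (fourier f))) \<longlongrightarrow> cmod c * norm (to_l2 (fourier f) - to_l2 (fourier f))) at_top"
    by (intro tendsto_intros fourier_spec f)
  then have "((\<lambda>R. norm (to_l2 (fourier_L1 (truncate R (\<lambda>x. c * f x))) - to_l2 (\<lambda>\<xi>. c * fourier f \<xi>))) \<longlongrightarrow> 0) at_top"
    unfolding F by (simp add: norm_le fourier_L1_truncate_L2 fourier_spec f)
  then have "((\<lambda>R. to_l2 (fourier_L1 (truncate R (\<lambda>x. c * f x)))) \<longlongrightarrow> to_l2 (\<lambda>\<xi>. c * fourier f \<xi>)) at_top"
    by (rule LIM_zero_cancel[OF tendsto_norm_zero_cancel])
  from tendsto_unique[OF _ this fourier_spec(2)[OF cf]]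
  have "to_l2 (fourier (\<lambda>x. c * f x)) = to_l2 (\<lambda>\<xi>. c * fourier f \<xi>)" by simp
  then show ?thesis by (simp add: to_l2_eq_iff L2_space_cmult fourier_spec f cf)
qed

lemma fourier_cong:
  assumes f: "f \<in> L2_space" and g: "g \<in> L2_space" and "AE x in lborel. f x = g x"
  shows "AE \<xi> in lborel. fourier f \<xi> = fourier g \<xi>"
proof -
  have "to_l2 f = to_l2 g" using assms by (simp add: to_l2_eq_iff)
  then have "to_l2 (fourier f) = to_l2 (fourier g)" by (metis fourier_l2_to_l2 f g)
  then show ?thesis by (simp add: to_l2_eq_iff f g fourier_spec)
qed

lemma fourier_measurable: "f \<in> L2_space \<Longrightarrow> fourier f \<in> borel_measurable borel"
  by (intro L2_space_measurable fourier_spec)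

section \<open>Sobolev spaces through weighted transforms\<close>

definition weight :: "real \<Rightarrow> 'a::euclidean_space \<Rightarrow> real" where
  "weight s \<xi> = (1 + (norm \<xi>)\<^sup>2) powr (s / 2)"

lemma one_plus_norm_sq_pos: "1 + (norm x)\<^sup>2 > 0"
  by (simp add: add_pos_nonneg)

lemma weight_measurable [measurable]: "weight s \<in> borel_measurable borel"
  unfolding weight_def[abs_def] by measurable

lemma weight_pos [simp]: "weight s \<xi> > 0" "weight s \<xi> \<ge> 0" "weight s \<xi> \<noteq> 0"
  using one_plus_norm_sq_pos[of \<xi>] by (auto simp: weight_def)

lemma weight_mono: "s \<le> t \<Longrightarrow> weight s \<xi> \<le> weight t \<xi>"
  unfolding weight_def by (rule powr_mono) auto

lemma weight_0: "weight 0 \<xi> = 1"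
  using one_plus_norm_sq_pos[of \<xi>] by (simp add: weight_def)

lemma weight_2: "weight 2 \<xi> = 1 + (norm \<xi>)\<^sup>2"
  using one_plus_norm_sq_pos[of \<xi>] by (simp add: weight_def)

lemma weight_power2: "(weight s \<xi>)\<^sup>2 = (1 + (norm \<xi>)\<^sup>2) powr s"
  using one_plus_norm_sq_pos[of \<xi>] by (simp add: weight_def flip: powr_add add: power2_eq_square)

text \<open>\<open>weight s\<close> has half the exponent of the Sobolev norm, so the L2 norm of
  this function is \<open>sobolev_norm s f\<close>.\<close>

definition weighted_fourier :: "real \<Rightarrow> ('a::euclidean_space \<Rightarrow> complex) \<Rightarrow> 'a \<Rightarrow> complex" where
  "weighted_fourier s f \<xi> = complex_of_real (weight s \<xi>) * fourier f \<xi>"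

lemma sobolev_space_iff: "f \<in> sobolev_space s \<longleftrightarrow> f \<in> L2_space \<and> weighted_fourier s f \<in> L2_space"
proof (cases "f \<in> L2_space")
  case True
  note [measurable] = fourier_measurable[OF True]
  have "weighted_fourier s f \<in> borel_measurable borel" unfolding weighted_fourier_def by measurable
  then show ?thesis
    using True by (simp add: sobolev_space_def L2_space_def weighted_fourier_def norm_mult power_mult_distrib weight_power2)
qed (simp add: sobolev_space_def)

lemma sobolev_space_L2: "f \<in> sobolev_space s \<Longrightarrow> f \<in> L2_space"
  by (simp add: sobolev_space_def)

lemma sobolev_norm_eq: "f \<in> sobolev_space s \<Longrightarrow> sobolev_norm s f = norm (to_l2 (weighted_fourier s f))"
  by (simp add: sobolev_space_iff norm_to_l2 L2_norm_def sobolev_norm_def weighted_fourier_def norm_mult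
      power_mult_distrib weight_power2)

lemma L2_space_cong_AE:
  "AE x in lborel. f x = g x \<Longrightarrow> g \<in> L2_space \<Longrightarrow> f \<in> borel_measurable borel \<Longrightarrow> f \<in> L2_space"
  by (rule L2_space_bound[of f g 1]) (auto elim!: eventually_mono)

lemma weighted_fourier_measurable: "f \<in> L2_space \<Longrightarrow> weighted_fourier s f \<in> borel_measurable borel"
  using fourier_measurable[of f] unfolding weighted_fourier_def[abs_def] by measurable

text \<open>Transforms are known almost everywhere only; membership and the class in
  \<open>l2\<close> can both be read off any square integrable function that agrees with the
  weighted transform outside a null set.\<close>

lemma sobolev_space_AE:
  assumes f: "f \<in> L2_space" and ae: "AE \<xi> in lborel. weighted_fourier s f \<xi> = g \<xi>" and g: "g \<in> L2_space"
  shows "f \<in> sobolev_space s" "to_l2 (weighted_fourier s f) = to_l2 g"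
  using L2_space_cong_AE[OF ae g weighted_fourier_measurable[OF f]] assms
  by (simp_all add: sobolev_space_iff to_l2_eq_iff)

lemma sobolev_space_add:
  assumes f: "f \<in> sobolev_space s" and g: "g \<in> sobolev_space s"
  shows "(\<lambda>x. f x + g x) \<in> sobolev_space s"
    and "to_l2 (weighted_fourier s (\<lambda>x. f x + g x)) = to_l2 (weighted_fourier s f) + to_l2 (weighted_fourier s g)"
proof -
  have f': "f \<in> L2_space" "weighted_fourier s f \<in> L2_space" and g': "g \<in> L2_space" "weighted_fourier s g \<in> L2_space"
    using f g by (simp_all add: sobolev_space_iff)
  have "AE \<xi> in lborel. weighted_fourier s (\<lambda>x. f x + g x) \<xi> = weighted_fourier s f \<xi> + weighted_fourier s g \<xi>"
    using fourier_add[OF f'(1) g'(1)] by eventually_elim (simp add: weighted_fourier_def distrib_left)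
  note * = sobolev_space_AE[OF L2_space_add[OF f'(1) g'(1)] this L2_space_add[OF f'(2) g'(2)]]
  show "(\<lambda>x. f x + g x) \<in> sobolev_space s"
    "to_l2 (weighted_fourier s (\<lambda>x. f x + g x)) = to_l2 (weighted_fourier s f) + to_l2 (weighted_fourier s g)"
    using * f' g' by (simp_all add: to_l2_add)
qed

lemma sobolev_space_cmult:
  assumes f: "f \<in> sobolev_space s"
  shows "(\<lambda>x. c * f x) \<in> sobolev_space s"
    and "to_l2 (weighted_fourier s (\<lambda>x. complex_of_real a * f x)) = a *\<^sub>R to_l2 (weighted_fourier s f)"
proof -
  have f': "f \<in> L2_space" "weighted_fourier s f \<in> L2_space"
    using f by (simp_all add: sobolev_space_iff)
  have ae: "AE \<xi> in lborel. weighted_fourier s (\<lambda>x. c * f x) \<xi> = c * weighted_fourier s f \<xi>" for c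
    using fourier_cmult[OF f'(1), of c] by eventually_elim (simp add: weighted_fourier_def)
  show "(\<lambda>x. c * f x) \<in> sobolev_space s"
    by (rule sobolev_space_AE[OF L2_space_cmult[OF f'(1)] ae L2_space_cmult[OF f'(2)]])
  show "to_l2 (weighted_fourier s (\<lambda>x. complex_of_real a * f x)) = a *\<^sub>R to_l2 (weighted_fourier s f)"
    using sobolev_space_AE(2)[OF L2_space_cmult[OF f'(1)] ae L2_space_cmult[OF f'(2)]] f'
    by (simp add: scaleR_conv_of_real flip: to_l2_scaleR)
qed

lemma sobolev_space_diff:
  assumes f: "f \<in> sobolev_space s" and g: "g \<in> sobolev_space s"
  shows "(\<lambda>x. f x - g x) \<in> sobolev_space s"
    and "to_l2 (weighted_fourier s (\<lambda>x. f x - g x)) = to_l2 (weighted_fourier s f) - to_l2 (weighted_fourier s g)"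
  using sobolev_space_add[OF f sobolev_space_cmult(1)[OF g, of "-1"]] sobolev_space_cmult(2)[OF g, of "-1"]
  by simp_all

lemma sobolev_space_mono:
  assumes f: "f \<in> sobolev_space t" and st: "s \<le> t"
  shows "f \<in> sobolev_space s"
proof -
  have f': "f \<in> L2_space" "weighted_fourier t f \<in> L2_space"
    using f by (simp_all add: sobolev_space_iff)
  have "weighted_fourier s f \<in> L2_space"
    by (rule L2_space_bound[OF weighted_fourier_measurable[OF f'(1)] f'(2), of _ 1])
      (auto simp: weighted_fourier_def norm_mult intro!: mult_right_mono weight_mono st)
  then show ?thesis using f' by (simp add: sobolev_space_iff)
qed

lemma sobolev_space_inv_fourier:
  assumes g: "g \<in> L2_space" and s: "s \<ge> 0"
  defines "f \<equiv> inv_fourier (\<lambda>\<xi>. complex_of_real (inverse (weight s \<xi>)) * g \<xi>)"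
  shows "f \<in> sobolev_space s" "to_l2 (weighted_fourier s f) = to_l2 g"
proof -
  note [measurable] = L2_space_measurable[OF g]
  have "weight s \<xi> \<ge> 1" for \<xi> :: 'a using weight_mono[OF s, of \<xi>] by (simp add: weight_0)
  then have "inverse (weight s \<xi>) \<le> 1" for \<xi> :: 'a by (simp add: inverse_le_1_iff)
  then have "cmod (complex_of_real (inverse (weight s \<xi>)) * g \<xi>) \<le> 1 * cmod (g \<xi>)" for \<xi>
    unfolding norm_mult by (intro mult_right_mono) (simp_all add: norm_inverse)
  then have "(\<lambda>\<xi>. complex_of_real (inverse (weight s \<xi>)) * g \<xi>) \<in> L2_space"
    by (intro L2_space_bound[OF _ g, of _ 1]) auto
  note * = inv_fourier[OF this, folded f_def]
  have "AE \<xi> in lborel. weighted_fourier s f \<xi> = g \<xi>"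
    using *(2) by eventually_elim (simp add: weighted_fourier_def)
  from sobolev_space_AE[OF *(1) this g]
  show "f \<in> sobolev_space s" "to_l2 (weighted_fourier s f) = to_l2 g" by simp_all
qed

text \<open>The first component passes to the frequency side, where its H1 norm is an L2 norm; the
  second stays in physical space, since its norm is already that of L2. The product norm is then the
  energy norm. This asymmetry is why \<open>fourier_l2\<close> is applied only to second components
  below.\<close>

definition encode :: "'a::euclidean_space state \<Rightarrow> 'a l2 \<times> 'a l2" where
  "encode U = (to_l2 (weighted_fourier 1 (fst U)), to_l2 (snd U))"

lemma energy_spaceD:
  "U \<in> energy_space \<Longrightarrow> fst U \<in> sobolev_space 1" "U \<in> energy_space \<Longrightarrow> snd U \<in> L2_space"
  by (auto simp: energy_space_def)

lemma norm_encode: "U \<in> energy_space \<Longrightarrow> norm (encode U) = energy_norm U"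
  by (auto simp: encode_def energy_norm_def norm_prod_def energy_space_def sobolev_norm_eq norm_to_l2)

lemma encode_add:
  assumes "U \<in> energy_space" "V \<in> energy_space"
  shows "state_add U V \<in> energy_space" "encode (state_add U V) = encode U + encode V"
  using assms
  by (auto simp: energy_space_def encode_def state_add_def sobolev_space_add L2_space_add to_l2_add)

lemma encode_scale:
  assumes "U \<in> energy_space"
  shows "state_scale c U \<in> energy_space" "encode (state_scale (complex_of_real a) U) = a *\<^sub>R encode U"
proof -
  note U = energy_spaceD[OF assms]
  show "state_scale c U \<in> energy_space"
    using U by (simp add: energy_space_def state_scale_def sobolev_space_cmult L2_space_cmult)
  have "to_l2 (\<lambda>x. complex_of_real a * snd U x) = a *\<^sub>R to_l2 (snd U)"
    using to_l2_scaleR[OF U(2), of a] by (simp add: scaleR_conv_of_real)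
  then show "encode (state_scale (complex_of_real a) U) = a *\<^sub>R encode U"
    using sobolev_space_cmult(2)[OF U(1), of a] by (simp add: encode_def state_scale_def)
qed

lemma encode_diff:
  assumes "U \<in> energy_space" "V \<in> energy_space"
  shows "state_diff U V \<in> energy_space" "encode (state_diff U V) = encode U - encode V"
  using assms
  by (auto simp: energy_space_def encode_def state_diff_def sobolev_space_diff L2_space_diff to_l2_diff)

lemma encode_eq_iff:
  assumes U: "U \<in> energy_space" and V: "V \<in> energy_space"
  shows "encode U = encode V \<longleftrightarrow> state_eq U V"
proof -
  have fU: "fst U \<in> L2_space" "weighted_fourier 1 (fst U) \<in> L2_space"
    and fV: "fst V \<in> L2_space" "weighted_fourier 1 (fst V) \<in> L2_space"
    using energy_spaceD(1)[OF U] energy_spaceD(1)[OF V] by (simp_all add: sobolev_space_iff)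
  have "to_l2 (weighted_fourier 1 (fst U)) = to_l2 (weighted_fourier 1 (fst V)) \<longleftrightarrow>
      (AE \<xi> in lborel. fourier (fst U) \<xi> = fourier (fst V) \<xi>)"
    by (simp add: to_l2_eq_iff fU fV weighted_fourier_def)
  also have "\<dots> \<longleftrightarrow> fourier_l2 (to_l2 (fst U)) = fourier_l2 (to_l2 (fst V))"
    by (simp add: fourier_l2_to_l2 fU fV fourier_spec to_l2_eq_iff)
  also have "\<dots> \<longleftrightarrow> (AE x in lborel. fst U x = fst V x)"
    by (simp add: fourier_l2_inj to_l2_eq_iff fU fV)
  finally show ?thesis
    using U V by (simp add: encode_def state_eq_def to_l2_eq_iff energy_spaceD)
qed

lemma encode_surj: "\<exists>U\<in>energy_space. encode U = y"
proof -
  define p q where "p = fst y" and "q = snd y"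
  then have y: "y = (p, q)" by simp
  obtain g where g: "g \<in> L2_space" "p = to_l2 g" using l2_cases[of p] by metis
  note s = sobolev_space_inv_fourier[OF g(1), of 1]
  show ?thesis
    by (rule bexI[of _ "(inv_fourier (\<lambda>\<xi>. complex_of_real (inverse (weight 1 \<xi>)) * g \<xi>), rep_l2 q)"])
      (use s g in \<open>auto simp: encode_def energy_space_def y\<close>)
qed

text \<open>Transport of structure: representatives are chosen by \<open>decode\<close>, and all
  laws stated modulo null sets become equations in \<open>l2 \<times> l2\<close>. The point to be
  settled is that the choice of representatives does not matter.\<close>

lemma semigroup_encode:
  fixes T :: "real \<Rightarrow> 'a::euclidean_space state \<Rightarrow> 'a state"
  assumes sg: "C0_semigroup energy_space energy_norm T"
    and gen: "generated_by energy_space energy_norm T D A"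
  obtains \<tau> where "c0_semigroup \<tau>"
    and "\<And>t U. t \<ge> 0 \<Longrightarrow> U \<in> energy_space \<Longrightarrow> T t U \<in> energy_space"
    and "\<And>t U. t \<ge> 0 \<Longrightarrow> U \<in> energy_space \<Longrightarrow> encode (T t U) = \<tau> t (encode U)"
    and "\<And>U W. U \<in> energy_space \<Longrightarrow> W \<in> energy_space \<Longrightarrow>
      c0_semigroup.generates \<tau> (encode U) (encode W) \<longleftrightarrow> U \<in> D \<and> state_eq W (A U)"
proof -
  have T: "T t U \<in> energy_space" if "t \<ge> 0" "U \<in> energy_space" for t U
    using sg that by (auto simp: C0_semigroup_def)
  have T_add: "encode (T t (state_add U V)) = encode (T t U) + encode (T t V)"
    if "t \<ge> 0" "U \<in> energy_space" "V \<in> energy_space" for t U V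
  proof -
    have "state_eq (T t (state_add U V)) (state_add (T t U) (T t V))"
      using sg that by (auto simp: C0_semigroup_def)
    then show ?thesis using that by (simp add: T encode_add flip: encode_eq_iff)
  qed
  have T_scale: "encode (T t (state_scale (complex_of_real a) U)) = a *\<^sub>R encode (T t U)"
    if "t \<ge> 0" "U \<in> energy_space" for t U a
  proof -
    have "state_eq (T t (state_scale (complex_of_real a) U)) (state_scale (complex_of_real a) (T t U))"
      using sg that by (auto simp: C0_semigroup_def)
    then show ?thesis using that by (simp add: T encode_scale flip: encode_eq_iff)
  qed
  have T_bound: "\<exists>M. \<forall>U\<in>energy_space. norm (encode (T t U)) \<le> M * norm (encode U)" if t: "t \<ge> 0" for t
  proof -
    have "\<forall>t\<ge>0. \<exists>M. \<forall>U\<in>energy_space. energy_norm (T t U) \<le> M * energy_norm U"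
      using sg by (simp add: C0_semigroup_def)
    then obtain M where "\<forall>U\<in>energy_space. energy_norm (T t U) \<le> M * energy_norm U"
      using t by blast
    then show ?thesis using T[OF t] by (auto simp: norm_encode)
  qed
  define decode :: "'a l2 \<times> 'a l2 \<Rightarrow> 'a state" where
    "decode y = (SOME U. U \<in> energy_space \<and> encode U = y)" for y
  have decode: "decode y \<in> energy_space" "encode (decode y) = y" for y
    using someI_ex[of "\<lambda>U. U \<in> energy_space \<and> encode U = y"] encode_surj[of y]
    unfolding decode_def by blast+
  define \<tau> where "\<tau> t y = encode (T t (decode y))" for t y
  have tau: "encode (T t U) = \<tau> t (encode U)" if "t \<ge> 0" "U \<in> energy_space" for t U
  proof -
    define V where "V = decode (encode U)"
    have V: "V \<in> energy_space" "encode V = encode U" by (simp_all add: V_def decode)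
    \<comment> \<open>This holds as an equality of functions, so additivity applies to it directly.
      The difference has energy norm 0, and the bound on \<open>T t\<close> forces its image to have
      norm 0 as well.\<close>
    have "state_add (state_diff U V) V = U" by (simp add: state_add_def state_diff_def)
    then have "encode (T t U) = encode (T t (state_diff U V)) + encode (T t V)"
      using T_add[of t "state_diff U V" V] that V by (simp add: encode_diff)
    moreover have "encode (T t (state_diff U V)) = 0"
      using T_bound[OF \<open>t \<ge> 0\<close>] encode_diff[OF that(2) V(1)] V(2) by auto
    ultimately show ?thesis by (simp add: \<tau>_def V_def)
  qed
  have sem: "c0_semigroup \<tau>"
  proof (rule c0_semigroup.intro)
    fix s t :: real and x :: "'a l2 \<times> 'a l2"
    show "bounded_linear (\<tau> t)" if t: "t \<ge> 0"
    proof -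
      obtain M where M: "\<And>U. U \<in> energy_space \<Longrightarrow> norm (encode (T t U)) \<le> M * norm (encode U)"
        using T_bound[OF t] by blast
      show ?thesis
      proof (rule bounded_linear_intro)
        fix x y :: "'a l2 \<times> 'a l2" and c :: real
        show "\<tau> t (x + y) = \<tau> t x + \<tau> t y"
          using T_add[OF t decode(1) decode(1), of x y] tau[OF t encode_add(1)[OF decode(1) decode(1)], of x y]
          by (simp add: encode_add decode \<tau>_def)
        show "\<tau> t (c *\<^sub>R x) = c *\<^sub>R \<tau> t x"
          using T_scale[OF t decode(1), of c x] tau[OF t encode_scale(1)[OF decode(1)], of "complex_of_real c" x]
          by (simp add: encode_scale decode \<tau>_def)
        show "norm (\<tau> t x) \<le> norm x * M"
          using M[OF decode(1), of x] by (simp add: decode \<tau>_def mult.commute)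
      qed
    qed
    show "\<tau> 0 x = x"
    proof -
      have "state_eq (T 0 (decode x)) (decode x)"
        using sg decode(1) by (auto simp: C0_semigroup_def)
      then have "encode (T 0 (decode x)) = encode (decode x)"
        using T[of 0] decode(1) by (simp add: encode_eq_iff)
      then show ?thesis by (simp add: \<tau>_def decode)
    qed
    show "\<tau> (s + t) x = \<tau> s (\<tau> t x)" if "s \<ge> 0" "t \<ge> 0"
    proof -
      have "state_eq (T (s + t) (decode x)) (T s (T t (decode x)))"
        using sg decode(1) that by (auto simp: C0_semigroup_def)
      then have "encode (T (s + t) (decode x)) = encode (T s (T t (decode x)))"
        using T decode(1) that by (simp add: encode_eq_iff)
      also have "\<dots> = \<tau> s (encode (T t (decode x)))"
        by (rule tau[OF that(1) T[OF that(2) decode(1)]])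
      finally show ?thesis by (simp only: \<tau>_def[of "s + t"] \<tau>_def[of t])
    qed
    have "((\<lambda>t. energy_norm (state_diff (T t (decode x)) (decode x))) \<longlongrightarrow> 0) (at_right 0)"
      using sg decode(1) by (auto simp: C0_semigroup_def)
    moreover have "\<forall>\<^sub>F t in at_right 0. energy_norm (state_diff (T t (decode x)) (decode x)) = norm (\<tau> t x - x)"
      using eventually_at_right_less[of 0]
      by eventually_elim (simp add: T decode encode_diff \<tau>_def flip: norm_encode)
    ultimately have "((\<lambda>t. norm (\<tau> t x - x)) \<longlongrightarrow> 0) (at_right 0)"
      by (rule Lim_transform_eventually)
    then show "((\<lambda>t. \<tau> t x) \<longlongrightarrow> x) (at_right 0)"
      by (rule LIM_zero_cancel[OF tendsto_norm_zero_cancel])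
  qed
  interpret c0_semigroup \<tau> by (rule sem)
  show thesis
  proof (rule that[OF sem T tau])
    fix U W :: "'a state" assume UW: "U \<in> energy_space" "W \<in> energy_space"
    let ?q = "\<lambda>h. state_diff (state_scale (complex_of_real (1 / h)) (state_diff (T h U) U)) W"
    have "\<forall>\<^sub>F h in at_right 0. energy_norm (?q h) = norm ((1 / h) *\<^sub>R (\<tau> h (encode U) - encode U) - encode W)"
      using eventually_at_right_less[of 0]
      by eventually_elim (simp add: T UW encode_diff encode_scale tau del: of_real_divide flip: norm_encode)
    then have "((\<lambda>h. energy_norm (?q h)) \<longlongrightarrow> 0) (at_right 0)
        \<longleftrightarrow> ((\<lambda>h. norm ((1 / h) *\<^sub>R (\<tau> h (encode U) - encode U) - encode W)) \<longlongrightarrow> 0) (at_right 0)"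
      by (rule filterlim_cong[OF refl refl])
    also have "\<dots> \<longleftrightarrow> generates (encode U) (encode W)"
      unfolding generates_def by (simp only: tendsto_norm_zero_iff LIM_zero_iff)
    finally show "generates (encode U) (encode W) \<longleftrightarrow> U \<in> D \<and> state_eq W (A U)"
      using gen UW unfolding generated_by_def by blast
  qed
qed

section \<open>The generator in terms of Fourier multipliers\<close>

lemma fourier_multiplier:
  assumes "(\<lambda>\<xi>. complex_of_real (m \<xi>) * fourier f \<xi>) \<in> L2_space"
  shows "fourier_multiplier m f \<in> L2_space"
    "AE \<xi> in lborel. fourier (fourier_multiplier m f) \<xi> = complex_of_real (m \<xi>) * fourier f \<xi>"
  using inv_fourier[OF assms] by (simp_all add: fourier_multiplier_def)

text \<open>The difference \<open>r - ln (1 + r\<^sup>2)\<close> vanishes at 0 and has derivative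
  \<open>(1 - r)\<^sup>2 / (1 + r\<^sup>2)\<close>. The bound keeps \<open>freq\<close> real and
  comparable to \<open>r\<close>, and lets H1 control the logarithmic symbol.\<close>

lemma ln_one_plus_square_le:
  assumes "r \<ge> (0::real)"
  shows "ln (1 + r\<^sup>2) \<le> r"
proof -
  have "0 - ln (1 + 0\<^sup>2) \<le> r - ln (1 + r\<^sup>2)"
  proof (rule DERIV_nonneg_imp_nondecreasing[OF assms])
    fix x :: real
    have pos: "1 + x\<^sup>2 > 0" by (simp add: add_pos_nonneg)
    have "((\<lambda>r. r - ln (1 + r\<^sup>2)) has_real_derivative 1 - 2 * x / (1 + x\<^sup>2)) (at x)"
      using pos by (auto intro!: derivative_eq_intros simp: field_simps)
    moreover have "2 * x / (1 + x\<^sup>2) \<le> 1"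
      using sum_squares_bound[of 1 x] pos by simp
    ultimately show "\<exists>y. ((\<lambda>r. r - ln (1 + r\<^sup>2)) has_real_derivative y) (at x) \<and> y \<ge> 0"
      by (intro exI[of _ "1 - 2 * x / (1 + x\<^sup>2)"]) simp
  qed
  then show ?thesis by simp
qed

lemma norm_le_weight: "norm \<xi> \<le> weight 1 \<xi>"
  by (rule power2_le_imp_le) (simp_all add: weight_power2 one_plus_norm_sq_pos abs_of_pos)

lemma wave_domain_energy_space: "U \<in> wave_domain \<Longrightarrow> U \<in> energy_space"
  by (auto simp: wave_domain_def energy_space_def intro: sobolev_space_mono sobolev_space_L2)

text \<open>A multiplier is defined by a choice and has the expected transform once the product with
  its symbol is square integrable. The symbol of the Laplacian is dominated by
  \<open>weight 2\<close> and the logarithm by \<open>weight 1\<close>, which is what the two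
  factors of \<open>wave_domain\<close> provide.\<close>

lemma wave_op_fourier:
  assumes U: "U \<in> wave_domain"
  shows "wave_op U \<in> energy_space"
    and "AE \<xi> in lborel. fourier (snd (wave_op U)) \<xi> =
      - complex_of_real ((norm \<xi>)\<^sup>2) * fourier (fst U) \<xi> - complex_of_real (ln (1 + (norm \<xi>)\<^sup>2)) * fourier (snd U) \<xi>"
proof -
  have u: "fst U \<in> L2_space" "weighted_fourier 2 (fst U) \<in> L2_space"
    and v: "snd U \<in> L2_space" "weighted_fourier 1 (snd U) \<in> L2_space"
    using U by (auto simp: wave_domain_def sobolev_space_iff)
  note [measurable] = fourier_measurable[OF u(1)] fourier_measurable[OF v(1)]
  have "(\<lambda>\<xi>. complex_of_real (- (norm \<xi>)\<^sup>2) * fourier (fst U) \<xi>) \<in> L2_space"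
    by (rule L2_space_bound[OF _ u(2), of _ 1])
      (auto simp: weighted_fourier_def norm_mult weight_2 abs_of_pos[OF one_plus_norm_sq_pos]
        simp del: of_real_power of_real_add of_real_minus intro!: mult_right_mono)
  note lap = fourier_multiplier[OF this, folded laplacian_def]
  have "ln (1 + (norm \<xi>)\<^sup>2) \<le> weight 1 \<xi>" for \<xi> :: 'a
    using ln_one_plus_square_le[of "norm \<xi>"] norm_le_weight[of \<xi>] by simp
  then have "cmod (complex_of_real (ln (1 + (norm \<xi>)\<^sup>2)) * fourier (snd U) \<xi>) \<le> 1 * cmod (weighted_fourier 1 (snd U) \<xi>)" for \<xi>
    by (auto simp: weighted_fourier_def norm_mult intro!: mult_right_mono)
  then have "(\<lambda>\<xi>. complex_of_real (ln (1 + (norm \<xi>)\<^sup>2)) * fourier (snd U) \<xi>) \<in> L2_space"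
    by (intro L2_space_bound[OF _ v(2), of _ 1]) auto
  note log = fourier_multiplier[OF this, folded log_op_def]
  show "wave_op U \<in> energy_space"
    using U lap(1) log(1) by (auto simp: wave_op_def energy_space_def wave_domain_def laplacian_def log_op_def intro!: L2_space_diff)
  show "AE \<xi> in lborel. fourier (snd (wave_op U)) \<xi> =
      - complex_of_real ((norm \<xi>)\<^sup>2) * fourier (fst U) \<xi> - complex_of_real (ln (1 + (norm \<xi>)\<^sup>2)) * fourier (snd U) \<xi>"
    using fourier_diff[OF lap(1) log(1)] lap(2) log(2)
    by eventually_elim (simp add: wave_op_def laplacian_def log_op_def)
qed

section \<open>Multiplication operators\<close>

definition bounded_mult :: "('a::euclidean_space \<Rightarrow> real) \<Rightarrow> bool" where
  "bounded_mult m \<longleftrightarrow> m \<in> borel_measurable borel \<and> (\<exists>B. \<forall>\<xi>. \<bar>m \<xi>\<bar> \<le> B)"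

definition mult_l2 :: "('a::euclidean_space \<Rightarrow> real) \<Rightarrow> 'a l2 \<Rightarrow> 'a l2" where
  "mult_l2 m x = to_l2 (\<lambda>\<xi>. complex_of_real (m \<xi>) * rep_l2 x \<xi>)"

lemma bounded_multI: "m \<in> borel_measurable borel \<Longrightarrow> (\<And>\<xi>. \<bar>m \<xi>\<bar> \<le> B) \<Longrightarrow> bounded_mult m"
  by (auto simp: bounded_mult_def)

lemma bounded_mult_L2:
  assumes m: "bounded_mult m" and f: "f \<in> L2_space"
  shows "(\<lambda>\<xi>. complex_of_real (m \<xi>) * f \<xi>) \<in> L2_space"
proof -
  obtain B where B: "\<And>\<xi>. \<bar>m \<xi>\<bar> \<le> B" and [measurable]: "m \<in> borel_measurable borel"
    using m by (auto simp: bounded_mult_def)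
  note [measurable] = L2_space_measurable[OF f]
  show ?thesis
    by (rule L2_space_bound[OF _ f, of _ B]) (auto simp: norm_mult intro!: mult_right_mono B)
qed

lemma mult_l2_to_l2:
  assumes m: "bounded_mult m" and f: "f \<in> L2_space"
  shows "mult_l2 m (to_l2 f) = to_l2 (\<lambda>\<xi>. complex_of_real (m \<xi>) * f \<xi>)"
  unfolding mult_l2_def
  by (rule to_l2_cong) (use rep_l2_to_l2[OF f] in \<open>auto intro!: bounded_mult_L2 m f elim!: eventually_mono\<close>)

lemma norm_mult_l2_le:
  assumes m: "m \<in> borel_measurable borel" and B: "\<And>\<xi>. \<bar>m \<xi>\<bar> \<le> B"
  shows "norm (mult_l2 m x) \<le> B * norm x"
proof -
  have bm: "bounded_mult m" using m B by (rule bounded_multI)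
  have "B \<ge> 0" using B[of 0] by linarith
  obtain f where f: "f \<in> L2_space" "x = to_l2 f" using l2_cases[of x] by metis
  have Bf: "(\<lambda>\<xi>. complex_of_real B * f \<xi>) \<in> L2_space" by (rule L2_space_cmult[OF f(1)])
  have "(\<integral>\<xi>. (cmod (complex_of_real (m \<xi>) * f \<xi>))\<^sup>2 \<partial>lborel) \<le> (\<integral>\<xi>. (cmod (complex_of_real B * f \<xi>))\<^sup>2 \<partial>lborel)"
  proof (rule integral_mono)
    fix \<xi>
    have "\<bar>m \<xi>\<bar> \<le> \<bar>B\<bar>" using B[of \<xi>] by linarith
    then show "(cmod (complex_of_real (m \<xi>) * f \<xi>))\<^sup>2 \<le> (cmod (complex_of_real B * f \<xi>))\<^sup>2"
      by (auto simp: norm_mult intro!: power_mono mult_right_mono)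
  qed (intro L2_space_integrable bounded_mult_L2 bm f Bf)+
  then have "norm (mult_l2 m x) \<le> norm (to_l2 (\<lambda>\<xi>. complex_of_real B * f \<xi>))"
    using Bf by (simp add: f mult_l2_to_l2 bm norm_to_l2 bounded_mult_L2 L2_norm_def)
  also have "\<dots> = B * norm x"
    using to_l2_scaleR[OF f(1), of B] \<open>B \<ge> 0\<close> by (simp add: scaleR_conv_of_real f)
  finally show ?thesis .
qed

lemma bounded_linear_mult_l2:
  fixes m :: "'a::euclidean_space \<Rightarrow> real"
  assumes m: "bounded_mult m"
  shows "bounded_linear (mult_l2 m)"
proof -
  obtain B where B: "\<And>\<xi>. \<bar>m \<xi>\<bar> \<le> B" and mm: "m \<in> borel_measurable borel"
    using m by (auto simp: bounded_mult_def)
  show ?thesis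
  proof (rule bounded_linear_intro)
    fix x y :: "'a l2" and c :: real
    obtain f g where f: "f \<in> L2_space" "x = to_l2 f" and g: "g \<in> L2_space" "y = to_l2 g"
      using l2_cases[of x] l2_cases[of y] by metis
    have "mult_l2 m (x + y) = mult_l2 m (to_l2 (\<lambda>\<xi>. f \<xi> + g \<xi>))"
      by (simp add: f g to_l2_add)
    also have "\<dots> = to_l2 (\<lambda>\<xi>. complex_of_real (m \<xi>) * f \<xi> + complex_of_real (m \<xi>) * g \<xi>)"
      by (simp add: mult_l2_to_l2 m L2_space_add f g distrib_left)
    also have "\<dots> = mult_l2 m x + mult_l2 m y"
      by (simp add: to_l2_add bounded_mult_L2 m f g mult_l2_to_l2)
    finally show "mult_l2 m (x + y) = mult_l2 m x + mult_l2 m y" .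
    have "mult_l2 m (c *\<^sub>R x) = mult_l2 m (to_l2 (\<lambda>\<xi>. c *\<^sub>R f \<xi>))"
      by (simp add: f to_l2_scaleR)
    also have "\<dots> = to_l2 (\<lambda>\<xi>. c *\<^sub>R (complex_of_real (m \<xi>) * f \<xi>))"
      by (simp add: mult_l2_to_l2 m L2_space_scaleR f)
    also have "\<dots> = c *\<^sub>R mult_l2 m x"
      by (simp only: to_l2_scaleR bounded_mult_L2 m f mult_l2_to_l2)
    finally show "mult_l2 m (c *\<^sub>R x) = c *\<^sub>R mult_l2 m x" .
    show "norm (mult_l2 m x) \<le> norm x * B"
      using norm_mult_l2_le[OF mm B, of x] by (simp add: mult.commute)
  qed
qed

text \<open>A quadratic Taylor remainder uniform in the frequency makes the family of multiplication
  operators differentiable in operator norm. The rest is the product rule for applying an operator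
  to a vector.\<close>

lemma has_vector_derivative_mult_l2:
  fixes m :: "real \<Rightarrow> 'a::euclidean_space \<Rightarrow> real" and x :: "real \<Rightarrow> 'a l2"
  assumes m: "\<And>s. s \<in> S \<Longrightarrow> bounded_mult (m s)" and m': "bounded_mult m'" and a: "a \<in> S"
    and K: "\<And>s \<xi>. s \<in> S \<Longrightarrow> \<bar>m s \<xi> - m a \<xi> - (s - a) * m' \<xi>\<bar> \<le> K * (s - a)\<^sup>2"
    and x: "(x has_vector_derivative x') (at a within S)"
  shows "((\<lambda>s. mult_l2 (m s) (x s)) has_vector_derivative mult_l2 (m a) x' + mult_l2 m' (x a)) (at a within S)"
proof -
  define M where "M m = Blinfun (mult_l2 m)" for m :: "'a \<Rightarrow> real"
  have M: "blinfun_apply (M m) = mult_l2 m" if "bounded_mult m" for m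
    unfolding M_def by (rule bounded_linear_Blinfun_apply[OF bounded_linear_mult_l2[OF that]])
  have bound: "norm (norm (M (m s) - M (m a) - (s - a) *\<^sub>R M m') / norm (s - a)) \<le> K * \<bar>s - a\<bar>" if s: "s \<in> S" "s \<noteq> a" for s
  proof -
    have 1: "K * (s - a)\<^sup>2 \<ge> 0" using K[OF s(1), of 0] by linarith
    have [measurable]: "m s \<in> borel_measurable borel" "m a \<in> borel_measurable borel" "m' \<in> borel_measurable borel"
      using m s a m' by (auto simp: bounded_mult_def)
    have 2: "norm (blinfun_apply (M (m s) - M (m a) - (s - a) *\<^sub>R M m') y) \<le> K * (s - a)\<^sup>2 * norm y" for y
    proof -
      obtain f where f: "f \<in> L2_space" "y = to_l2 f" using l2_cases[of y] by metis
      have d: "bounded_mult (\<lambda>\<xi>. m s \<xi> - m a \<xi> - (s - a) * m' \<xi>)"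
        using K[OF s(1)] by (intro bounded_multI) auto
      have "blinfun_apply (M (m s) - M (m a) - (s - a) *\<^sub>R M m') y
          = mult_l2 (m s) y - mult_l2 (m a) y - (s - a) *\<^sub>R mult_l2 m' y"
        using M m s a m' by (simp add: blinfun.diff_left blinfun.scaleR_left)
      also have "\<dots> = to_l2 (\<lambda>\<xi>. complex_of_real (m s \<xi>) * f \<xi> - complex_of_real (m a \<xi>) * f \<xi>
          - (s - a) *\<^sub>R (complex_of_real (m' \<xi>) * f \<xi>))"
        using m s a m' f by (simp only: mult_l2_to_l2 bounded_mult_L2 L2_space_diff L2_space_scaleR
            to_l2_diff to_l2_scaleR)
      also have "\<dots> = mult_l2 (\<lambda>\<xi>. m s \<xi> - m a \<xi> - (s - a) * m' \<xi>) y"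
        unfolding f(2) mult_l2_to_l2[OF d f(1)]
        by (rule arg_cong[where f = to_l2]) (simp add: fun_eq_iff scaleR_conv_of_real algebra_simps)
      finally show ?thesis
        using norm_mult_l2_le[of "\<lambda>\<xi>. m s \<xi> - m a \<xi> - (s - a) * m' \<xi>" "K * (s - a)\<^sup>2" y] K[OF s(1)] by simp
    qed
    have "norm (M (m s) - M (m a) - (s - a) *\<^sub>R M m') \<le> K * (s - a)\<^sup>2"
      using 1 2 by (rule norm_blinfun_bound)
    then show ?thesis using s by (simp add: divide_simps power2_eq_square abs_mult)
  qed
  have "((\<lambda>s. K * \<bar>s - a\<bar>) \<longlongrightarrow> K * \<bar>a - a\<bar>) (at a within S)"
    by (intro tendsto_intros)
  then have lim: "((\<lambda>s. K * \<bar>s - a\<bar>) \<longlongrightarrow> 0) (at a within S)" by simp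
  have "\<forall>\<^sub>F s in at a within S. s \<in> S \<and> s \<noteq> a"
    unfolding eventually_at by (intro exI[of _ 1]) auto
  then have "\<forall>\<^sub>F s in at a within S. norm (norm (M (m s) - M (m a) - (s - a) *\<^sub>R M m') / norm (s - a)) \<le> K * \<bar>s - a\<bar>"
    by eventually_elim (use bound in auto)
  from Lim_null_comparison[OF this lim]
  have "((\<lambda>s. M (m s)) has_vector_derivative M m') (at a within S)"
    unfolding has_vector_derivative_def has_derivative_iff_norm
    by (simp add: bounded_linear_scaleR_left)
  from bounded_bilinear.has_vector_derivative[OF bounded_bilinear_blinfun_apply this x]
  have "((\<lambda>s. blinfun_apply (M (m s)) (x s)) has_vector_derivative mult_l2 (m a) x' + mult_l2 m' (x a)) (at a within S)"
    by (simp add: M m a m')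
  then show ?thesis
    by (rule has_vector_derivative_transform[rotated 2]) (use a m M in auto)
qed

section \<open>The explicit solution\<close>

text \<open>For a fixed frequency of modulus \<open>r\<close>, the equation reads \<open>w'' + damping r * w' + r\<^sup>2 * w = 0\<close>, whose
  characteristic roots are \<open>- damping r / 2 \<plusminus> \<i> * freq r\<close>; \<open>prop0\<close> and \<open>prop1\<close> are its solutions
  with initial data \<open>(1, 0)\<close> and \<open>(0, 1)\<close>.\<close>

definition damping :: "real \<Rightarrow> real" where
  "damping r = ln (1 + r\<^sup>2)"

definition freq :: "real \<Rightarrow> real" where
  "freq r = sqrt (r\<^sup>2 - (damping r)\<^sup>2 / 4)"

definition prop0 :: "real \<Rightarrow> real \<Rightarrow> real" where
  "prop0 r t = exp (- damping r * t / 2) * (cos (freq r * t) + damping r / (2 * freq r) * sin (freq r * t))"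

definition prop1 :: "real \<Rightarrow> real \<Rightarrow> real" where
  "prop1 r t = exp (- damping r * t / 2) * (sin (freq r * t) / freq r)"

lemma measurable_props [measurable]:
  "damping \<in> borel_measurable borel" "freq \<in> borel_measurable borel"
  "(\<lambda>r. prop0 r t) \<in> borel_measurable borel" "(\<lambda>r. prop1 r t) \<in> borel_measurable borel"
proof -
  show [measurable]: "damping \<in> borel_measurable borel" unfolding damping_def[abs_def] by measurable
  show [measurable]: "freq \<in> borel_measurable borel" unfolding freq_def[abs_def] by measurable
  show "(\<lambda>r. prop0 r t) \<in> borel_measurable borel" unfolding prop0_def by measurable
  show "(\<lambda>r. prop1 r t) \<in> borel_measurable borel" unfolding prop1_def by measurable
qed

lemma damping_bounds:
  shows "damping r \<ge> 0" "damping r \<le> r\<^sup>2" "r \<ge> 0 \<Longrightarrow> damping r \<le> r"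
  using ln_one_plus_square_le[of r] ln_add_one_self_le_self[of "r\<^sup>2"]
  by (auto simp: damping_def)

text \<open>Everything follows from \<open>damping r \<le> r\<close>, which leaves at least three
  quarters of \<open>r\<^sup>2\<close> under the root. The factor \<open>sqrt 3 / 2\<close> enters
  the final constant; the cruder \<open>r / 2\<close> suffices for identifying the
  semigroup.\<close>

lemma freq_bounds:
  assumes r: "r > 0"
  shows "(freq r)\<^sup>2 = r\<^sup>2 - (damping r)\<^sup>2 / 4" "freq r \<ge> sqrt 3 / 2 * r" "freq r \<ge> r / 2" "freq r > 0" "freq r \<le> r"
proof -
  have d: "(damping r)\<^sup>2 \<le> r\<^sup>2" using damping_bounds[of r] r by (intro power_mono) auto
  then have "(damping r)\<^sup>2 \<le> r\<^sup>2 * 4" using zero_le_power2[of r] by linarith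
  then show sq: "(freq r)\<^sup>2 = r\<^sup>2 - (damping r)\<^sup>2 / 4" by (simp add: freq_def)
  have "freq r \<ge> 0" using \<open>(damping r)\<^sup>2 \<le> r\<^sup>2 * 4\<close> by (simp add: freq_def)
  have "(sqrt 3 / 2 * r)\<^sup>2 \<le> (freq r)\<^sup>2" using d by (simp add: sq power_mult_distrib power_divide)
  then show 1: "freq r \<ge> sqrt 3 / 2 * r" using \<open>freq r \<ge> 0\<close> by (rule power2_le_imp_le)
  have "sqrt 3 \<ge> 1" by simp
  then have "sqrt 3 / 2 * r \<ge> 1 / 2 * r" using r by (intro mult_right_mono) auto
  then show 2: "freq r \<ge> r / 2" using 1 by simp
  show "freq r > 0" using 2 r by simp
  have "(freq r)\<^sup>2 \<le> r\<^sup>2" by (simp add: sq)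
  then show "freq r \<le> r" using r by (auto intro: power2_le_imp_le)
qed

text \<open>The derivatives are written through \<open>prop0\<close> and \<open>prop1\<close>
  themselves. In this form, differentiating in the remaining time produces terms that cancel against
  the system \<open>u' = v\<close>, \<open>v' = - r\<^sup>2 u - damping r * v\<close>.\<close>

lemma prop_derivs:
  assumes r: "r > 0"
  shows "((\<lambda>t. prop0 r t) has_real_derivative - r\<^sup>2 * prop1 r t) (at t within S)"
    and "((\<lambda>t. prop1 r t) has_real_derivative prop0 r t - damping r * prop1 r t) (at t within S)"
proof -
  note f = freq_bounds[OF r]
  \<comment> \<open>With \<open>r\<^sup>2\<close> eliminated, the first derivative becomes an
    identity that is rational in \<open>freq\<close> and \<open>damping\<close>.\<close>
  have r2: "r\<^sup>2 = (freq r)\<^sup>2 + (damping r)\<^sup>2 / 4" using f(1) by simp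
  show "((\<lambda>t. prop0 r t) has_real_derivative - r\<^sup>2 * prop1 r t) (at t within S)"
    unfolding prop0_def prop1_def r2
    using f(4) by (auto intro!: derivative_eq_intros simp: field_simps power2_eq_square)
  show "((\<lambda>t. prop1 r t) has_real_derivative prop0 r t - damping r * prop1 r t) (at t within S)"
    unfolding prop0_def prop1_def
    using f(4) by (auto intro!: derivative_eq_intros simp: field_simps power2_eq_square)
qed

lemma prop_0 [simp]: "prop0 r 0 = 1" "prop1 r 0 = 0"
  by (simp_all add: prop0_def prop1_def)

lemma prop_bounds:
  assumes r: "r > 0" and t: "t \<ge> 0"
  shows "\<bar>prop0 r t\<bar> \<le> 2" "\<bar>prop1 r t\<bar> \<le> 2 / r"
proof -
  note f = freq_bounds[OF r]
  have e: "exp (- damping r * t / 2) \<le> 1" using damping_bounds(1)[of r] t by simp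
  have q: "0 \<le> damping r / (2 * freq r)" "damping r / (2 * freq r) \<le> 1"
    using f damping_bounds[of r] r by (auto simp: field_simps)
  have "\<bar>cos (freq r * t) + damping r / (2 * freq r) * sin (freq r * t)\<bar>
      \<le> \<bar>cos (freq r * t)\<bar> + damping r / (2 * freq r) * \<bar>sin (freq r * t)\<bar>"
    using abs_triangle_ineq[of "cos (freq r * t)" "damping r / (2 * freq r) * sin (freq r * t)"]
    unfolding abs_mult abs_of_nonneg[OF q(1)] .
  also have "\<dots> \<le> 1 + 1 * 1"
    using q by (intro add_mono mult_mono) auto
  finally have "\<bar>prop0 r t\<bar> \<le> 1 * (1 + 1 * 1)"
    unfolding prop0_def abs_mult by (intro mult_mono) (use e in auto)
  then show "\<bar>prop0 r t\<bar> \<le> 2" by simp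
  have "\<bar>sin (freq r * t) / freq r\<bar> \<le> 1 / freq r"
    using f(4) by (simp add: divide_simps)
  also have "\<dots> \<le> 2 / r" using f(3,4) r by (simp add: field_simps)
  finally have "\<bar>prop1 r t\<bar> \<le> 1 * (2 / r)"
    unfolding prop1_def abs_mult by (intro mult_mono) (use e in auto)
  then show "\<bar>prop1 r t\<bar> \<le> 2 / r" by simp
qed

text \<open>The mean value inequality is used for \<open>f'\<close> and then for
  \<open>f t - t * f' s\<close> on the segment between \<open>s\<close> and \<open>t\<close>, which
  costs the factor \<open>1/2\<close> of the sharp remainder. The order of \<open>s\<close> and
  \<open>t\<close> is free, and one-sided derivatives at 0 suffice, so the remaining time may reach
  0.\<close>

lemma second_order_Taylor_bound:
  fixes f :: "real \<Rightarrow> real"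
  assumes f: "\<And>t. t \<ge> 0 \<Longrightarrow> (f has_real_derivative f' t) (at t within {0..})"
    and f': "\<And>t. t \<ge> 0 \<Longrightarrow> (f' has_real_derivative f'' t) (at t within {0..})"
    and K: "\<And>t. t \<ge> 0 \<Longrightarrow> \<bar>f'' t\<bar> \<le> K" and st: "s \<ge> 0" "t \<ge> 0"
  shows "\<bar>f t - f s - (t - s) * f' s\<bar> \<le> K * (t - s)\<^sup>2"
proof -
  have sub: "closed_segment s t \<subseteq> {0..}" using st by (auto simp: closed_segment_eq_real_ivl)
  have lip: "\<bar>f' x - f' s\<bar> \<le> K * \<bar>x - s\<bar>" if "x \<ge> 0" for x
    using field_differentiable_bound[of "{0..}" f' f'' K x s] f' K that st
    by (auto simp: convex_real_interval)
  have "norm ((f t - t * f' s) - (f s - s * f' s)) \<le> (K * \<bar>t - s\<bar>) * norm (t - s)"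
  proof (rule field_differentiable_bound[where S = "closed_segment s t" and f' = "\<lambda>x. f' x - f' s"])
    fix x assume x: "x \<in> closed_segment s t"
    then have x0: "x \<ge> 0" using sub by auto
    show "((\<lambda>t. f t - t * f' s) has_field_derivative f' x - f' s) (at x within closed_segment s t)"
      using DERIV_subset[OF f[OF x0] sub] by (auto intro!: derivative_eq_intros)
    have "K \<ge> 0" using K[of 0] by linarith
    have "\<bar>x - s\<bar> \<le> \<bar>t - s\<bar>" using x by (auto simp: closed_segment_eq_real_ivl split: if_splits)
    then have "K * \<bar>x - s\<bar> \<le> K * \<bar>t - s\<bar>" using \<open>K \<ge> 0\<close> by (rule mult_left_mono)
    then show "norm (f' x - f' s) \<le> K * \<bar>t - s\<bar>" using lip[OF x0] by simp
  qed auto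
  then show ?thesis by (simp add: algebra_simps power2_eq_square abs_mult_self_eq flip: abs_mult)
qed

text \<open>The outer radius bounds \<open>r\<^sup>2\<close> and \<open>damping r\<close>; the inner
  radius turns the bound \<open>2 / r\<close> for \<open>prop1\<close> into a uniform one. All
  bounds depend on \<open>R\<close> alone.\<close>

lemma prop_bounds_cutoff:
  assumes R: "R \<ge> 1" and r: "inverse R \<le> r" "r \<le> R" and t: "t \<ge> 0"
  shows "r > 0" "\<bar>prop0 r t\<bar> \<le> 2" "\<bar>prop1 r t\<bar> \<le> 2 * R" "\<bar>r\<^sup>2 * prop1 r t\<bar> \<le> R\<^sup>2 * (2 * R)"
    "\<bar>prop0 r t - damping r * prop1 r t\<bar> \<le> 2 + R * (2 * R)"
proof -
  show r0: "r > 0" using R r(1) by (meson inverse_positive_iff_positive less_le_trans zero_less_one)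
  show p0: "\<bar>prop0 r t\<bar> \<le> 2" by (rule prop_bounds[OF r0 t])
  have "2 / r \<le> 2 * R" using r(1) r0 R by (simp add: field_simps)
  then show p1: "\<bar>prop1 r t\<bar> \<le> 2 * R" using prop_bounds(2)[OF r0 t] by linarith
  show "\<bar>r\<^sup>2 * prop1 r t\<bar> \<le> R\<^sup>2 * (2 * R)"
    unfolding abs_mult using r r0 p1 R by (intro mult_mono) (auto intro: power_mono)
  have "\<bar>damping r * prop1 r t\<bar> \<le> R * (2 * R)"
    unfolding abs_mult using damping_bounds[of r] r r0 p1 R by (intro mult_mono) auto
  then show "\<bar>prop0 r t - damping r * prop1 r t\<bar> \<le> 2 + R * (2 * R)" using p0 by linarith
qed

lemma prop_Taylor:
  assumes R: "R \<ge> 1"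
  obtains K where "\<And>r s t. inverse R \<le> r \<Longrightarrow> r \<le> R \<Longrightarrow> s \<ge> 0 \<Longrightarrow> t \<ge> 0 \<Longrightarrow>
      \<bar>prop0 r t - prop0 r s - (t - s) * (- r\<^sup>2 * prop1 r s)\<bar> \<le> K * (t - s)\<^sup>2 \<and>
      \<bar>prop1 r t - prop1 r s - (t - s) * (prop0 r s - damping r * prop1 r s)\<bar> \<le> K * (t - s)\<^sup>2"
proof -
  \<comment> \<open>The first summand bounds the second derivative of \<open>prop0\<close>; the
    other two bound the two terms in the second derivative of \<open>prop1\<close>.\<close>
  define K where "K = R\<^sup>2 * (2 + R * (2 * R)) + R\<^sup>2 * (2 * R) + R * (2 + R * (2 * R))"
  have R0: "R\<^sup>2 * (2 + R * (2 * R)) \<ge> 0" "R\<^sup>2 * (2 * R) \<ge> 0" "R * (2 + R * (2 * R)) \<ge> 0" using R by auto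
  have main: "\<bar>prop0 r t - prop0 r s - (t - s) * (- r\<^sup>2 * prop1 r s)\<bar> \<le> K * (t - s)\<^sup>2 \<and>
      \<bar>prop1 r t - prop1 r s - (t - s) * (prop0 r s - damping r * prop1 r s)\<bar> \<le> K * (t - s)\<^sup>2"
    if r: "inverse R \<le> r" "r \<le> R" and st: "s \<ge> 0" "t \<ge> 0" for r s t
  proof -
    note b = prop_bounds_cutoff[OF R r]
    have r0: "r > 0" by (rule b(1)[OF st(1)])
    have K0: "\<bar>- r\<^sup>2 * (prop0 r t - damping r * prop1 r t)\<bar> \<le> K" if "t \<ge> 0" for t
    proof -
      have "\<bar>- r\<^sup>2 * (prop0 r t - damping r * prop1 r t)\<bar> \<le> R\<^sup>2 * (2 + R * (2 * R))"
        unfolding abs_mult abs_minus_cancel using r r0 b(5)[OF that] R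
        by (intro mult_mono) (auto intro: power_mono)
      then show ?thesis using R0 unfolding K_def by linarith
    qed
    have K1: "\<bar>- r\<^sup>2 * prop1 r t - damping r * (prop0 r t - damping r * prop1 r t)\<bar> \<le> K" if "t \<ge> 0" for t
    proof -
      have "\<bar>damping r * (prop0 r t - damping r * prop1 r t)\<bar> \<le> R * (2 + R * (2 * R))"
        unfolding abs_mult using damping_bounds[of r] r r0 b(5)[OF that] R by (intro mult_mono) auto
      then show ?thesis using b(4)[OF that] R0 unfolding K_def mult_minus_left by linarith
    qed
    have "\<bar>prop0 r t - prop0 r s - (t - s) * (- r\<^sup>2 * prop1 r s)\<bar> \<le> K * (t - s)\<^sup>2"
      by (rule second_order_Taylor_bound[OF prop_derivs(1)[OF r0] DERIV_cmult[OF prop_derivs(2)[OF r0]] K0 st])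
    moreover have "\<bar>prop1 r t - prop1 r s - (t - s) * (prop0 r s - damping r * prop1 r s)\<bar> \<le> K * (t - s)\<^sup>2"
      by (rule second_order_Taylor_bound[OF prop_derivs(2)[OF r0]
            DERIV_diff[OF prop_derivs(1)[OF r0] DERIV_cmult[OF prop_derivs(2)[OF r0]]] K1 st])
    ultimately show ?thesis ..
  qed
  show thesis by (rule that[OF main])
qed

section \<open>Frequency cutoff and identification of the semigroup\<close>

definition annulus :: "real \<Rightarrow> 'a::euclidean_space set" where
  "annulus R = {\<xi>. inverse R \<le> norm \<xi> \<and> norm \<xi> \<le> R}"

lemma annulus_measurable [measurable]: "annulus R \<in> sets borel"
  unfolding annulus_def by measurable

lemma bounded_mult_annulus:
  assumes [measurable]: "m \<in> borel_measurable borel" and B: "\<And>\<xi>. \<xi> \<in> annulus R \<Longrightarrow> \<bar>m \<xi>\<bar> \<le> B"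
  shows "bounded_mult (\<lambda>\<xi>. indicator (annulus R) \<xi> * m \<xi>)"
proof (rule bounded_multI)
  show "\<bar>indicator (annulus R) \<xi> * m \<xi>\<bar> \<le> \<bar>B\<bar>" for \<xi>
    using B[of \<xi>] by (cases "\<xi> \<in> annulus R") auto
qed measurable

lemma abs_divide_weight_le: "\<bar>a / weight 1 \<xi>\<bar> \<le> \<bar>a\<bar>"
proof -
  have "weight 1 \<xi> \<ge> 1" using weight_mono[of 0 1 \<xi>] by (simp add: weight_0)
  then have "\<bar>a\<bar> / weight 1 \<xi> \<le> \<bar>a\<bar> / 1" by (intro divide_left_mono) auto
  then show ?thesis by simp
qed

text \<open>The division removes the weight that \<open>encode\<close> puts on the first component.
  At time 0 only the cutoff remains, so \<open>cutoff_mult0 R 0\<close> extracts the plain transform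
  on the annulus from an encoded state.\<close>

definition cutoff_mult0 :: "real \<Rightarrow> real \<Rightarrow> 'a::euclidean_space \<Rightarrow> real" where
  "cutoff_mult0 R t \<xi> = indicator (annulus R) \<xi> * (prop0 (norm \<xi>) t / weight 1 \<xi>)"

definition cutoff_mult1 :: "real \<Rightarrow> real \<Rightarrow> 'a::euclidean_space \<Rightarrow> real" where
  "cutoff_mult1 R t \<xi> = indicator (annulus R) \<xi> * prop1 (norm \<xi>) t"

lemma cutoff_mult_0 [simp]: "cutoff_mult1 R 0 = (\<lambda>_. 0)"
  by (simp add: cutoff_mult1_def fun_eq_iff)

lemma bounded_cutoff_mult:
  assumes "R \<ge> 1" "t \<ge> 0"
  shows "bounded_mult (cutoff_mult0 R t)" "bounded_mult (cutoff_mult1 R t)"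
proof -
  note b = prop_bounds_cutoff[OF assms(1) _ _ assms(2)]
  show "bounded_mult (cutoff_mult0 R t)"
    unfolding cutoff_mult0_def
    by (rule bounded_mult_annulus[OF _ order_trans[OF abs_divide_weight_le b(2)]]) (auto simp: annulus_def)
  show "bounded_mult (cutoff_mult1 R t)"
    unfolding cutoff_mult1_def
    by (rule bounded_mult_annulus[OF _ b(3)]) (auto simp: annulus_def)
qed

text \<open>On an annulus of frequencies all symbols are bounded, so that for data in the domain of the generator
  the map \<open>s \<mapsto> prop0 (t - s) * fourier (u s) + prop1 (t - s) * fourier (u' s)\<close> is differentiable in
  \<open>l2\<close>; its derivative on \<open>[0, t]\<close> vanishes, and its values at \<open>0\<close> and \<open>t\<close> are the two sides of the claim.\<close>
lemma semigroup_fourier_domain: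
  fixes T :: "real \<Rightarrow> 'a::euclidean_space state \<Rightarrow> 'a state"
  assumes sem: "c0_semigroup \<tau>"
    and T: "\<And>t U. t \<ge> 0 \<Longrightarrow> U \<in> energy_space \<Longrightarrow> T t U \<in> energy_space"
    and tau: "\<And>t U. t \<ge> 0 \<Longrightarrow> U \<in> energy_space \<Longrightarrow> encode (T t U) = \<tau> t (encode U)"
    and gen: "\<And>U W. U \<in> energy_space \<Longrightarrow> W \<in> energy_space \<Longrightarrow>
      c0_semigroup.generates \<tau> (encode U) (encode W) \<longleftrightarrow> U \<in> wave_domain \<and> state_eq W (wave_op U)"
    and U0: "U0 \<in> wave_domain" and t: "t \<ge> 0" and R: "R \<ge> 1"
  shows "mult_l2 (cutoff_mult0 R 0) (fst (\<tau> t (encode U0))) =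
    mult_l2 (cutoff_mult0 R t) (fst (encode U0)) + mult_l2 (cutoff_mult1 R t) (fourier_l2 (snd (encode U0)))"
proof -
  interpret c0_semigroup \<tau> by (rule sem)
  obtain K where K: "\<And>r s t. inverse R \<le> r \<Longrightarrow> r \<le> R \<Longrightarrow> s \<ge> 0 \<Longrightarrow> t \<ge> 0 \<Longrightarrow>
      \<bar>prop0 r t - prop0 r s - (t - s) * (- r\<^sup>2 * prop1 r s)\<bar> \<le> K * (t - s)\<^sup>2 \<and>
      \<bar>prop1 r t - prop1 r s - (t - s) * (prop0 r s - damping r * prop1 r s)\<bar> \<le> K * (t - s)\<^sup>2"
    using prop_Taylor[OF R] by blast
  have K0: "K \<ge> 0" using K[of 1 0 1] R by (auto simp: inverse_le_1_iff)
  have U0E: "U0 \<in> energy_space" by (rule wave_domain_energy_space[OF U0])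
  define W where "W = wave_op U0"
  have WE: "W \<in> energy_space" unfolding W_def by (rule wave_op_fourier(1)[OF U0])
  have gen0: "generates (encode U0) (encode W)"
    using gen[OF U0E WE] U0 by (simp add: W_def state_eq_def)
  define y where "y s = \<tau> s (encode U0)" for s
  define y' where "y' s = \<tau> s (encode W)" for s
  \<comment> \<open>The orbit stays in the domain because generation is preserved along it; the
    equivalence \<open>gen\<close> then shows that its derivative is \<open>wave_op\<close> of the
    orbit.\<close>
  have T_domain: "T s U0 \<in> wave_domain" "y s = encode (T s U0)" "y' s = encode (wave_op (T s U0))"
    if s: "s \<ge> 0" for s
  proof -
    have "generates (encode (T s U0)) (encode (T s W))"
      using generates_T[OF gen0 s] by (simp add: tau U0E WE s)
    then have *: "T s U0 \<in> wave_domain" "state_eq (T s W) (wave_op (T s U0))"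
      using gen T s U0E WE by auto
    show "T s U0 \<in> wave_domain" by fact
    show "y s = encode (T s U0)" by (simp add: y_def tau U0E s)
    have "encode (T s W) = encode (wave_op (T s U0))"
      using *(2) by (subst encode_eq_iff) (auto intro: T s WE wave_op_fourier *)
    then show "y' s = encode (wave_op (T s U0))" by (simp add: y'_def tau WE s)
  qed
  have y_deriv: "(y has_vector_derivative y' s) (at s within {0..t})" if "s \<in> {0..t}" for s
    unfolding y_def y'_def using has_vector_derivative[OF gen0, of s] that
    by (auto intro: has_vector_derivative_within_subset)
  define m0 m1 :: "real \<Rightarrow> 'a \<Rightarrow> real" where "m0 s = cutoff_mult0 R (t - s)" and "m1 s = cutoff_mult1 R (t - s)" for s
  \<comment> \<open>The derivatives of \<open>m0\<close> and \<open>m1\<close> in \<open>s\<close>;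
    the inner function \<open>t - s\<close> reverses the signs of the time derivatives of the
    propagators.\<close>
  define m0' where "m0' s \<xi> = indicator (annulus R) \<xi> * ((norm \<xi>)\<^sup>2 * prop1 (norm \<xi>) (t - s) / weight 1 \<xi>)" for s and \<xi> :: 'a
  define m1' where "m1' s \<xi> = indicator (annulus R) \<xi> * - (prop0 (norm \<xi>) (t - s) - damping (norm \<xi>) * prop1 (norm \<xi>) (t - s))" for s and \<xi> :: 'a
  have bm: "bounded_mult (m0 s)" "bounded_mult (m0' s)" "bounded_mult (m1 s)" "bounded_mult (m1' s)"
    if "s \<in> {0..t}" for s
  proof -
    have s: "t - s \<ge> 0" using that by simp
    note b = prop_bounds_cutoff[OF R _ _ s]
    show "bounded_mult (m0 s)" "bounded_mult (m1 s)"
      unfolding m0_def m1_def by (rule bounded_cutoff_mult[OF R s])+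
    show "bounded_mult (m0' s)"
      unfolding m0'_def
      by (rule bounded_mult_annulus[OF _ order_trans[OF abs_divide_weight_le b(4)]]) (auto simp: annulus_def)
    show "bounded_mult (m1' s)"
      unfolding m1'_def
    proof (rule bounded_mult_annulus)
      show "\<bar>- (prop0 (norm \<xi>) (t - s) - damping (norm \<xi>) * prop1 (norm \<xi>) (t - s))\<bar> \<le> 2 + R * (2 * R)"
        if "\<xi> \<in> annulus R" for \<xi> :: 'a
        using b(5)[of "norm \<xi>"] that unfolding abs_minus_cancel annulus_def by simp
    qed measurable
  qed
  note m_defs = m0_def m0'_def m1_def m1'_def cutoff_mult0_def cutoff_mult1_def
  have T: "\<bar>m0 s \<xi> - m0 a \<xi> - (s - a) * m0' a \<xi>\<bar> \<le> K * (s - a)\<^sup>2"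
      "\<bar>m1 s \<xi> - m1 a \<xi> - (s - a) * m1' a \<xi>\<bar> \<le> K * (s - a)\<^sup>2"
    if sa: "s \<in> {0..t}" "a \<in> {0..t}" for s a \<xi>
  proof -
    define r where "r = norm \<xi>"
    have "\<bar>m0 s \<xi> - m0 a \<xi> - (s - a) * m0' a \<xi>\<bar> \<le> K * ((t - s) - (t - a))\<^sup>2 \<and>
        \<bar>m1 s \<xi> - m1 a \<xi> - (s - a) * m1' a \<xi>\<bar> \<le> K * ((t - s) - (t - a))\<^sup>2"
    proof (cases "\<xi> \<in> annulus R")
      case True
      define X Y where "X = prop0 r (t - s) - prop0 r (t - a) - ((t - s) - (t - a)) * (- r\<^sup>2 * prop1 r (t - a))"
        and "Y = prop1 r (t - s) - prop1 r (t - a) - ((t - s) - (t - a)) * (prop0 r (t - a) - damping r * prop1 r (t - a))"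
      have "\<bar>X\<bar> \<le> K * ((t - s) - (t - a))\<^sup>2" "\<bar>Y\<bar> \<le> K * ((t - s) - (t - a))\<^sup>2"
        unfolding X_def Y_def using K[of r "t - a" "t - s"] True sa by (auto simp: annulus_def r_def)
      moreover have "m0 s \<xi> - m0 a \<xi> - (s - a) * m0' a \<xi> = X / weight 1 \<xi>"
        using True by (simp add: m_defs X_def r_def field_simps)
      moreover have "m1 s \<xi> - m1 a \<xi> - (s - a) * m1' a \<xi> = Y"
        using True by (simp add: m_defs Y_def r_def algebra_simps)
      ultimately show ?thesis
        using order_trans[OF abs_divide_weight_le[of X \<xi>]] by simp
    qed (use K0 in \<open>simp add: m_defs\<close>)
    then show "\<bar>m0 s \<xi> - m0 a \<xi> - (s - a) * m0' a \<xi>\<bar> \<le> K * (s - a)\<^sup>2"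
      "\<bar>m1 s \<xi> - m1 a \<xi> - (s - a) * m1' a \<xi>\<bar> \<le> K * (s - a)\<^sup>2"
      by (simp_all add: power2_commute)
  qed
  define \<Psi> where "\<Psi> s = mult_l2 (m0 s) (fst (y s)) + mult_l2 (m1 s) (fourier_l2 (snd (y s)))" for s
  have \<Psi>_deriv: "(\<Psi> has_vector_derivative 0) (at a within {0..t})" if a: "a \<in> {0..t}" for a
  proof -
    have 1: "((\<lambda>s. fst (y s)) has_vector_derivative fst (y' a)) (at a within {0..t})"
      by (rule bounded_linear.has_vector_derivative[OF bounded_linear_fst y_deriv[OF a]])
    have 2: "((\<lambda>s. fourier_l2 (snd (y s))) has_vector_derivative fourier_l2 (snd (y' a))) (at a within {0..t})"
      by (intro bounded_linear.has_vector_derivative[OF bounded_linear_fourier_l2]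
          bounded_linear.has_vector_derivative[OF bounded_linear_snd y_deriv[OF a]])
    have d: "(\<Psi> has_vector_derivative
       (mult_l2 (m0 a) (fst (y' a)) + mult_l2 (m0' a) (fst (y a))) +
       (mult_l2 (m1 a) (fourier_l2 (snd (y' a))) + mult_l2 (m1' a) (fourier_l2 (snd (y a))))) (at a within {0..t})"
      unfolding \<Psi>_def
      by (intro has_vector_derivative_add has_vector_derivative_mult_l2[where K = K] bm a T 1 2)
    define U where "U = T a U0"
    have U: "U \<in> wave_domain" "y a = encode U" "y' a = encode (wave_op U)"
      using T_domain[of a] a by (auto simp: U_def)
    note wE = wave_op_fourier[OF U(1)]
    note u = energy_spaceD(1)[OF wave_domain_energy_space[OF U(1)], unfolded sobolev_space_iff]
    note v = energy_spaceD(2)[OF wave_domain_energy_space[OF U(1)]]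
    have v1: "weighted_fourier 1 (snd U) \<in> L2_space"
      using U(1) by (auto simp: wave_domain_def sobolev_space_iff)
    have fst_y: "fst (y a) = to_l2 (weighted_fourier 1 (fst U))" and snd_y: "fourier_l2 (snd (y a)) = to_l2 (fourier (snd U))"
      using v by (simp_all add: U encode_def fourier_l2_to_l2)
    have fst_y': "fst (y' a) = to_l2 (weighted_fourier 1 (snd U))"
      by (simp add: U encode_def wave_op_def)
    have snd_y': "fourier_l2 (snd (y' a)) = to_l2 (fourier (snd (wave_op U)))"
      using energy_spaceD(2)[OF wE(1)] by (simp add: U encode_def fourier_l2_to_l2)
    note L2s = v1 conjunct2[OF u] fourier_spec(1)[OF energy_spaceD(2)[OF wE(1)]] fourier_spec(1)[OF v]
    have "(mult_l2 (m0 a) (fst (y' a)) + mult_l2 (m0' a) (fst (y a))) +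
       (mult_l2 (m1 a) (fourier_l2 (snd (y' a))) + mult_l2 (m1' a) (fourier_l2 (snd (y a)))) =
       to_l2 (\<lambda>\<xi>. (complex_of_real (m0 a \<xi>) * weighted_fourier 1 (snd U) \<xi> + complex_of_real (m0' a \<xi>) * weighted_fourier 1 (fst U) \<xi>)
        + (complex_of_real (m1 a \<xi>) * fourier (snd (wave_op U)) \<xi> + complex_of_real (m1' a \<xi>) * fourier (snd U) \<xi>))"
      unfolding fst_y fst_y' snd_y snd_y'
      by (simp only: mult_l2_to_l2 bm[OF a] L2s to_l2_add bounded_mult_L2 L2_space_add)
    \<comment> \<open>With \<open>U\<close> and \<open>V\<close> for the two transforms,
      \<open>l\<close> for the damping and \<open>r\<close> for the modulus, the terms on the
      annulus are \<open>prop0 V + r\<^sup>2 prop1 U + prop1 (- r\<^sup>2 U - l V) - (prop0 - l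
      prop1) V\<close>, and they cancel.\<close>
    also have "\<dots> = to_l2 (\<lambda>\<xi>. 0)"
    proof (rule to_l2_cong)
      show "AE \<xi> in lborel. (complex_of_real (m0 a \<xi>) * weighted_fourier 1 (snd U) \<xi> + complex_of_real (m0' a \<xi>) * weighted_fourier 1 (fst U) \<xi>)
        + (complex_of_real (m1 a \<xi>) * fourier (snd (wave_op U)) \<xi> + complex_of_real (m1' a \<xi>) * fourier (snd U) \<xi>) = 0"
        using wE(2)
      proof eventually_elim
        fix \<xi> :: 'a
        assume e: "fourier (snd (wave_op U)) \<xi> = - complex_of_real ((norm \<xi>)\<^sup>2) * fourier (fst U) \<xi>
          - complex_of_real (ln (1 + (norm \<xi>)\<^sup>2)) * fourier (snd U) \<xi>"
        show "(complex_of_real (m0 a \<xi>) * weighted_fourier 1 (snd U) \<xi> + complex_of_real (m0' a \<xi>) * weighted_fourier 1 (fst U) \<xi>)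
          + (complex_of_real (m1 a \<xi>) * fourier (snd (wave_op U)) \<xi> + complex_of_real (m1' a \<xi>) * fourier (snd U) \<xi>) = 0"
          unfolding e m_defs weighted_fourier_def damping_def
          by (simp add: algebra_simps)
      qed
    qed (intro L2_space_zero L2_space_add bounded_mult_L2 bm[OF a] L2s)+
    also have "\<dots> = 0" by (simp add: zero_l2_def)
    finally show ?thesis using d by simp
  qed
  obtain c where "\<And>s. s \<in> {0..t} \<Longrightarrow> \<Psi> s = c"
    using has_vector_derivative_zero_constant[OF convex_real_interval(5) \<Psi>_deriv] by metis
  \<comment> \<open>At \<open>s = t\<close> no time remains: the term with \<open>prop1\<close>
    vanishes and the first one is the cutoff of the solution; at \<open>s = 0\<close> the
    propagators act on the data.\<close>
  then have "\<Psi> t = \<Psi> 0" using t by simp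
  moreover have "mult_l2 (\<lambda>_. 0) x = 0" for x :: "'a l2"
    by (simp add: mult_l2_def zero_l2_def)
  ultimately show ?thesis
    by (simp add: \<Psi>_def y_def zero m0_def m1_def)
qed

text \<open>Cutting off high frequencies keeps any Sobolev weight bounded, so the truncated data lie
  in the domain. Truncation converges in L2 for the weighted transform of the first component; for
  the second, convergence of transforms is carried back by the isometry.\<close>

lemma wave_domain_dense:
  fixes U :: "'a::euclidean_space state"
  assumes U: "U \<in> energy_space"
  obtains V where "\<And>n. V n \<in> wave_domain" "(\<lambda>n. encode (V n)) \<longlonglongrightarrow> encode U"
proof -
  have u: "fst U \<in> L2_space" "weighted_fourier 1 (fst U) \<in> L2_space" and v: "snd U \<in> L2_space"
    using energy_spaceD[OF U] by (simp_all add: sobolev_space_iff)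
  define un vn where "un n = inv_fourier (truncate (real n) (fourier (fst U)))"
    and "vn n = inv_fourier (truncate (real n) (fourier (snd U)))" for n
  note un = inv_fourier[OF truncate_L2[OF fourier_spec(1)[OF u(1)]], of "real n" for n, folded un_def]
  note vn = inv_fourier[OF truncate_L2[OF fourier_spec(1)[OF v]], of "real n" for n, folded vn_def]
  have weight_trunc: "(\<lambda>\<xi>. complex_of_real (weight s \<xi>) * truncate (real n) f \<xi>) \<in> L2_space"
    if f: "f \<in> L2_space" and s: "s \<ge> 0" for s n and f :: "'a \<Rightarrow> complex"
  proof (rule L2_space_bound[OF _ f])
    note [measurable] = L2_space_measurable[OF truncate_L2[OF f]]
    show "(\<lambda>\<xi>. complex_of_real (weight s \<xi>) * truncate (real n) f \<xi>) \<in> borel_measurable borel"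
      by measurable
    have "weight s \<xi> \<le> (1 + (real n)\<^sup>2) powr (s / 2)" if "norm \<xi> \<le> real n" for \<xi> :: 'a
      unfolding weight_def using that s by (intro powr_mono2 add_mono power_mono) auto
    then show "AE \<xi> in lborel. cmod (complex_of_real (weight s \<xi>) * truncate (real n) f \<xi>)
        \<le> (1 + (real n)\<^sup>2) powr (s / 2) * cmod (f \<xi>)"
      by (auto simp: truncate_def indicator_def norm_mult intro!: mult_right_mono)
  qed
  have un_wf: "AE \<xi> in lborel. weighted_fourier s (un n) \<xi> = complex_of_real (weight s \<xi>) * truncate (real n) (fourier (fst U)) \<xi>" for s n
    using un(2)[of n] by eventually_elim (simp add: weighted_fourier_def)
  have vn_wf: "AE \<xi> in lborel. weighted_fourier s (vn n) \<xi> = complex_of_real (weight s \<xi>) * truncate (real n) (fourier (snd U)) \<xi>" for s n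
    using vn(2)[of n] by eventually_elim (simp add: weighted_fourier_def)
  have dom: "(un n, vn n) \<in> wave_domain" for n
    using sobolev_space_AE(1)[OF un(1) un_wf weight_trunc[OF fourier_spec(1)[OF u(1)]], of 2]
      sobolev_space_AE(1)[OF vn(1) vn_wf weight_trunc[OF fourier_spec(1)[OF v]], of 1]
    by (simp add: wave_domain_def)
  have "(\<lambda>\<xi>. complex_of_real (weight 1 \<xi>) * truncate (real n) (fourier (fst U)) \<xi>) = truncate (real n) (weighted_fourier 1 (fst U))" for n
    by (simp add: truncate_def weighted_fourier_def fun_eq_iff)
  then have 1: "to_l2 (weighted_fourier 1 (un n)) = to_l2 (truncate (real n) (weighted_fourier 1 (fst U)))" for n
    using sobolev_space_AE(2)[OF un(1) un_wf weight_trunc[OF fourier_spec(1)[OF u(1)]], of 1] by simp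
  have lim1: "(\<lambda>n. to_l2 (weighted_fourier 1 (un n))) \<longlonglongrightarrow> to_l2 (weighted_fourier 1 (fst U))"
    unfolding 1 by (rule filterlim_compose[OF truncate_tendsto[OF u(2)] filterlim_real_sequentially])
  have F: "fourier_l2 (to_l2 (vn n)) = to_l2 (truncate (real n) (fourier (snd U)))" for n
    unfolding vn_def by (intro fourier_l2_inv_fourier truncate_L2 fourier_spec v)
  have "(\<lambda>n. fourier_l2 (to_l2 (vn n))) \<longlonglongrightarrow> fourier_l2 (to_l2 (snd U))"
    unfolding F fourier_l2_to_l2[OF v]
    by (rule filterlim_compose[OF truncate_tendsto[OF fourier_spec(1)[OF v]] filterlim_real_sequentially])
  then have "(\<lambda>n. norm (fourier_l2 (to_l2 (vn n)) - fourier_l2 (to_l2 (snd U)))) \<longlonglongrightarrow> 0"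
    by (intro tendsto_norm_zero) (simp add: LIM_zero)
  then have "(\<lambda>n. inverse (plancherel_const TYPE('a)) * (plancherel_const TYPE('a) * norm (to_l2 (vn n) - to_l2 (snd U)))) \<longlonglongrightarrow>
      inverse (plancherel_const TYPE('a)) * 0"
    by (intro tendsto_mult tendsto_const) (simp add: norm_fourier_l2 flip: fourier_l2_diff)
  then have "(\<lambda>n. norm (to_l2 (vn n) - to_l2 (snd U))) \<longlonglongrightarrow> 0"
    using plancherel_const_pos[where 'a = 'a] by (simp flip: mult.assoc)
  then have lim2: "(\<lambda>n. to_l2 (vn n)) \<longlonglongrightarrow> to_l2 (snd U)"
    by (rule LIM_zero_cancel[OF tendsto_norm_zero_cancel])
  show thesis
    by (rule that[OF dom]) (use tendsto_Pair[OF lim1 lim2] in \<open>simp add: encode_def\<close>)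
qed

text \<open>For fixed \<open>R\<close> both sides of the identity on the domain are continuous in
  the encoded data, so density extends it to all data. The cutoff is then removed pointwise by
  letting the annuli grow.\<close>

lemma fourier_mild_solution:
  fixes u0 u1 :: "'a::euclidean_space \<Rightarrow> complex"
  assumes u0: "u0 \<in> sobolev_space 1" and u1: "u1 \<in> L2_space" and sol: "mild_solution u0 u1 u" and t: "t \<ge> 0"
  shows "AE \<xi> in lborel. fourier (u t) \<xi> =
    complex_of_real (prop0 (norm \<xi>) t) * fourier u0 \<xi> + complex_of_real (prop1 (norm \<xi>) t) * fourier u1 \<xi>"
proof -
  obtain T where T: "C0_semigroup energy_space energy_norm T"
    "generated_by energy_space energy_norm T wave_domain wave_op"
    and u: "u t \<in> sobolev_space 1" "AE x in lborel. u t x = fst (T t (u0, u1)) x"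
    using sol t by (auto simp: mild_solution_def)
  obtain \<tau> where sem: "c0_semigroup \<tau>"
    and TE: "\<And>t U. t \<ge> 0 \<Longrightarrow> U \<in> energy_space \<Longrightarrow> T t U \<in> energy_space"
    and tau: "\<And>t U. t \<ge> 0 \<Longrightarrow> U \<in> energy_space \<Longrightarrow> encode (T t U) = \<tau> t (encode U)"
    and gen: "\<And>U W. U \<in> energy_space \<Longrightarrow> W \<in> energy_space \<Longrightarrow>
      c0_semigroup.generates \<tau> (encode U) (encode W) \<longleftrightarrow> U \<in> wave_domain \<and> state_eq W (wave_op U)"
    using semigroup_encode[OF T] by blast
  interpret c0_semigroup \<tau> by (rule sem)
  have U: "(u0, u1) \<in> energy_space" using u0 u1 by (simp add: energy_space_def)
  obtain V where V: "\<And>n. V n \<in> wave_domain" "(\<lambda>n. encode (V n)) \<longlonglongrightarrow> encode (u0, u1)"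
    using wave_domain_dense[OF U] by blast
  note bm = bounded_cutoff_mult(1)[OF _ order_refl] bounded_cutoff_mult[OF _ t]
  define W where "W = T t (u0, u1)"
  have WE: "W \<in> energy_space" unfolding W_def by (rule TE[OF t U])
  have eq: "mult_l2 (cutoff_mult0 R 0) (fst (encode W)) = mult_l2 (cutoff_mult0 R t) (fst (encode (u0, u1))) + mult_l2 (cutoff_mult1 R t) (fourier_l2 (snd (encode (u0, u1))))"
    if R: "R \<ge> 1" for R
  proof (rule LIMSEQ_unique)
    have "(\<lambda>n. \<tau> t (encode (V n))) \<longlonglongrightarrow> encode W"
      unfolding W_def tau[OF t U] by (intro bounded_linear.tendsto[OF bounded_linear] t V)
    then show "(\<lambda>n. mult_l2 (cutoff_mult0 R 0) (fst (\<tau> t (encode (V n))))) \<longlonglongrightarrow> mult_l2 (cutoff_mult0 R 0) (fst (encode W))"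
      by (intro bounded_linear.tendsto[OF bounded_linear_mult_l2[OF bm(1)[OF R]]] tendsto_fst)
    have "mult_l2 (cutoff_mult0 R 0) (fst (\<tau> t (encode (V n)))) = mult_l2 (cutoff_mult0 R t) (fst (encode (V n))) + mult_l2 (cutoff_mult1 R t) (fourier_l2 (snd (encode (V n))))" for n
      by (rule semigroup_fourier_domain[OF sem TE tau gen V(1) t R])
    then show "(\<lambda>n. mult_l2 (cutoff_mult0 R 0) (fst (\<tau> t (encode (V n))))) \<longlonglongrightarrow>
        mult_l2 (cutoff_mult0 R t) (fst (encode (u0, u1))) + mult_l2 (cutoff_mult1 R t) (fourier_l2 (snd (encode (u0, u1))))"
      by (simp only:) (intro tendsto_add bounded_linear.tendsto[OF bounded_linear_mult_l2[OF bm(2)[OF R]]]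
        bounded_linear.tendsto[OF bounded_linear_mult_l2[OF bm(3)[OF R]]] tendsto_fst tendsto_snd tendsto_fourier_l2 V(2))
  qed
  have W1: "fst W \<in> L2_space" "weighted_fourier 1 (fst W) \<in> L2_space"
    using energy_spaceD(1)[OF WE] by (simp_all add: sobolev_space_iff)
  have u0': "u0 \<in> L2_space" "weighted_fourier 1 u0 \<in> L2_space"
    using u0 by (simp_all add: sobolev_space_iff)
  have ae: "AE \<xi> in lborel. complex_of_real (cutoff_mult0 R 0 \<xi>) * weighted_fourier 1 (fst W) \<xi> =
      complex_of_real (cutoff_mult0 R t \<xi>) * weighted_fourier 1 u0 \<xi> + complex_of_real (cutoff_mult1 R t \<xi>) * fourier u1 \<xi>" if R: "R \<ge> 1" for R
  proof -
    have "to_l2 (\<lambda>\<xi>. complex_of_real (cutoff_mult0 R 0 \<xi>) * weighted_fourier 1 (fst W) \<xi>) =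
        to_l2 (\<lambda>\<xi>. complex_of_real (cutoff_mult0 R t \<xi>) * weighted_fourier 1 u0 \<xi> + complex_of_real (cutoff_mult1 R t \<xi>) * fourier u1 \<xi>)"
      using eq[OF R] by (simp add: encode_def mult_l2_to_l2 bm[OF R] W1 u0' u1 fourier_l2_to_l2 fourier_spec
        to_l2_add bounded_mult_L2)
    then show ?thesis
      by (subst (asm) to_l2_eq_iff) (intro L2_space_add bounded_mult_L2 bm[OF R] W1 u0' fourier_spec u1)+
  qed
  \<comment> \<open>The exceptional set depends on \<open>R\<close>; integer radii leave countably
    many null sets and still reach every nonzero frequency.\<close>
  have "AE \<xi> in lborel. \<forall>n. complex_of_real (cutoff_mult0 (real (Suc n)) 0 \<xi>) * weighted_fourier 1 (fst W) \<xi> =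
      complex_of_real (cutoff_mult0 (real (Suc n)) t \<xi>) * weighted_fourier 1 u0 \<xi> + complex_of_real (cutoff_mult1 (real (Suc n)) t \<xi>) * fourier u1 \<xi>"
    unfolding AE_all_countable by (intro allI ae) simp
  moreover have "AE \<xi> in lborel. \<xi> \<noteq> (0 :: 'a)" by (rule AE_lborel_singleton)
  moreover have "AE \<xi> in lborel. fourier (u t) \<xi> = fourier (fst W) \<xi>"
    by (rule fourier_cong) (use u W1 in \<open>auto simp: W_def sobolev_space_L2\<close>)
  ultimately show ?thesis
  proof eventually_elim
    fix \<xi> :: 'a
    assume all: "\<forall>n. complex_of_real (cutoff_mult0 (real (Suc n)) 0 \<xi>) * weighted_fourier 1 (fst W) \<xi> =
        complex_of_real (cutoff_mult0 (real (Suc n)) t \<xi>) * weighted_fourier 1 u0 \<xi> + complex_of_real (cutoff_mult1 (real (Suc n)) t \<xi>) * fourier u1 \<xi>"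
      and "\<xi> \<noteq> 0" and uW: "fourier (u t) \<xi> = fourier (fst W) \<xi>"
    obtain n where n: "max (norm \<xi>) (inverse (norm \<xi>)) \<le> real n" using real_arch_simple by blast
    then have "inverse (real (Suc n)) \<le> inverse (inverse (norm \<xi>))"
      using \<open>\<xi> \<noteq> 0\<close> by (intro le_imp_inverse_le) auto
    then have "\<xi> \<in> annulus (real (Suc n))" using n by (auto simp: annulus_def)
    then show "fourier (u t) \<xi> = complex_of_real (prop0 (norm \<xi>) t) * fourier u0 \<xi> + complex_of_real (prop1 (norm \<xi>) t) * fourier u1 \<xi>"
      using all[rule_format, of n] by (simp add: cutoff_mult0_def cutoff_mult1_def weighted_fourier_def uW)
  qed
qed

section \<open>Pointwise bounds on the propagators\<close>

lemma inverse_freq_le: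
  assumes r: "r > 0"
  shows "1 / freq r \<le> 2 / sqrt 3 / r"
  using freq_bounds(2,4)[OF r] r by (simp add: field_simps)

text \<open>The oscillating factor \<open>c + q * s\<close> is the inner product of
  \<open>(1, q)\<close> with a unit vector, so it is at most \<open>sqrt (1 + q\<^sup>2)\<close>,
  and this equals \<open>r / freq r\<close>.\<close>

lemma prop0_le:
  assumes r: "r > 0"
  shows "\<bar>prop0 r t\<bar> \<le> exp (- damping r * t / 2) * (2 / sqrt 3)"
proof -
  note f = freq_bounds[OF r]
  define q where "q = damping r / (2 * freq r)"
  define c s where "c = cos (freq r * t)" and "s = sin (freq r * t)"
  have cs: "c\<^sup>2 + s\<^sup>2 = 1" by (simp add: c_def s_def)
  have "(c + q * s)\<^sup>2 + (q * c - s)\<^sup>2 = (1 + q\<^sup>2) * (c\<^sup>2 + s\<^sup>2)"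
    by (simp add: power2_eq_square algebra_simps)
  then have "(c + q * s)\<^sup>2 + (q * c - s)\<^sup>2 = 1 + q\<^sup>2" unfolding cs by simp
  then have "(c + q * s)\<^sup>2 \<le> 1 + q\<^sup>2"
    using zero_le_power2[of "q * c - s"] by linarith
  also have "1 + q\<^sup>2 = (r * (1 / freq r))\<^sup>2"
    using f(1,4) by (simp add: q_def power_divide power_mult_distrib field_simps)
  also have "\<dots> \<le> (r * (2 / sqrt 3 / r))\<^sup>2"
    using inverse_freq_le[OF r] r f(4) by (intro power_mono mult_left_mono) auto
  also have "\<dots> = (2 / sqrt 3)\<^sup>2" using r by simp
  finally have "\<bar>c + q * s\<bar> \<le> 2 / sqrt 3"
    by (rule abs_le_square_iff[THEN iffD2, THEN order_trans]) simp
  moreover have "\<bar>prop0 r t\<bar> = exp (- damping r * t / 2) * \<bar>c + q * s\<bar>"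
    by (simp only: prop0_def abs_mult abs_exp_cancel c_def s_def q_def)
  ultimately show ?thesis by (simp only: mult_left_mono exp_ge_zero)
qed

lemma prop1_le:
  assumes r: "r > 0"
  shows "\<bar>prop1 r t\<bar> \<le> exp (- damping r * t / 2) * (2 / sqrt 3 / r)"
proof -
  have "\<bar>sin (freq r * t) / freq r\<bar> \<le> 1 / freq r"
    using freq_bounds(4)[OF r] by (simp add: divide_simps)
  also note inverse_freq_le[OF r]
  finally have "\<bar>sin (freq r * t) / freq r\<bar> \<le> 2 / sqrt 3 / r" .
  then show ?thesis
    unfolding prop1_def abs_mult[of "exp _"] abs_exp_cancel by (rule mult_left_mono) simp
qed

lemma abs_sin_diff_le: "\<bar>sin x - sin y\<bar> \<le> \<bar>x - y :: real\<bar>"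
  using field_differentiable_bound[of UNIV sin cos 1 x y] by (auto intro: DERIV_sin)

text \<open>Replacing the frequency \<open>b\<close> by \<open>r\<close> costs
  \<open>r - b \<le> l\<^sup>2 / (4 r)\<close>, because
  \<open>(r - b) (r + b) = l\<^sup>2 / 4\<close>. The change inside the sine gains a factor
  \<open>t\<close> and the change of the denominator does not; these produce the two terms of the
  bound.\<close>

lemma prop1_minus_wave_le:
  assumes r: "r > 0" and t: "t \<ge> 0"
  shows "\<bar>prop1 r t - exp (- damping r * t / 2) * (sin (r * t) / r)\<bar>
    \<le> exp (- damping r * t / 2) * (2 / sqrt 3 * (1 + damping r * t / 4))"
proof -
  note f = freq_bounds[OF r] and d = damping_bounds[of r]
  define b l \<kappa> where "b = freq r" and "l = damping r" and "\<kappa> = 2 / sqrt 3"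
  have b: "b > 0" "b \<le> r" "b\<^sup>2 = r\<^sup>2 - l\<^sup>2 / 4" "1 / b \<le> \<kappa> / r"
    using f inverse_freq_le[OF r] by (simp_all add: b_def l_def \<kappa>_def)
  have l: "0 \<le> l" "l \<le> r\<^sup>2" "l \<le> r" using d r by (simp_all add: l_def)
  have \<kappa>: "\<kappa> > 0" by (simp add: \<kappa>_def)
  have "(r - b) * r \<le> (r - b) * (r + b)" using b r by (intro mult_left_mono) auto
  also have "\<dots> = l\<^sup>2 / 4" using b(3) by (simp add: algebra_simps power2_eq_square)
  finally have rb: "r - b \<le> l\<^sup>2 / (4 * r)" using r by (simp add: field_simps)
  have "sin (b * t) / b - sin (r * t) / r = (sin (b * t) - sin (r * t)) / b + sin (r * t) * ((r - b) / (b * r))"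
    using b(1) r by (simp add: field_simps)
  also have "\<bar>\<dots>\<bar> \<le> \<bar>(sin (b * t) - sin (r * t)) / b\<bar> + \<bar>sin (r * t) * ((r - b) / (b * r))\<bar>"
    by (rule abs_triangle_ineq)
  also have "\<dots> \<le> (r - b) * t * (1 / b) + 1 * ((r - b) * (1 / b) / r)"
  proof (rule add_mono)
    have "\<bar>b * t - r * t\<bar> = (r - b) * t"
      using b(2) t by (simp add: abs_mult flip: left_diff_distrib)
    then have "\<bar>sin (b * t) - sin (r * t)\<bar> \<le> (r - b) * t"
      using abs_sin_diff_le[of "b * t" "r * t"] by simp
    then show "\<bar>(sin (b * t) - sin (r * t)) / b\<bar> \<le> (r - b) * t * (1 / b)"
      using b(1) by (simp add: divide_right_mono)
    show "\<bar>sin (r * t) * ((r - b) / (b * r))\<bar> \<le> 1 * ((r - b) * (1 / b) / r)"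
      unfolding abs_mult using b r by (intro mult_mono) auto
  qed
  also have "\<dots> \<le> l\<^sup>2 / (4 * r) * t * (\<kappa> / r) + 1 * (l\<^sup>2 / (4 * r) * (\<kappa> / r) / r)"
    using b r t rb \<kappa> by (intro add_mono mult_mono divide_right_mono mult_nonneg_nonneg) auto
  also have "\<dots> = \<kappa> * (l * (t * l) / (4 * r\<^sup>2) + l * l / (4 * r\<^sup>2 * r))"
    using r by (simp add: field_simps power2_eq_square)
  \<comment> \<open>The term with \<open>t\<close> uses \<open>l \<le> r\<^sup>2\<close> for one
    factor \<open>l\<close>; the other uses \<open>l \<le> r\<^sup>2\<close> and
    \<open>l \<le> r\<close>, so that no negative power of \<open>r\<close> is left at low
    frequency.\<close>
  also have "\<dots> \<le> \<kappa> * (r\<^sup>2 * (t * l) / (4 * r\<^sup>2) + r\<^sup>2 * r / (4 * r\<^sup>2 * r))"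
    using l r t \<kappa> by (intro mult_left_mono add_mono divide_right_mono mult_mono) auto
  also have "\<dots> = \<kappa> * (1 / 4 + l * t / 4)"
    using r by (simp add: field_simps)
  also have "\<dots> \<le> \<kappa> * (1 + l * t / 4)"
    using \<kappa> by (intro mult_left_mono) auto
  finally have "\<bar>sin (b * t) / b - sin (r * t) / r\<bar> \<le> \<kappa> * (1 + l * t / 4)" .
  then have "exp (- l * t / 2) * \<bar>sin (b * t) / b - sin (r * t) / r\<bar> \<le> exp (- l * t / 2) * (\<kappa> * (1 + l * t / 4))"
    by (rule mult_left_mono) simp
  moreover have "prop1 r t - exp (- damping r * t / 2) * (sin (r * t) / r)
      = exp (- l * t / 2) * (sin (b * t) / b - sin (r * t) / r)"
    by (simp add: prop1_def b_def l_def right_diff_distrib)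
  ultimately show ?thesis by (simp add: abs_mult l_def \<kappa>_def)
qed

text \<open>The phase differs from 1 by at most \<open>\<bar>x \<bullet> \<xi>\<bar>\<close>. The
  factor \<open>norm \<xi>\<close> gained here compensates the singularity \<open>1 / r\<close> of
  \<open>prop1\<close>, at the price of a first moment of the data.\<close>

lemma fourier_L1_minus_integral_le:
  fixes f :: "'a::euclidean_space \<Rightarrow> complex"
  assumes f: "integrable lborel f" and xf: "integrable lborel (\<lambda>x. norm x * cmod (f x))"
  shows "cmod (fourier_L1 f \<xi> - (\<integral>x. f x \<partial>lborel)) \<le> norm \<xi> * (\<integral>x. norm x * cmod (f x) \<partial>lborel)"
proof -
  have "fourier_L1 f \<xi> - (\<integral>x. f x \<partial>lborel) = (\<integral>x. exp (- \<i> * complex_of_real (x \<bullet> \<xi>)) * f x - f x \<partial>lborel)"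
    unfolding fourier_L1_def using f by (simp add: integrable_exp_mult[simplified])
  also have "cmod \<dots> \<le> (\<integral>x. norm \<xi> * (norm x * cmod (f x)) \<partial>lborel)"
  proof (rule Bochner_Integration.integral_norm_bound_integral)
    show "integrable lborel (\<lambda>x. exp (- \<i> * complex_of_real (x \<bullet> \<xi>)) * f x - f x)"
      using f by (intro Bochner_Integration.integrable_diff integrable_exp_mult)
    show "integrable lborel (\<lambda>x. norm \<xi> * (norm x * cmod (f x)))" using xf by simp
    fix x :: 'a
    have "cmod (exp (\<i> * complex_of_real (- (x \<bullet> \<xi>))) - 1) \<le> \<bar>- (x \<bullet> \<xi>)\<bar>"
      using iexp_approx1[of "- (x \<bullet> \<xi>)" 0] by simp
    also have "\<dots> \<le> norm \<xi> * norm x" using Cauchy_Schwarz_ineq2[of x \<xi>] by (simp add: mult.commute)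
    finally have "cmod (exp (- \<i> * complex_of_real (x \<bullet> \<xi>)) - 1) \<le> norm \<xi> * norm x" by simp
    then have "cmod ((exp (- \<i> * complex_of_real (x \<bullet> \<xi>)) - 1) * f x) \<le> norm \<xi> * norm x * cmod (f x)"
      unfolding norm_mult by (rule mult_right_mono) simp
    then show "cmod (exp (- \<i> * complex_of_real (x \<bullet> \<xi>)) * f x - f x) \<le> norm \<xi> * (norm x * cmod (f x))"
      by (simp add: left_diff_distrib mult.assoc)
  qed
  finally show ?thesis by simp
qed

section \<open>The integral of the damping factor\<close>

lemma integrable_inverse_1_plus_square_real: "integrable lborel (\<lambda>x::real. inverse (1 + x\<^sup>2))"
  using integrable_inverse_1_plus_square by (simp add: set_integrable_def)

text \<open>Each coordinate is at most the norm, so the product of the one-dimensional functions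
  \<open>1 / (1 + x\<^sup>2)\<close> is a majorant.\<close>

lemma integrable_inverse_weight_power:
  "integrable lborel (\<lambda>\<xi>::'a::euclidean_space. inverse ((1 + (norm \<xi>)\<^sup>2) ^ DIM('a)))"
proof (rule Bochner_Integration.integrable_bound)
  show "integrable lborel (\<lambda>\<xi>::'a. \<Prod>b\<in>Basis. inverse (1 + (\<xi> \<bullet> b)\<^sup>2))"
    by (intro lborel_prod_Basis(1) integrable_inverse_1_plus_square_real)
  have "inverse ((1 + (norm \<xi>)\<^sup>2) ^ DIM('a)) \<le> (\<Prod>b\<in>Basis. inverse (1 + (\<xi> \<bullet> b)\<^sup>2))" for \<xi> :: 'a
  proof -
    have "(\<Prod>b\<in>(Basis::'a set). 1 + (\<xi> \<bullet> b)\<^sup>2) \<le> (\<Prod>b\<in>(Basis::'a set). 1 + (norm \<xi>)\<^sup>2)"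
    proof (rule prod_mono)
      fix b :: 'a assume "b \<in> Basis"
      then have "(\<xi> \<bullet> b)\<^sup>2 \<le> (norm \<xi>)\<^sup>2"
        using Basis_le_norm[of b \<xi>] by (metis abs_ge_zero power2_abs power_mono)
      then show "0 \<le> 1 + (\<xi> \<bullet> b)\<^sup>2 \<and> 1 + (\<xi> \<bullet> b)\<^sup>2 \<le> 1 + (norm \<xi>)\<^sup>2" by simp
    qed
    moreover have "(\<Prod>b\<in>(Basis::'a set). 1 + (\<xi> \<bullet> b)\<^sup>2) > 0"
      by (intro prod_pos) (simp add: add_pos_nonneg)
    ultimately have "inverse (\<Prod>b\<in>(Basis::'a set). 1 + (norm \<xi>)\<^sup>2) \<le> inverse (\<Prod>b\<in>(Basis::'a set). 1 + (\<xi> \<bullet> b)\<^sup>2)"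
      by (rule le_imp_inverse_le)
    then show ?thesis by (simp add: prod_inversef[symmetric] comp_def)
  qed
  moreover have "(\<Prod>b\<in>Basis. inverse (1 + (\<xi> \<bullet> b)\<^sup>2)) \<ge> 0" for \<xi> :: 'a
    by (intro prod_nonneg) simp
  ultimately show "AE \<xi> in lborel. norm (inverse ((1 + (norm \<xi>)\<^sup>2) ^ DIM('a))) \<le> norm (\<Prod>b\<in>Basis. inverse (1 + ((\<xi>::'a) \<bullet> b)\<^sup>2))"
    by (auto simp: abs_of_nonneg)
qed measurable

text \<open>The frequencies are split at modulus 1. Inside, a lower bound for the logarithm gives a
  Gaussian; outside, the factor is exponentially small in \<open>t\<close> times an integrable
  function that does not depend on \<open>t\<close>.\<close>

lemma damping_factor_le:
  fixes \<xi> :: "'a::euclidean_space"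
  assumes t: "t \<ge> 2 * real n"
  shows "(1 + (norm \<xi>)\<^sup>2) powr (- t / 2)
    \<le> gaussian (sqrt (t / 2)) \<xi> + 2 powr (real n - t / 2) * inverse ((1 + (norm \<xi>)\<^sup>2) ^ n)"
proof -
  define x where "x = (norm \<xi>)\<^sup>2"
  have x: "x \<ge> 0" by (simp add: x_def)
  have t0: "t \<ge> 0" using t by (meson of_nat_0_le_iff mult_nonneg_nonneg order_trans zero_le_numeral)
  have "gaussian (sqrt (t / 2)) \<xi> = exp (- (t / 2) * (x / 2))"
    using t0 by (simp add: gaussian_def x_def power_mult_distrib)
  moreover have "(1 + x) powr (- t / 2) \<le> exp (- (t / 2) * (x / 2)) + 2 powr (real n - t / 2) * inverse ((1 + x) ^ n)"
  proof (cases "x \<le> 1")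
    case True
    \<comment> \<open>The loss of a factor 2 in the exponent turns \<open>2 pi / t\<close> into
      \<open>4 pi / t\<close> in the Gaussian integral; the final constant tolerates this.\<close>
    have "x / 2 \<le> x / (1 + x)" using x True by (intro divide_left_mono) auto
    also have "x / (1 + x) \<le> ln (1 + x)"
    proof -
      have "ln (inverse (1 + x)) = - ln (1 + x)"
        by (rule ln_inverse)
      moreover have "inverse (1 + x) - 1 = - (x / (1 + x))"
        using x by (simp add: field_simps)
      ultimately show ?thesis using ln_le_minus_one[of "inverse (1 + x)"] x by simp
    qed
    finally have "t / 2 * (x / 2) \<le> t / 2 * ln (1 + x)" using t0 by (intro mult_left_mono) auto
    then have "(1 + x) powr (- t / 2) \<le> exp (- (t / 2) * (x / 2))" using x by (simp add: powr_def)
    moreover have "0 \<le> 2 powr (real n - t / 2) * inverse ((1 + x) ^ n)" using x by simp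
    ultimately show ?thesis by linarith
  next
    case False
    \<comment> \<open>The power \<open>- n\<close> is set aside for integrability. The remaining
      exponent is nonpositive because \<open>t \<ge> 2 * n\<close>, so that \<open>1 + x > 2\<close>
      may be replaced by 2.\<close>
    have "(1 + x) powr (- t / 2) = (1 + x) powr (real n - t / 2) * (1 + x) powr (- real n)"
      by (simp flip: powr_add)
    also have "\<dots> \<le> 2 powr (real n - t / 2) * (1 + x) powr (- real n)"
      using False t by (intro mult_right_mono powr_mono2') auto
    also have "(1 + x) powr (- real n) = inverse ((1 + x) ^ n)"
      using x by (simp add: powr_minus powr_realpow)
    finally show ?thesis by (simp add: add_increasing)
  qed
  ultimately show ?thesis by (simp add: x_def)
qed

lemma integral_damping_factor_le:
  obtains C where "C \<ge> 0"
    and "\<And>t. t \<ge> 2 * real DIM('a::euclidean_space) \<Longrightarrow> t > 0 \<Longrightarrow>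
      integrable lborel (\<lambda>\<xi>::'a. (1 + (norm \<xi>)\<^sup>2) powr (- t / 2)) \<and>
      (\<integral>\<xi>. (1 + (norm (\<xi>::'a))\<^sup>2) powr (- t / 2) \<partial>lborel) \<le> sqrt (4 * pi / t) ^ DIM('a) + C * 2 powr (- t / 2)"
proof -
  define J where "J = (\<integral>\<xi>. inverse ((1 + (norm (\<xi>::'a))\<^sup>2) ^ DIM('a)) \<partial>lborel)"
  have J: "J \<ge> 0" unfolding J_def by (rule Bochner_Integration.integral_nonneg) simp
  define C where "C = 2 ^ DIM('a) * J"
  have main: "integrable lborel (\<lambda>\<xi>::'a. (1 + (norm \<xi>)\<^sup>2) powr (- t / 2)) \<and>
      (\<integral>\<xi>. (1 + (norm (\<xi>::'a))\<^sup>2) powr (- t / 2) \<partial>lborel) \<le> sqrt (4 * pi / t) ^ DIM('a) + C * 2 powr (- t / 2)"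
    if t: "t \<ge> 2 * real DIM('a)" "t > 0" for t
  proof -
    let ?h = "\<lambda>\<xi>::'a. gaussian (sqrt (t / 2)) \<xi> + 2 powr (real DIM('a) - t / 2) * inverse ((1 + (norm \<xi>)\<^sup>2) ^ DIM('a))"
    have g: "integrable lborel (gaussian (sqrt (t / 2)) :: 'a \<Rightarrow> real)"
      by (rule gaussian_integrable) (use t in simp)
    have h: "integrable lborel ?h"
      using g integrable_inverse_weight_power[where 'a = 'a] by simp
    have int: "integrable lborel (\<lambda>\<xi>::'a. (1 + (norm \<xi>)\<^sup>2) powr (- t / 2))"
    proof (rule Bochner_Integration.integrable_bound[OF h])
      show "AE \<xi> in lborel. norm ((1 + (norm (\<xi>::'a))\<^sup>2) powr (- t / 2)) \<le> norm (?h \<xi>)"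
        unfolding real_norm_def abs_of_nonneg[OF powr_ge_zero]
        by (intro AE_I2 order_trans[OF damping_factor_le[OF t(1)] abs_ge_self])
    qed measurable
    have "(\<integral>\<xi>. (1 + (norm (\<xi>::'a))\<^sup>2) powr (- t / 2) \<partial>lborel) \<le> (\<integral>\<xi>. ?h \<xi> \<partial>lborel)"
      by (intro integral_mono int h damping_factor_le t)
    also have "\<dots> = (sqrt (2 * pi) / sqrt (t / 2)) ^ DIM('a) + 2 powr (real DIM('a) - t / 2) * J"
      using g integrable_inverse_weight_power[where 'a = 'a] t
      by (simp add: gaussian_integral J_def)
    also have "sqrt (2 * pi) / sqrt (t / 2) = sqrt (4 * pi / t)"
      by (simp flip: real_sqrt_divide)
    also have "2 powr (real DIM('a) - t / 2) * J = C * 2 powr (- t / 2)"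
    proof -
      have "2 powr (real DIM('a) - t / 2) = 2 powr real DIM('a) * 2 powr (- t / 2)"
        by (simp flip: powr_add)
      then show ?thesis by (simp add: C_def powr_realpow)
    qed
    finally show ?thesis using int by simp
  qed
  show thesis by (rule that[OF _ main]) (simp add: C_def J)
qed

text \<open>The Gaussian part leaves a positive margin \<open>\<delta>\<close>, since the ratio of
  \<open>(2 * pi) ^ n\<close> to \<open>sqrt (4 * pi) ^ n\<close> is \<open>sqrt pi ^ n\<close> and
  \<open>16 / 9 < pi\<close>. The exponentially small remainder fits into this margin once
  \<open>t\<close> is large; this is where the restriction to large \<open>t\<close>
  originates.\<close>

lemma eventually_damping_integral_le:
  "\<forall>\<^sub>F t in at_top. t > 0 \<and> integrable lborel (\<lambda>\<xi>::'a::euclidean_space. (1 + (norm \<xi>)\<^sup>2) powr (- t / 2)) \<and>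
    4 / 3 * (\<integral>\<xi>. (1 + (norm (\<xi>::'a))\<^sup>2) powr (- t / 2) \<partial>lborel) \<le> (2 * pi) ^ DIM('a) * t powr (- real DIM('a) / 2)"
proof -
  obtain C where C: "C \<ge> 0" and J: "\<And>t. t \<ge> 2 * real DIM('a) \<Longrightarrow> t > 0 \<Longrightarrow>
      integrable lborel (\<lambda>\<xi>::'a. (1 + (norm \<xi>)\<^sup>2) powr (- t / 2)) \<and>
      (\<integral>\<xi>. (1 + (norm (\<xi>::'a))\<^sup>2) powr (- t / 2) \<partial>lborel) \<le> sqrt (4 * pi / t) ^ DIM('a) + C * 2 powr (- t / 2)"
    using integral_damping_factor_le[where 'a = 'a] by blast
  define n where "n = DIM('a)"
  have n: "n \<ge> 1" by (simp add: n_def Suc_le_eq)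
  define \<delta> where "\<delta> = (2 * pi) ^ n - 4 / 3 * sqrt (4 * pi) ^ n"
  have "\<delta> > 0"
  proof -
    have "(4 / 3)\<^sup>2 < pi" using pi_gt3 by (simp add: power2_eq_square)
    then have "4 / 3 < sqrt pi" by (rule real_less_rsqrt)
    also have "sqrt pi = sqrt pi ^ 1" by simp
    also have "sqrt pi ^ 1 \<le> sqrt pi ^ n"
      using pi_gt3 n by (intro power_increasing) auto
    finally have "4 / 3 * sqrt (4 * pi) ^ n < sqrt pi ^ n * sqrt (4 * pi) ^ n"
      by (intro mult_strict_right_mono) auto
    also have "\<dots> = (2 * pi) ^ n"
    proof -
      have "sqrt pi * sqrt (4 * pi) = 2 * pi" by (simp add: real_sqrt_mult)
      then show ?thesis by (simp only: power_mult_distrib[symmetric])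
    qed
    finally show ?thesis by (simp add: \<delta>_def)
  qed
  have "((\<lambda>t. 4 / 3 * C * (2 powr (- t / 2) * t powr (real n / 2))) \<longlongrightarrow> 4 / 3 * C * 0) at_top"
    by (intro tendsto_mult tendsto_const) real_asymp
  then have "\<forall>\<^sub>F t in at_top. 4 / 3 * C * (2 powr (- t / 2) * t powr (real n / 2)) < \<delta>"
    using \<open>\<delta> > 0\<close> by (intro order_tendstoD) auto
  moreover have "\<forall>\<^sub>F t in at_top. t \<ge> 2 * real DIM('a)" by (rule eventually_ge_at_top)
  moreover have "\<forall>\<^sub>F t in at_top. t > (0::real)" by (rule eventually_gt_at_top)
  ultimately show ?thesis
  proof eventually_elim
    fix t :: real
    assume small: "4 / 3 * C * (2 powr (- t / 2) * t powr (real n / 2)) < \<delta>" and t: "t \<ge> 2 * real DIM('a)" "t > 0"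
    have tn: "t powr (real n / 2) * t powr (- real n / 2) = 1" using t by (simp flip: powr_add)
    have sq: "sqrt (4 * pi / t) ^ n = sqrt (4 * pi) ^ n * t powr (- real n / 2)"
    proof -
      have "sqrt t ^ n = t powr (real n / 2)"
        using t by (simp add: powr_half_sqrt[symmetric] powr_powr flip: powr_realpow)
      then show ?thesis
        using t by (simp add: real_sqrt_divide power_divide powr_minus field_simps)
    qed
    have "4 / 3 * (C * 2 powr (- t / 2)) = (4 / 3 * C * (2 powr (- t / 2) * t powr (real n / 2))) * t powr (- real n / 2)"
      using tn by (simp add: mult.assoc)
    also have "\<dots> \<le> \<delta> * t powr (- real n / 2)"
      using small by (intro mult_right_mono) auto
    finally have "4 / 3 * (sqrt (4 * pi / t) ^ n + C * 2 powr (- t / 2)) \<le> 4 / 3 * (sqrt (4 * pi) ^ n * t powr (- real n / 2)) + \<delta> * t powr (- real n / 2)"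
      by (simp add: sq distrib_left)
    also have "\<dots> = (2 * pi) ^ n * t powr (- real n / 2)"
      by (simp add: \<delta>_def algebra_simps)
    finally have fin: "4 / 3 * (sqrt (4 * pi / t) ^ n + C * 2 powr (- t / 2)) \<le> (2 * pi) ^ n * t powr (- real n / 2)" .
    show "t > 0 \<and> integrable lborel (\<lambda>\<xi>::'a. (1 + (norm \<xi>)\<^sup>2) powr (- t / 2)) \<and>
      4 / 3 * (\<integral>\<xi>. (1 + (norm (\<xi>::'a))\<^sup>2) powr (- t / 2) \<partial>lborel) \<le> (2 * pi) ^ DIM('a) * t powr (- real DIM('a) / 2)"
    proof (intro conjI)
      show "4 / 3 * (\<integral>\<xi>. (1 + (norm (\<xi>::'a))\<^sup>2) powr (- t / 2) \<partial>lborel) \<le> (2 * pi) ^ DIM('a) * t powr (- real DIM('a) / 2)"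
        by (rule order_trans[OF mult_left_mono[OF conjunct2[OF J[OF t]]] fin[unfolded n_def]]) simp
    qed (use J[OF t] t(2) in auto)
  qed
qed

section \<open>The asymptotic profile\<close>

text \<open>With \<open>b = (b - p) + p\<close> the difference has three parts: the response to
  \<open>u0\<close>, the response to the oscillation of the transform of \<open>u1\<close>, and the
  error of the wave profile for the mass \<open>p\<close>. They are bounded by a common factor times
  \<open>A\<close>, \<open>B\<close> and \<open>P\<close>.\<close>

lemma fourier_difference_le:
  fixes \<xi> :: "'a::euclidean_space"
  assumes \<xi>: "\<xi> \<noteq> 0" and t: "t \<ge> 0"
    and a: "cmod a \<le> A" and b: "cmod (b - p) \<le> norm \<xi> * B" and p: "cmod p \<le> P"
  shows "(cmod (complex_of_real (prop0 (norm \<xi>) t) * a + complex_of_real (prop1 (norm \<xi>) t) * b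
      - p * complex_of_real ((1 + (norm \<xi>)\<^sup>2) powr (- t / 2) * (sin (norm \<xi> * t) / norm \<xi>))))\<^sup>2
    \<le> 4 / 3 * (A + B + P)\<^sup>2 * (1 + (norm \<xi>)\<^sup>2) powr (- t / 2)"
proof -
  define r where "r = norm \<xi>"
  have r: "r > 0" using \<xi> by (simp add: r_def)
  define E \<kappa> l where "E = exp (- damping r * t / 2)" and "\<kappa> = 2 / sqrt 3" and "l = damping r"
  have E: "(1 + (norm \<xi>)\<^sup>2) powr (- t / 2) = E"
    using one_plus_norm_sq_pos[of \<xi>] by (simp add: powr_def E_def damping_def r_def)
  have l: "l \<ge> 0" unfolding l_def by (rule damping_bounds)
  have pos: "A \<ge> 0" "P \<ge> 0" "B \<ge> 0" "E > 0" "\<kappa> > 0"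
    using order_trans[OF norm_ge_zero a] order_trans[OF norm_ge_zero p] order_trans[OF norm_ge_zero b] r
    by (auto simp: E_def \<kappa>_def r_def zero_le_mult_iff)
  have 1: "cmod (complex_of_real (prop0 r t) * a) \<le> E * \<kappa> * A"
    unfolding norm_mult using prop0_le[OF r, of t] a pos by (intro mult_mono) (auto simp: E_def \<kappa>_def)
  have "cmod (complex_of_real (prop1 r t) * (b - p)) \<le> (E * (\<kappa> / r)) * (r * B)"
    unfolding norm_mult using prop1_le[OF r, of t] b pos r
    by (intro mult_mono) (auto simp: E_def \<kappa>_def r_def)
  also have "\<dots> = E * \<kappa> * B" using r by simp
  finally have 2: "cmod (complex_of_real (prop1 r t) * (b - p)) \<le> E * \<kappa> * B" .
  have 3: "cmod (complex_of_real (prop1 r t - E * (sin (r * t) / r)) * p) \<le> E * (\<kappa> * (1 + l * t / 4)) * P"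
  proof -
    have "\<bar>prop1 r t - E * (sin (r * t) / r)\<bar> \<le> E * (\<kappa> * (1 + l * t / 4))"
      unfolding E_def \<kappa>_def l_def by (rule prop1_minus_wave_le[OF r t])
    then show ?thesis
      unfolding norm_mult norm_of_real using p pos l t by (intro mult_mono) auto
  qed
  define D where "D = complex_of_real (prop0 (norm \<xi>) t) * a + complex_of_real (prop1 (norm \<xi>) t) * b
      - p * complex_of_real ((1 + (norm \<xi>)\<^sup>2) powr (- t / 2) * (sin (norm \<xi> * t) / norm \<xi>))"
  have "D = complex_of_real (prop0 r t) * a + complex_of_real (prop1 r t) * (b - p)
      + complex_of_real (prop1 r t - E * (sin (r * t) / r)) * p"
    unfolding D_def E by (simp add: r_def algebra_simps)
  then have "cmod D \<le> E * \<kappa> * A + E * \<kappa> * B + E * (\<kappa> * (1 + l * t / 4)) * P"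
    using norm_triangle_le[OF add_mono[OF norm_triangle_le[OF add_mono[OF 1 2]] 3]] by simp
  also have "\<dots> \<le> E * \<kappa> * (1 + l * t / 4) * A + E * \<kappa> * (1 + l * t / 4) * B + E * \<kappa> * (1 + l * t / 4) * P"
  proof -
    have "E * \<kappa> * 1 \<le> E * \<kappa> * (1 + l * t / 4)" using pos l t by (intro mult_left_mono) auto
    then have "E * \<kappa> * X \<le> E * \<kappa> * (1 + l * t / 4) * X" if "X \<ge> 0" for X
      using that by (intro mult_right_mono) auto
    from add_mono[OF this[OF pos(1)] this[OF pos(3)]] show ?thesis by (simp add: mult.assoc)
  qed
  also have "\<dots> = E * \<kappa> * (1 + l * t / 4) * (A + B + P)" by (simp add: algebra_simps)
  also have "\<dots> \<le> E * \<kappa> * exp (l * t / 4) * (A + B + P)"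
    using exp_ge_add_one_self[of "l * t / 4"] pos by (intro mult_right_mono mult_left_mono) auto
  finally have "(cmod D)\<^sup>2 \<le> (E * \<kappa> * exp (l * t / 4) * (A + B + P))\<^sup>2"
    by (rule power_mono) simp
  also have "\<dots> = \<kappa>\<^sup>2 * (A + B + P)\<^sup>2 * (E * exp (l * t / 4))\<^sup>2"
    by (simp add: power_mult_distrib)
  \<comment> \<open>The loss \<open>exp (l t / 4)\<close> is chosen so that the square of the decay
    left over is \<open>E\<close>, which is again the damping factor.\<close>
  also have "(E * exp (l * t / 4))\<^sup>2 = E"
    by (simp add: E_def l_def power2_eq_square flip: exp_add)
  also have "\<kappa>\<^sup>2 = 4 / 3" by (simp add: \<kappa>_def power_divide)
  finally show ?thesis unfolding D_def E .
qed

text \<open>Square integrability makes \<open>inv_fourier\<close> of the profile meaningful. The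
  singular quotient is bounded by \<open>t\<close>, and the damping factor, being at most 1,
  dominates its own square.\<close>

lemma wave_profile_L2:
  assumes t: "t > 0" and int: "integrable lborel (\<lambda>\<xi>::'a::euclidean_space. (1 + (norm \<xi>)\<^sup>2) powr (- t / 2))"
  shows "(\<lambda>\<xi>::'a. complex_of_real ((1 + (norm \<xi>)\<^sup>2) powr (- t / 2) * (sin (norm \<xi> * t) / norm \<xi>))) \<in> L2_space"
proof (rule L2_spaceI)
  show "(\<lambda>\<xi>::'a. complex_of_real ((1 + (norm \<xi>)\<^sup>2) powr (- t / 2) * (sin (norm \<xi> * t) / norm \<xi>))) \<in> borel_measurable borel"
    by measurable
  show "integrable lborel (\<lambda>\<xi>::'a. (cmod (complex_of_real ((1 + (norm \<xi>)\<^sup>2) powr (- t / 2) * (sin (norm \<xi> * t) / norm \<xi>))))\<^sup>2)"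
  proof (rule Bochner_Integration.integrable_bound)
    show "integrable lborel (\<lambda>\<xi>::'a. t\<^sup>2 * (1 + (norm \<xi>)\<^sup>2) powr (- t / 2))" using int by simp
    show "AE \<xi> in lborel. norm ((cmod (complex_of_real ((1 + (norm \<xi>)\<^sup>2) powr (- t / 2) * (sin (norm \<xi> * t) / norm \<xi>))))\<^sup>2)
        \<le> norm (t\<^sup>2 * (1 + (norm (\<xi>::'a))\<^sup>2) powr (- t / 2))"
    proof (rule AE_I2)
      fix \<xi> :: 'a
      define w s where "w = (1 + (norm \<xi>)\<^sup>2) powr (- t / 2)" and "s = sin (norm \<xi> * t) / norm \<xi>"
      have "w \<le> (1 + (norm \<xi>)\<^sup>2) powr 0" unfolding w_def by (rule powr_mono) (use t in auto)
      then have w: "0 \<le> w" "w \<le> 1" using one_plus_norm_sq_pos[of \<xi>] by (simp_all add: w_def)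
      have "\<bar>s\<bar> \<le> \<bar>t\<bar>"
      \<comment> \<open>At the origin the quotient is 0 by the convention on division, so the bound
        holds there as well.\<close>
      proof (cases "\<xi> = 0")
        case False
        have "\<bar>sin (norm \<xi> * t)\<bar> \<le> norm \<xi> * t" using abs_sin_x_le_abs_x[of "norm \<xi> * t"] t by simp
        then show ?thesis using False t by (simp add: s_def field_simps)
      qed (use t in \<open>simp add: s_def\<close>)
      then have "s\<^sup>2 \<le> t\<^sup>2" by (simp only: abs_le_square_iff)
      moreover have "w\<^sup>2 \<le> w" using w by (simp add: power2_eq_square mult_left_le)
      ultimately have "w\<^sup>2 * s\<^sup>2 \<le> w * t\<^sup>2" using w by (intro mult_mono) auto
      then have "norm ((cmod (complex_of_real (w * s)))\<^sup>2) \<le> norm (t\<^sup>2 * w)"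
        using w by (simp add: norm_mult power_mult_distrib abs_mult mult.commute)
      then show "norm ((cmod (complex_of_real ((1 + (norm \<xi>)\<^sup>2) powr (- t / 2) * (sin (norm \<xi> * t) / norm \<xi>))))\<^sup>2)
          \<le> norm (t\<^sup>2 * (1 + (norm \<xi>)\<^sup>2) powr (- t / 2))"
        by (simp only: w_def s_def)
    qed
  qed measurable
qed

text \<open>Membership in \<open>L2_space\<close> is part of the conclusion because
  \<open>L2_norm\<close> returns 0 when the squared modulus is not integrable, which would make the
  norm bound alone too weak.\<close>

theorem theorem1p1:
  fixes u0 u1 :: "'a::euclidean_space \<Rightarrow> complex"
    and u :: "real \<Rightarrow> 'a \<Rightarrow> complex"
    and I0 :: real
  assumes "u0 \<in> sobolev_space 1 \<inter> L1_space"
    and "u1 \<in> L2_space \<inter> L11_space"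
    and "mild_solution u0 u1 u"
    and "I0 = L2_norm u0 + L2_norm u1 + L1_norm u0
              + L1_norm (\<lambda>x. complex_of_real (1 + norm x) * u1 x)"
  shows "\<forall>\<^sub>F t in at_top.
    (let d = (\<lambda>x. u t x - (\<integral>y. u1 y \<partial>lborel) *
                 inv_fourier (\<lambda>\<xi>. complex_of_real
                   ((1 + (norm \<xi>)\<^sup>2) powr (- t / 2) * (sin (norm \<xi> * t) / norm \<xi>))) x)
     in d \<in> L2_space \<and> L2_norm d \<le> I0 * t powr (- real DIM('a) / 4))"
proof -
  have u0: "u0 \<in> sobolev_space 1" "u0 \<in> L2_space" "integrable lborel u0"
    using assms(1) by (auto simp: L1_space_def sobolev_space_L2)
  have u1: "u1 \<in> L2_space" "integrable lborel u1" "integrable lborel (\<lambda>x. (1 + norm x) * cmod (u1 x))"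
    using assms(2) by (auto simp: L11_space_def L1_space_def)
  have u1': "integrable lborel (\<lambda>x. norm x * cmod (u1 x))"
    using Bochner_Integration.integrable_diff[OF u1(3) integrable_norm[OF u1(2)]] by (simp add: distrib_right)
  define A B P where "A = L1_norm u0" and "B = (\<integral>x. norm x * cmod (u1 x) \<partial>lborel)" and "P = L1_norm u1"
  define p where "p = (\<integral>y. u1 y \<partial>lborel)"
  have p: "cmod p \<le> P" unfolding p_def P_def L1_norm_def by (rule integral_norm_bound)
  \<comment> \<open>The weight \<open>1 + norm x\<close> splits into the two quantities in which
    \<open>u1\<close> enters, so their sum is paid for by a single term of
    \<open>I0\<close>.\<close>
  have "L1_norm (\<lambda>x. complex_of_real (1 + norm x) * u1 x) = (\<integral>x. cmod (u1 x) + norm x * cmod (u1 x) \<partial>lborel)"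
    unfolding L1_norm_def norm_mult norm_of_real by (simp add: distrib_right)
  also have "\<dots> = P + B"
    using u1(2) u1' by (simp add: P_def B_def L1_norm_def)
  finally have BP: "L1_norm (\<lambda>x. complex_of_real (1 + norm x) * u1 x) = P + B" .
  have "L2_norm u0 \<ge> 0" "L2_norm u1 \<ge> 0" by (simp_all add: L2_norm_def)
  then have I0: "A + B + P \<le> I0" unfolding assms(4) BP A_def by linarith
  have ABP: "A + B + P \<ge> 0" by (simp add: A_def B_def P_def L1_norm_def)
  show ?thesis
    using eventually_damping_integral_le[where 'a = 'a]
  proof eventually_elim
    fix t :: real
    define g where "g \<xi> = complex_of_real ((1 + (norm \<xi>)\<^sup>2) powr (- t / 2) * (sin (norm \<xi> * t) / norm \<xi>))" for \<xi> :: 'a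
    define d where "d x = u t x - p * inv_fourier g x" for x
    assume "t > 0 \<and> integrable lborel (\<lambda>\<xi>::'a. (1 + (norm \<xi>)\<^sup>2) powr (- t / 2)) \<and>
      4 / 3 * (\<integral>\<xi>. (1 + (norm (\<xi>::'a))\<^sup>2) powr (- t / 2) \<partial>lborel) \<le> (2 * pi) ^ DIM('a) * t powr (- real DIM('a) / 2)"
    then have t: "t > 0" and int: "integrable lborel (\<lambda>\<xi>::'a. (1 + (norm \<xi>)\<^sup>2) powr (- t / 2))"
      and J: "4 / 3 * (\<integral>\<xi>. (1 + (norm (\<xi>::'a))\<^sup>2) powr (- t / 2) \<partial>lborel) \<le> (2 * pi) ^ DIM('a) * t powr (- real DIM('a) / 2)"
      by auto
    have g: "g \<in> L2_space" unfolding g_def[abs_def] by (rule wave_profile_L2[OF t int])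
    have "u t \<in> sobolev_space 1"
      using assms(3) t unfolding mild_solution_def by auto
    then have ut: "u t \<in> L2_space" by (rule sobolev_space_L2)
    have pg: "(\<lambda>x. p * inv_fourier g x) \<in> L2_space" by (intro L2_space_cmult inv_fourier g)
    have d: "d \<in> L2_space" unfolding d_def[abs_def] by (rule L2_space_diff[OF ut pg])
    have "AE \<xi> in lborel. fourier d \<xi> = complex_of_real (prop0 (norm \<xi>) t) * fourier_L1 u0 \<xi>
        + complex_of_real (prop1 (norm \<xi>) t) * fourier_L1 u1 \<xi> - p * g \<xi>"
      using fourier_diff[OF ut pg, folded d_def] fourier_cmult[OF inv_fourier(1)[OF g], of p]
        inv_fourier(2)[OF g] fourier_mild_solution[OF u0(1) u1(1) assms(3) less_imp_le[OF t]]
        fourier_L1_fourier[OF u0(3,2)] fourier_L1_fourier[OF u1(2,1)]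
      by eventually_elim simp
    moreover have "AE \<xi> in lborel. \<xi> \<noteq> (0 :: 'a)" by (rule AE_lborel_singleton)
    ultimately have bound: "AE \<xi> in lborel. (cmod (fourier d \<xi>))\<^sup>2 \<le> 4 / 3 * (A + B + P)\<^sup>2 * (1 + (norm \<xi>)\<^sup>2) powr (- t / 2)"
    proof eventually_elim
      fix \<xi> :: 'a
      assume e: "fourier d \<xi> = complex_of_real (prop0 (norm \<xi>) t) * fourier_L1 u0 \<xi>
        + complex_of_real (prop1 (norm \<xi>) t) * fourier_L1 u1 \<xi> - p * g \<xi>" and "\<xi> \<noteq> 0"
      show "(cmod (fourier d \<xi>))\<^sup>2 \<le> 4 / 3 * (A + B + P)\<^sup>2 * (1 + (norm \<xi>)\<^sup>2) powr (- t / 2)"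
        unfolding e g_def
      proof (rule fourier_difference_le[OF \<open>\<xi> \<noteq> 0\<close> less_imp_le[OF t] _ _ p])
        show "cmod (fourier_L1 u0 \<xi>) \<le> A" unfolding A_def by (rule norm_fourier_L1_le)
        show "cmod (fourier_L1 u1 \<xi> - p) \<le> norm \<xi> * B"
          unfolding B_def p_def by (rule fourier_L1_minus_integral_le[OF u1(2) u1'])
      qed
    qed
    have "(2 * pi) ^ DIM('a) * (L2_norm d)\<^sup>2 = (norm (fourier_l2 (to_l2 d)))\<^sup>2"
      by (simp add: norm_fourier_l2 norm_to_l2 d power_mult_distrib plancherel_const_def)
    also have "\<dots> = (\<integral>\<xi>. (cmod (fourier d \<xi>))\<^sup>2 \<partial>lborel)"
      by (simp add: fourier_l2_to_l2 d norm_to_l2_sq fourier_spec)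
    also have "\<dots> \<le> (\<integral>\<xi>. 4 / 3 * (A + B + P)\<^sup>2 * (1 + (norm (\<xi>::'a))\<^sup>2) powr (- t / 2) \<partial>lborel)"
      by (rule integral_mono_AE[OF L2_space_integrable[OF fourier_spec(1)[OF d]] _ bound]) (use int in simp)
    also have "\<dots> = (A + B + P)\<^sup>2 * (4 / 3 * (\<integral>\<xi>. (1 + (norm (\<xi>::'a))\<^sup>2) powr (- t / 2) \<partial>lborel))"
      by simp
    also have "\<dots> \<le> (A + B + P)\<^sup>2 * ((2 * pi) ^ DIM('a) * t powr (- real DIM('a) / 2))"
      by (intro mult_left_mono J) simp
    finally have "(2 * pi) ^ DIM('a) * (L2_norm d)\<^sup>2 \<le> (2 * pi) ^ DIM('a) * ((A + B + P)\<^sup>2 * t powr (- real DIM('a) / 2))"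
      by (simp add: mult_ac)
    then have "(L2_norm d)\<^sup>2 \<le> (A + B + P)\<^sup>2 * t powr (- real DIM('a) / 2)"
      by (rule mult_left_le_imp_le) simp
    also have "\<dots> = ((A + B + P) * t powr (- real DIM('a) / 4))\<^sup>2"
      by (simp add: power_mult_distrib power2_eq_square flip: powr_add)
    finally have "L2_norm d \<le> (A + B + P) * t powr (- real DIM('a) / 4)"
      using ABP by (auto intro: power2_le_imp_le)
    also have "\<dots> \<le> I0 * t powr (- real DIM('a) / 4)"
      using I0 by (rule mult_right_mono) simp
    finally show "let d = (\<lambda>x. u t x - (\<integral>y. u1 y \<partial>lborel) *
                 inv_fourier (\<lambda>\<xi>. complex_of_real
                   ((1 + (norm \<xi>)\<^sup>2) powr (- t / 2) * (sin (norm \<xi> * t) / norm \<xi>))) x)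
     in d \<in> L2_space \<and> L2_norm d \<le> I0 * t powr (- real DIM('a) / 4)"
      using d unfolding Let_def d_def[abs_def] g_def[abs_def] p_def by blast
  qed
qed

end
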